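(* Every exactly definable additive category has split idempotents, pseudocokernels and pseudokernels.
   Context: An additive category $\mathcal{C}$ is exactly definable if it is equivalent to the category $\mathrm{Ex}(\mathcal{A}^{\mathrm{op}},\mathrm{Ab})$ of exact (additive) functors $\mathcal{A}^{\mathrm{op}}\to\mathrm{Ab}$ for some (skeletally) small abelian category $\mathcal{A}$ (with natural transformations as morphisms). Equivalently (known), $\mathcal{C}$ is equivalent to the full subcategory of FP-injective objects of a locally coherent Grothendieck category $\mathcal{G}$, where $Y$ is FP-injective if $\operatorname{Ext}^1_{\mathcal{G}}(F,Y)=0$ for every finitely presented object $F$; a Grothendieck category is locally coherent if it is finitely accessible (its finitely presented objects form a skeletally small subcategory and every object is a direct limit of finitely presented objects) and the finitely presented objects are closed under kernels. A category has pseudokernels (pseudocokernels) if every morphism has one. A pseudokernel of $f:A\to B$ is $k:K\to A$ with $fk=0$ through which every $k':K'\to A$ with $fk'=0$ factors (not necessarily uniquely); pseudocokernels are dual. Split idempotents: each idempotent $e:A\to A$ factors as $e=ip$ with $pi=1$. *)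

theory Defs
  imports "HOL-Algebra.Group" "HOL-Library.FuncSet" "HOL-Library.Equipollence"
begin

section \<open>Preadditive, additive and abelian categories\<close>

text \<open>
  Each hom-set carries its group structure and is written multiplicatively, so that
  the one of \<open>Hom C a b\<close> is the zero morphism and its multiplication is the addition of
  morphisms. Hom-sets of different pairs of objects need not be disjoint, so composition is
  indexed by objects: \<open>cmp C a b c g f\<close> is the composite of \<open>f : a \<rightarrow> b\<close> and \<open>g : b \<rightarrow> c\<close>.
\<close>

record ('o, 'm) category =
  obj :: "'o set"
  Hom :: "'o \<Rightarrow> 'o \<Rightarrow> 'm monoid"
  idt :: "'o \<Rightarrow> 'm"
  cmp :: "'o \<Rightarrow> 'o \<Rightarrow> 'o \<Rightarrow> 'm \<Rightarrow> 'm \<Rightarrow> 'm"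

abbreviation arr :: "('o, 'm) category \<Rightarrow> 'o \<Rightarrow> 'o \<Rightarrow> 'm set" where
  "arr C a b \<equiv> carrier (Hom C a b)"

abbreviation zero_arr :: "('o, 'm) category \<Rightarrow> 'o \<Rightarrow> 'o \<Rightarrow> 'm" where
  "zero_arr C a b \<equiv> one (Hom C a b)"

locale preadditive_category =
  fixes C :: "('o, 'm) category"
  assumes hom_group: "\<lbrakk>a \<in> obj C; b \<in> obj C\<rbrakk> \<Longrightarrow> comm_group (Hom C a b)"
    and idt_closed: "a \<in> obj C \<Longrightarrow> idt C a \<in> arr C a a"
    and cmp_closed: "\<lbrakk>a \<in> obj C; b \<in> obj C; c \<in> obj C; f \<in> arr C a b; g \<in> arr C b c\<rbrakk>
      \<Longrightarrow> cmp C a b c g f \<in> arr C a c"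
    and cmp_idt_right: "\<lbrakk>a \<in> obj C; b \<in> obj C; f \<in> arr C a b\<rbrakk> \<Longrightarrow> cmp C a a b f (idt C a) = f"
    and cmp_idt_left: "\<lbrakk>a \<in> obj C; b \<in> obj C; f \<in> arr C a b\<rbrakk> \<Longrightarrow> cmp C a b b (idt C b) f = f"
    and cmp_assoc: "\<lbrakk>a \<in> obj C; b \<in> obj C; c \<in> obj C; d \<in> obj C;
        f \<in> arr C a b; g \<in> arr C b c; h \<in> arr C c d\<rbrakk>
      \<Longrightarrow> cmp C a b d (cmp C b c d h g) f = cmp C a c d h (cmp C a b c g f)"
    and cmp_add_left: "\<lbrakk>a \<in> obj C; b \<in> obj C; c \<in> obj C;
        f \<in> arr C a b; g \<in> arr C b c; h \<in> arr C b c\<rbrakk>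
      \<Longrightarrow> cmp C a b c (g \<otimes>\<^bsub>Hom C b c\<^esub> h) f = cmp C a b c g f \<otimes>\<^bsub>Hom C a c\<^esub> cmp C a b c h f"
    and cmp_add_right: "\<lbrakk>a \<in> obj C; b \<in> obj C; c \<in> obj C;
        f \<in> arr C a b; g \<in> arr C a b; h \<in> arr C b c\<rbrakk>
      \<Longrightarrow> cmp C a b c h (f \<otimes>\<^bsub>Hom C a b\<^esub> g) = cmp C a b c h f \<otimes>\<^bsub>Hom C a c\<^esub> cmp C a b c h g"

definition opposite :: "('o, 'm) category \<Rightarrow> ('o, 'm) category" where
  "opposite C = \<lparr>obj = obj C, Hom = (\<lambda>a b. Hom C b a), idt = idt C,
     cmp = (\<lambda>a b c g f. cmp C c b a f g)\<rparr>"

definition zero_object :: "('o, 'm) category \<Rightarrow> 'o \<Rightarrow> bool" where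
  "zero_object C z \<longleftrightarrow> z \<in> obj C \<and>
     (\<forall>a\<in>obj C. (\<exists>!f. f \<in> arr C z a) \<and> (\<exists>!f. f \<in> arr C a z))"

definition biproduct :: "('o, 'm) category \<Rightarrow> 'o \<Rightarrow> 'o \<Rightarrow> 'o \<Rightarrow> bool" where
  "biproduct C a b c \<longleftrightarrow> c \<in> obj C \<and>
     (\<exists>i\<in>arr C a c. \<exists>j\<in>arr C b c. \<exists>p\<in>arr C c a. \<exists>q\<in>arr C c b.
        cmp C a c a p i = idt C a \<and> cmp C b c b q j = idt C b \<and>
        cmp C b c a p j = zero_arr C b a \<and> cmp C a c b q i = zero_arr C a b \<and>
        cmp C c a c i p \<otimes>\<^bsub>Hom C c c\<^esub> cmp C c b c j q = idt C c)"

locale additive_category = preadditive_category C for C :: "('o, 'm) category" +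
  assumes has_zero_object: "\<exists>z. zero_object C z"
    and has_biproducts: "\<lbrakk>a \<in> obj C; b \<in> obj C\<rbrakk> \<Longrightarrow> \<exists>c. biproduct C a b c"

definition kernel_of :: "('o, 'm) category \<Rightarrow> 'o \<Rightarrow> 'o \<Rightarrow> 'm \<Rightarrow> 'o \<Rightarrow> 'm \<Rightarrow> bool" where
  "kernel_of C a b f x k \<longleftrightarrow> x \<in> obj C \<and> k \<in> arr C x a \<and> cmp C x a b f k = zero_arr C x b \<and>
     (\<forall>y\<in>obj C. \<forall>h\<in>arr C y a. cmp C y a b f h = zero_arr C y b \<longrightarrow>
        (\<exists>!u. u \<in> arr C y x \<and> cmp C y x a k u = h))"

definition pseudokernel_of :: "('o, 'm) category \<Rightarrow> 'o \<Rightarrow> 'o \<Rightarrow> 'm \<Rightarrow> 'o \<Rightarrow> 'm \<Rightarrow> bool" where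
  "pseudokernel_of C a b f x k \<longleftrightarrow> x \<in> obj C \<and> k \<in> arr C x a \<and> cmp C x a b f k = zero_arr C x b \<and>
     (\<forall>y\<in>obj C. \<forall>h\<in>arr C y a. cmp C y a b f h = zero_arr C y b \<longrightarrow>
        (\<exists>u. u \<in> arr C y x \<and> cmp C y x a k u = h))"

text \<open>In the dual notions \<open>f : a \<rightarrow> b\<close> is still a morphism of \<open>C\<close> and \<open>k : b \<rightarrow> x\<close>.\<close>

definition cokernel_of :: "('o, 'm) category \<Rightarrow> 'o \<Rightarrow> 'o \<Rightarrow> 'm \<Rightarrow> 'o \<Rightarrow> 'm \<Rightarrow> bool" where
  "cokernel_of C a b f x k \<longleftrightarrow> kernel_of (opposite C) b a f x k"

definition pseudocokernel_of :: "('o, 'm) category \<Rightarrow> 'o \<Rightarrow> 'o \<Rightarrow> 'm \<Rightarrow> 'o \<Rightarrow> 'm \<Rightarrow> bool" where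
  "pseudocokernel_of C a b f x k \<longleftrightarrow> pseudokernel_of (opposite C) b a f x k"

definition has_pseudokernels :: "('o, 'm) category \<Rightarrow> bool" where
  "has_pseudokernels C \<longleftrightarrow>
     (\<forall>a\<in>obj C. \<forall>b\<in>obj C. \<forall>f\<in>arr C a b. \<exists>x k. pseudokernel_of C a b f x k)"

definition has_pseudocokernels :: "('o, 'm) category \<Rightarrow> bool" where
  "has_pseudocokernels C \<longleftrightarrow>
     (\<forall>a\<in>obj C. \<forall>b\<in>obj C. \<forall>f\<in>arr C a b. \<exists>x k. pseudocokernel_of C a b f x k)"

definition has_split_idempotents :: "('o, 'm) category \<Rightarrow> bool" where
  "has_split_idempotents C \<longleftrightarrow>
     (\<forall>a\<in>obj C. \<forall>e\<in>arr C a a. cmp C a a a e e = e \<longrightarrow>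
        (\<exists>b\<in>obj C. \<exists>p\<in>arr C a b. \<exists>i\<in>arr C b a.
           cmp C a b a i p = e \<and> cmp C b a b p i = idt C b))"

definition monic :: "('o, 'm) category \<Rightarrow> 'o \<Rightarrow> 'o \<Rightarrow> 'm \<Rightarrow> bool" where
  "monic C a b f \<longleftrightarrow> f \<in> arr C a b \<and>
     (\<forall>y\<in>obj C. \<forall>g\<in>arr C y a. \<forall>h\<in>arr C y a. cmp C y a b f g = cmp C y a b f h \<longrightarrow> g = h)"

definition epic :: "('o, 'm) category \<Rightarrow> 'o \<Rightarrow> 'o \<Rightarrow> 'm \<Rightarrow> bool" where
  "epic C a b f \<longleftrightarrow> monic (opposite C) b a f"

locale abelian_category = additive_category C for C :: "('o, 'm) category" +
  assumes has_kernels: "\<lbrakk>a \<in> obj C; b \<in> obj C; f \<in> arr C a b\<rbrakk> \<Longrightarrow> \<exists>x k. kernel_of C a b f x k"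
    and has_cokernels: "\<lbrakk>a \<in> obj C; b \<in> obj C; f \<in> arr C a b\<rbrakk> \<Longrightarrow> \<exists>x k. cokernel_of C a b f x k"
    and monic_normal: "\<lbrakk>a \<in> obj C; b \<in> obj C; monic C a b f\<rbrakk>
      \<Longrightarrow> \<exists>c g. c \<in> obj C \<and> g \<in> arr C b c \<and> kernel_of C b c g a f"
    and epic_normal: "\<lbrakk>a \<in> obj C; b \<in> obj C; epic C a b f\<rbrakk>
      \<Longrightarrow> \<exists>c g. c \<in> obj C \<and> g \<in> arr C c a \<and> cokernel_of C c a g b f"

definition is_iso :: "('o, 'm) category \<Rightarrow> 'o \<Rightarrow> 'o \<Rightarrow> 'm \<Rightarrow> bool" where
  "is_iso C a b f \<longleftrightarrow> f \<in> arr C a b \<and>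
     (\<exists>g\<in>arr C b a. cmp C a b a g f = idt C a \<and> cmp C b a b f g = idt C b)"

section \<open>Functors, natural transformations and equivalences\<close>

record ('o, 'm, 'p, 'n) fctr =
  fob :: "'o \<Rightarrow> 'p"
  fmap :: "'o \<Rightarrow> 'o \<Rightarrow> 'm \<Rightarrow> 'n"

definition is_functor ::
    "('o, 'm) category \<Rightarrow> ('p, 'n) category \<Rightarrow> ('o, 'm, 'p, 'n) fctr \<Rightarrow> bool" where
  "is_functor C D F \<longleftrightarrow>
     (\<forall>a\<in>obj C. fob F a \<in> obj D) \<and>
     (\<forall>a\<in>obj C. \<forall>b\<in>obj C. \<forall>f\<in>arr C a b. fmap F a b f \<in> arr D (fob F a) (fob F b)) \<and>
     (\<forall>a\<in>obj C. fmap F a a (idt C a) = idt D (fob F a)) \<and>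
     (\<forall>a\<in>obj C. \<forall>b\<in>obj C. \<forall>c\<in>obj C. \<forall>f\<in>arr C a b. \<forall>g\<in>arr C b c.
        fmap F a c (cmp C a b c g f) =
        cmp D (fob F a) (fob F b) (fob F c) (fmap F b c g) (fmap F a b f))"

definition additive_functor ::
    "('o, 'm) category \<Rightarrow> ('p, 'n) category \<Rightarrow> ('o, 'm, 'p, 'n) fctr \<Rightarrow> bool" where
  "additive_functor C D F \<longleftrightarrow> is_functor C D F \<and>
     (\<forall>a\<in>obj C. \<forall>b\<in>obj C. fmap F a b \<in> hom (Hom C a b) (Hom D (fob F a) (fob F b)))"

definition short_exact ::
    "('o, 'm) category \<Rightarrow> 'o \<Rightarrow> 'o \<Rightarrow> 'o \<Rightarrow> 'm \<Rightarrow> 'm \<Rightarrow> bool" where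
  "short_exact C a b c f g \<longleftrightarrow> kernel_of C b c g a f \<and> cokernel_of C a b f c g"

definition exact_functor ::
    "('o, 'm) category \<Rightarrow> ('p, 'n) category \<Rightarrow> ('o, 'm, 'p, 'n) fctr \<Rightarrow> bool" where
  "exact_functor C D F \<longleftrightarrow> additive_functor C D F \<and>
     (\<forall>a\<in>obj C. \<forall>b\<in>obj C. \<forall>c\<in>obj C. \<forall>f\<in>arr C a b. \<forall>g\<in>arr C b c. short_exact C a b c f g \<longrightarrow>
        short_exact D (fob F a) (fob F b) (fob F c) (fmap F a b f) (fmap F b c g))"

definition nat_trans ::
    "('o, 'm) category \<Rightarrow> ('p, 'n) category \<Rightarrow> ('o, 'm, 'p, 'n) fctr \<Rightarrow> ('o, 'm, 'p, 'n) fctr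
      \<Rightarrow> ('o \<Rightarrow> 'n) \<Rightarrow> bool" where
  "nat_trans C D F G \<eta> \<longleftrightarrow>
     (\<forall>a\<in>obj C. \<eta> a \<in> arr D (fob F a) (fob G a)) \<and>
     (\<forall>a\<in>obj C. \<forall>b\<in>obj C. \<forall>f\<in>arr C a b.
        cmp D (fob F a) (fob F b) (fob G b) (\<eta> b) (fmap F a b f) =
        cmp D (fob F a) (fob G a) (fob G b) (fmap G a b f) (\<eta> a))"

definition naturally_isomorphic ::
    "('o, 'm) category \<Rightarrow> ('p, 'n) category \<Rightarrow> ('o, 'm, 'p, 'n) fctr \<Rightarrow> ('o, 'm, 'p, 'n) fctr
      \<Rightarrow> bool" where
  "naturally_isomorphic C D F G \<longleftrightarrow>
     (\<exists>\<eta>. nat_trans C D F G \<eta> \<and> (\<forall>a\<in>obj C. is_iso D (fob F a) (fob G a) (\<eta> a)))"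

definition id_functor :: "('o, 'm, 'o, 'm) fctr" where
  "id_functor = \<lparr>fob = (\<lambda>a. a), fmap = (\<lambda>a b f. f)\<rparr>"

definition comp_functor ::
    "('p, 'n, 'q, 'l) fctr \<Rightarrow> ('o, 'm, 'p, 'n) fctr \<Rightarrow> ('o, 'm, 'q, 'l) fctr" where
  "comp_functor G F = \<lparr>fob = (\<lambda>a. fob G (fob F a)),
     fmap = (\<lambda>a b f. fmap G (fob F a) (fob F b) (fmap F a b f))\<rparr>"

definition equivalent_categories :: "('o, 'm) category \<Rightarrow> ('p, 'n) category \<Rightarrow> bool" where
  "equivalent_categories C D \<longleftrightarrow>
     (\<exists>(F :: ('o, 'm, 'p, 'n) fctr) (G :: ('p, 'n, 'o, 'm) fctr).
        is_functor C D F \<and> is_functor D C G \<and>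
        naturally_isomorphic C C (comp_functor G F) id_functor \<and>
        naturally_isomorphic D D (comp_functor F G) id_functor)"

text \<open>
  Natural transformations are required to be extensional (undefined off the objects), so that
  equality of morphisms in a functor category is equality of their components.
\<close>

definition functor_category ::
    "('o, 'm) category \<Rightarrow> ('p, 'n) category \<Rightarrow> (('o, 'm, 'p, 'n) fctr, 'o \<Rightarrow> 'n) category" where
  "functor_category C D = \<lparr>
     obj = {F. additive_functor C D F},
     Hom = (\<lambda>F G. \<lparr>
       carrier = {\<eta>. nat_trans C D F G \<eta>} \<inter> extensional (obj C),
       mult = (\<lambda>\<eta> \<theta>. \<lambda>a\<in>obj C. \<eta> a \<otimes>\<^bsub>Hom D (fob F a) (fob G a)\<^esub> \<theta> a),
       one = (\<lambda>a\<in>obj C. zero_arr D (fob F a) (fob G a))\<rparr>),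
     idt = (\<lambda>F. \<lambda>a\<in>obj C. idt D (fob F a)),
     cmp = (\<lambda>F G H \<theta> \<eta>. \<lambda>a\<in>obj C. cmp D (fob F a) (fob G a) (fob H a) (\<theta> a) (\<eta> a))\<rparr>"

definition full_subcategory :: "('o, 'm) category \<Rightarrow> 'o set \<Rightarrow> ('o, 'm) category" where
  "full_subcategory C X = C\<lparr>obj := obj C \<inter> X\<rparr>"

section \<open>Smallness and the category of abelian groups\<close>

text \<open>
  HOL has no type of all abelian groups, so Ab is the category of abelian groups whose
  carrier belongs to a fixed collection \<open>U\<close> of subsets of a type, the small sets, and an
  infinite set \<open>I\<close> bounds the skeleton of the category on which functors into Ab are defined.
  \<open>U\<close> is closed under passing to sets of at most the same cardinality and, up to
  cardinality, under products indexed by \<open>I\<close>.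

  If \<open>U\<close> consists of the sets of cardinality below an uncountable inaccessible (a
  Grothendieck universe), inside a type of at least that cardinality, then this holds for every small infinite \<open>I\<close>, and a category is
  skeletally small in the usual sense iff it is so with respect to some such \<open>I\<close>. But HOL does
  not prove that such a type exists, and closure under products indexed by the size of the
  domain category needs much less: for every infinite \<open>I :: 'i set\<close> the collection of all
  subsets of the type \<open>'i \<Rightarrow> bool\<close> qualifies.
\<close>

definition universe :: "'i set \<Rightarrow> 'u set set \<Rightarrow> bool" where
  "universe I U \<longleftrightarrow> infinite I \<and> (\<exists>X\<in>U. infinite X) \<and>
     (\<forall>X\<in>U. \<forall>Y. Y \<lesssim> X \<longrightarrow> Y \<in> U) \<and>
     (\<forall>X. (\<forall>i\<in>I. X i \<in> U) \<longrightarrow> (\<exists>Z\<in>U. (\<Pi>\<^sub>E i\<in>I. X i) \<lesssim> Z))"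

definition skeletally_small :: "'i set \<Rightarrow> ('o, 'm) category \<Rightarrow> bool" where
  "skeletally_small I C \<longleftrightarrow>
     (\<exists>S\<subseteq>obj C. (\<forall>a\<in>obj C. \<exists>s\<in>S. \<exists>f. is_iso C a s f) \<and> S \<lesssim> I \<and>
        (\<forall>a\<in>S. \<forall>b\<in>S. arr C a b \<lesssim> I))"

definition Ab :: "'u set set \<Rightarrow> ('u monoid, 'u \<Rightarrow> 'u) category" where
  "Ab U = \<lparr>
     obj = {G. comm_group G \<and> carrier G \<in> U},
     Hom = (\<lambda>G H. \<lparr>
       carrier = hom G H \<inter> extensional (carrier G),
       mult = (\<lambda>f g. \<lambda>x\<in>carrier G. f x \<otimes>\<^bsub>H\<^esub> g x),
       one = (\<lambda>x\<in>carrier G. \<one>\<^bsub>H\<^esub>)\<rparr>),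
     idt = (\<lambda>G. \<lambda>x\<in>carrier G. x),
     cmp = (\<lambda>G H K g f. compose (carrier G) g f)\<rparr>"

definition Ex :: "'u set set \<Rightarrow> ('o, 'm) category
    \<Rightarrow> (('o, 'm, 'u monoid, 'u \<Rightarrow> 'u) fctr, 'o \<Rightarrow> 'u \<Rightarrow> 'u) category" where
  "Ex U A = full_subcategory (functor_category (opposite A) (Ab U))
     {F. exact_functor (opposite A) (Ab U) F}"

text \<open>
  HOL does not quantify over the types of \<open>A\<close> inside a definition, so the witnessing category
  is an argument; \<open>C\<close> is exactly definable iff this holds for some \<open>A\<close>.
\<close>

definition exactly_definable_via ::
    "'i set \<Rightarrow> 'u set set \<Rightarrow> ('a, 'b) category \<Rightarrow> ('o, 'm) category \<Rightarrow> bool" where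
  "exactly_definable_via I U A C \<longleftrightarrow> additive_category C \<and>
     abelian_category A \<and> skeletally_small I A \<and> equivalent_categories C (Ex U A)"

end

theory Submission
  imports Defs "HOL-Algebra.Product_Groups" Complex_Main
begin

text \<open>
  Write \<open>B\<close> for the opposite of \<open>A\<close> and restrict functors to a small skeleton of \<open>B\<close>, where exactness is
  checked on elements. Idempotents split because a retract of an exact functor is exact. Fixing
  preimages for all short exact sequences turns an exact functor into an algebra with finitary
  operations whose subalgebras are exact; so every subset of an exact functor lies in an exact
  subfunctor that is not essentially larger than the index set \<open>I\<close>.

  For a pseudocokernel of \<open>F \<rightarrow> G\<close>, take all morphisms from \<open>G\<close> to exact functors that vanish on \<open>F\<close>,
  combine them into a morphism to the product of their targets, and pass to the exact hull of the image of \<open>G\<close>.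

  A pseudokernel is obtained from an exact \<open>X\<close> over the kernel \<open>K\<close> such that, for exact \<open>M \<subseteq> M'\<close> of size
  at most \<open>I\<close>, each morphism \<open>M \<rightarrow> X\<close> over \<open>K\<close> extends to every given \<open>M' \<rightarrow> K\<close>. Any exact functor over \<open>K\<close>
  is a continuous union of exact subfunctors, each obtained from the previous one by adding a small exact functor, and
  therefore maps to \<open>X\<close>. The functor \<open>X\<close> is built from well-founded terms that name the elements of
  iterated pushouts along \<open>M \<rightarrow> X\<close>. To avoid colimits, the terms are evaluated in a fixed large functor of
  families of unitary characters: extending characters realizes the pushout, and a new coordinate
  for each term keeps the elements outside \<open>M\<close> away from the part already built. The number of terms is
  bounded because they are \<open>I\<close>-branching trees and \<open>U\<close> is closed under products indexed by \<open>I\<close>.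
\<close>

section \<open>Cardinality\<close>

text \<open>The obstacle is on the pseudokernel side. The kernel of a morphism of exact functors is
  in general only left exact, and morphisms into it come from exact functors of unbounded size; the
  dual of the product argument would need a sum of all of them, and no bounded functor is at hand
  whose hull could replace it. As in the small object argument, the way out is that a lifting
  problem can be cut into pieces no larger than \<open>I\<close>, so one functor that solves all
  small extension problems is weakly universal. Attaching M' to X along M keeps exactness because
  M'/M is exact and extensions of exact functors are exact. The circle is used because it is an
  injective cogenerator of abelian groups: injectivity extends a morphism from M to M', cogeneration
  separates the points of M' from M. Inside one ambient functor, pushouts become sums of subfunctors
  and direct limits become unions. The exponent \<open>I\<close> in the hypothesis on
  \<open>U\<close> is the price of the attaching maps: one cell refers to a whole family of earlier
  terms, indexed by the elements of M.\<close>

lemma lepoll_total: "A \<lesssim> B \<or> B \<lesssim> A"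
  using ordLeq_total[OF card_of_Well_order[of A] card_of_Well_order[of B]]
  unfolding lepoll_def card_of_ordLeq .

lemma lepoll_Times:
  assumes "infinite Z" "A \<lesssim> Z" "B \<lesssim> Z"
  shows "A \<times> B \<lesssim> Z"
proof -
  have "Z \<times> Z \<approx> Z"
    using card_of_Times_same_infinite[OF assms(1)] by (simp add: eqpoll_iff_card_of_ordIso)
  then show ?thesis
    using times_lepoll_mono[OF assms(2,3)] by (meson eqpoll_imp_lepoll lepoll_trans)
qed

lemma lepoll_Sigma:
  assumes "infinite Z" "A \<lesssim> Z" "\<And>a. a \<in> A \<Longrightarrow> B a \<lesssim> Z"
  shows "Sigma A B \<lesssim> Z"
proof -
  have "Sigma A B \<lesssim> Sigma A (\<lambda>_. Z)"
    by (rule Sigma_lepoll_mono) (use assms(3) in auto)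
  then show ?thesis
    using lepoll_Times[OF assms(1,2) lepoll_refl] by (rule lepoll_trans)
qed

lemma lepoll_UN:
  assumes "infinite Z" "A \<lesssim> Z" "\<And>a. a \<in> A \<Longrightarrow> B a \<lesssim> Z"
  shows "(\<Union>a\<in>A. B a) \<lesssim> Z"
proof -
  have "(\<Union>a\<in>A. B a) \<subseteq> snd ` Sigma A B"
    by force
  from subset_image_lepoll[OF this] lepoll_Sigma[OF assms] show ?thesis
    by (rule lepoll_trans)
qed

lemma lepoll_Un:
  assumes "infinite Z" "A \<lesssim> Z" "B \<lesssim> Z"
  shows "A \<union> B \<lesssim> Z"
proof -
  have "{True, False} \<lesssim> Z"
    by (simp add: assms(1) finite_lepoll_infinite)
  from lepoll_UN[OF assms(1) this, of "\<lambda>b. if b then A else B"] assms(2,3)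
  show ?thesis
    by (simp add: UNIV_bool Un_commute)
qed

lemma lepoll_image: "A \<lesssim> Z \<Longrightarrow> f ` A \<lesssim> Z"
  by (rule lepoll_trans[OF image_lepoll])

lemma lepoll_subset: "A \<lesssim> Z \<Longrightarrow> B \<subseteq> A \<Longrightarrow> B \<lesssim> Z"
  by (rule lepoll_trans[OF subset_imp_lepoll])

text \<open>The cardinal inequality |Z|^|N| \<le> |Z|. It is the form of smallness that bounds all
  the constructions below: \<open>N\<close>-branching trees, power sets of \<open>N\<close> and
  \<open>N\<close>-indexed products.\<close>

definition absorbing :: "'i set \<Rightarrow> 'u set \<Rightarrow> bool" where
  "absorbing N Z \<longleftrightarrow> infinite Z \<and> (N \<rightarrow>\<^sub>E Z) \<lesssim> Z"

text \<open>Operations of arity at most two can be indexed by \<open>bool\<close>, and Z x Z is no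
  larger than an infinite Z. Finitary closures are therefore bounded by any infinite set that bounds
  the operations.\<close>

lemma absorbing_bool:
  assumes "infinite Z"
  shows "absorbing (UNIV :: bool set) Z"
proof -
  have "inj_on (\<lambda>f. (f True, f False)) (UNIV \<rightarrow>\<^sub>E Z :: (bool \<Rightarrow> _) set)"
  proof (rule inj_onI, rule ext)
    fix f g :: "bool \<Rightarrow> 'a" and b
    assume "(f True, f False) = (g True, g False)"
    then show "f b = g b" by (cases b) auto
  qed
  then have "(UNIV \<rightarrow>\<^sub>E Z :: (bool \<Rightarrow> _) set) \<lesssim> Z \<times> Z"
    unfolding lepoll_def by (intro exI[of _ "\<lambda>f. (f True, f False)"]) auto
  then show ?thesis
    unfolding absorbing_def
    using assms lepoll_trans[OF _ lepoll_Times[OF assms lepoll_refl lepoll_refl]] by blast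
qed

lemma absorbing_index_lepoll:
  assumes "absorbing I Z" "N \<lesssim> I"
  shows "absorbing N Z"
proof -
  have "(N \<rightarrow>\<^sub>E Z) \<lesssim> (I \<rightarrow>\<^sub>E Z)"
    using lepoll_funcset_left[OF infinite_imp_nonempty assms(2)] assms(1) unfolding absorbing_def by blast
  then show ?thesis
    using assms(1) unfolding absorbing_def by (meson lepoll_trans)
qed

lemma absorbing_Pow_lepoll:
  assumes "absorbing N Z"
  shows "Pow N \<lesssim> Z"
proof -
  have inf: "infinite Z" using assms by (simp add: absorbing_def)
  then obtain x where x: "x \<in> Z" by (metis ex_in_conv finite.emptyI)
  from inf have "infinite (Z - {x})" by simp
  then obtain y where "y \<in> Z - {x}" by (metis ex_in_conv finite.emptyI)
  with x have xy: "x \<in> Z" "y \<in> Z" "x \<noteq> y" by auto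
  have "inj_on (\<lambda>P. \<lambda>n\<in>N. if n \<in> P then x else y) (Pow N)"
  proof (rule inj_onI)
    fix P P' assume *: "P \<in> Pow N" "P' \<in> Pow N"
      "(\<lambda>n\<in>N. if n \<in> P then x else y) = (\<lambda>n\<in>N. if n \<in> P' then x else y)"
    have "n \<in> P \<longleftrightarrow> n \<in> P'" if "n \<in> N" for n
      using fun_cong[OF *(3), of n] that xy by (auto split: if_splits)
    with * show "P = P'" by blast
  qed
  then have "Pow N \<lesssim> (N \<rightarrow>\<^sub>E Z)"
    unfolding lepoll_def
    by (intro exI[of _ "\<lambda>P. \<lambda>n\<in>N. if n \<in> P then x else y"]) (auto simp: xy)
  then show ?thesis
    using assms unfolding absorbing_def by (meson lepoll_trans)
qed

lemma absorbing_self_lepoll: "absorbing N Z \<Longrightarrow> N \<lesssim> Z"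
  by (rule lepoll_trans[OF lepoll_Pow_self absorbing_Pow_lepoll])

lemma absorbing_PiE_lepoll:
  assumes "absorbing N Z" "\<And>n. n \<in> N \<Longrightarrow> Y n \<lesssim> Z"
  shows "PiE N Y \<lesssim> Z"
proof -
  have "PiE N Y \<lesssim> (N \<rightarrow>\<^sub>E Z)"
    by (rule lepoll_PiE) (use assms in auto)
  then show ?thesis
    using assms unfolding absorbing_def by (meson lepoll_trans)
qed

lemma universe_subset: "universe I U \<Longrightarrow> X \<in> U \<Longrightarrow> Y \<lesssim> X \<Longrightarrow> Y \<in> U"
  unfolding universe_def by blast

text \<open>The witness has the cardinality of \<open>I \<rightarrow>\<^sub>E Y\<close> with \<open>Y\<close> infinite and at least as large as \<open>X\<close>;
  it absorbs exponentiation by \<open>I\<close> because \<open>I \<times> I\<close> is equipollent to \<open>I\<close>.\<close>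

lemma universe_absorbing:
  assumes U: "universe I U" and X: "X \<in> U"
  shows "\<exists>Z\<in>U. X \<lesssim> Z \<and> absorbing I Z"
proof -
  have I: "infinite I" using U unfolding universe_def by (elim conjE)
  obtain X0 where X0: "X0 \<in> U" "infinite X0" 
    using U unfolding universe_def by (elim conjE bexE) (rule that)
  obtain Y where Y: "Y \<in> U" "infinite Y" "X \<lesssim> Y"
  proof (cases "X \<lesssim> X0")
    case True then show ?thesis using X0 that by blast
  next
    case False
    then have "X0 \<lesssim> X" using lepoll_total by blast
    have "infinite X"
      unfolding infinite_le_lepoll
      by (rule lepoll_trans[OF X0(2)[unfolded infinite_le_lepoll] \<open>X0 \<lesssim> X\<close>])
    then show ?thesis using X that lepoll_refl by blast
  qed
  obtain Z1 where Z1: "Z1 \<in> U" "(I \<rightarrow>\<^sub>E Y) \<lesssim> Z1"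
    using U Y(1) unfolding universe_def by (elim conjE allE[of _ "\<lambda>_. Y"]) (auto intro: that)
  then obtain f where f: "inj_on f (I \<rightarrow>\<^sub>E Y)" "f ` (I \<rightarrow>\<^sub>E Y) \<subseteq> Z1"
    unfolding lepoll_def by blast
  \<comment> \<open>Passing from \<open>Z1\<close> to the image makes \<open>Z\<close> equipollent
    to the function space instead of merely at least as large; both directions are used
    below.\<close>
  define Z where "Z = f ` (I \<rightarrow>\<^sub>E Y)"
  have Zeq: "Z \<approx> (I \<rightarrow>\<^sub>E Y)"
    unfolding Z_def using f by simp
  have ZU: "Z \<in> U"
    using universe_subset[OF U Z1(1) subset_imp_lepoll] f(2) by (simp add: Z_def)
  have Yn: "Y \<noteq> {}" using Y by auto
  have "inj_on (\<lambda>y. \<lambda>i\<in>I. y) Y"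
  proof (rule inj_onI)
    fix x y assume *: "(\<lambda>i\<in>I. x) = (\<lambda>i\<in>I. y)"
    obtain i where "i \<in> I" using I by (metis ex_in_conv finite.emptyI)
    then show "x = y" using fun_cong[OF *, of i] by simp
  qed
  then have YY: "Y \<lesssim> (I \<rightarrow>\<^sub>E Y)"
    unfolding lepoll_def by (intro exI[of _ "\<lambda>y. \<lambda>i\<in>I. y"] conjI image_subsetI) simp_all
  have "(I \<rightarrow>\<^sub>E Y) \<lesssim> Z" using Zeq by (simp add: eqpoll_imp_lepoll eqpoll_sym)
  with YY have YZ: "Y \<lesssim> Z" by (rule lepoll_trans)
  have "inj_on (\<lambda>g. \<lambda>(i,j)\<in>I \<times> I. g i j) (I \<rightarrow>\<^sub>E (I \<rightarrow>\<^sub>E Y))"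
  proof (rule inj_onI)
    fix g h assume gh: "g \<in> (I \<rightarrow>\<^sub>E (I \<rightarrow>\<^sub>E Y))" "h \<in> (I \<rightarrow>\<^sub>E (I \<rightarrow>\<^sub>E Y))"
      "(\<lambda>(i,j)\<in>I \<times> I. g i j) = (\<lambda>(i,j)\<in>I \<times> I. h i j)"
    have "g i = h i" if i: "i \<in> I" for i
    proof (rule PiE_ext)
      show "g i \<in> I \<rightarrow>\<^sub>E Y" "h i \<in> I \<rightarrow>\<^sub>E Y" using gh i by auto
      show "g i j = h i j" if "j \<in> I" for j
        using fun_cong[OF gh(3), of "(i,j)"] i that by simp
    qed
    then show "g = h" using PiE_ext[OF gh(1,2)] by blast
  qed
  then have "(I \<rightarrow>\<^sub>E (I \<rightarrow>\<^sub>E Y)) \<lesssim> (I \<times> I \<rightarrow>\<^sub>E Y)"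
    unfolding lepoll_def
  proof (intro exI[of _ "\<lambda>g. \<lambda>(i,j)\<in>I \<times> I. g i j"] conjI)
    show "(\<lambda>g. \<lambda>(i,j)\<in>I \<times> I. g i j) ` (I \<rightarrow>\<^sub>E (I \<rightarrow>\<^sub>E Y)) \<subseteq> I \<times> I \<rightarrow>\<^sub>E Y"
    proof (rule image_subsetI, rule restrict_PiE[THEN iffD2], clarify)
      fix g :: "'a \<Rightarrow> 'a \<Rightarrow> 'b" and i j assume "g \<in> I \<rightarrow>\<^sub>E (I \<rightarrow>\<^sub>E Y)" "i \<in> I" "j \<in> I"
      then show "g i j \<in> Y" by (intro PiE_mem[of "g i" I "\<lambda>_. Y"] PiE_mem[of g I "\<lambda>_. I \<rightarrow>\<^sub>E Y"])
    qed
  qed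
  then have 1: "(I \<rightarrow>\<^sub>E (I \<rightarrow>\<^sub>E Y)) \<lesssim> (I \<rightarrow>\<^sub>E Y)"
    by (rule lepoll_trans[OF _ lepoll_funcset_left[OF Yn lepoll_Times[OF I lepoll_refl lepoll_refl]]])
  have "(I \<rightarrow>\<^sub>E Z) \<lesssim> (I \<rightarrow>\<^sub>E (I \<rightarrow>\<^sub>E Y))"
    by (rule lepoll_funcset_right) (rule eqpoll_imp_lepoll[OF Zeq])
  then have IZ: "(I \<rightarrow>\<^sub>E Z) \<lesssim> Z"
    by (rule lepoll_trans[OF _ lepoll_trans[OF 1 \<open>(I \<rightarrow>\<^sub>E Y) \<lesssim> Z\<close>]])
  have "infinite Z"
    unfolding infinite_le_lepoll by (rule lepoll_trans[OF Y(2)[unfolded infinite_le_lepoll] YZ])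
  with IZ have "absorbing I Z" by (simp add: absorbing_def)
  with lepoll_trans[OF Y(3) YZ] show ?thesis
    by (rule bexI[OF conjI ZU])
qed

section \<open>Counting what is generated by operations of infinite arity\<close>

inductive_set closure_under :: "'l set \<Rightarrow> ('l \<Rightarrow> 'n set) \<Rightarrow> ('l \<Rightarrow> ('n \<Rightarrow> 'x) \<Rightarrow> 'x) \<Rightarrow> 'x set"
  for L ar opn where
  closure_underI: "l \<in> L \<Longrightarrow> (\<And>n. n \<in> ar l \<Longrightarrow> c n \<in> closure_under L ar opn)
    \<Longrightarrow> opn l (restrict c (ar l)) \<in> closure_under L ar opn"

text \<open>A tree records how an element was generated, so that names are counted instead of
  elements. \<open>WLeaf\<close> makes the datatype inhabited; the trees of \<open>wtrees\<close>
  end in nodes of empty arity.\<close>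

datatype ('l, 'n) wtree = WLeaf | WNode 'l "'n \<Rightarrow> ('l, 'n) wtree"

primrec weval :: "('l \<Rightarrow> 'n set) \<Rightarrow> ('l \<Rightarrow> ('n \<Rightarrow> 'x) \<Rightarrow> 'x) \<Rightarrow> ('l, 'n) wtree \<Rightarrow> 'x" where
  "weval ar opn WLeaf = undefined"
| "weval ar opn (WNode l c) = opn l (restrict (\<lambda>n. weval ar opn (c n)) (ar l))"

text \<open>Collapses a tree from the bottom up to one element of \<open>Z\<close>, with
  \<open>p\<close> an injection of pairs (label, family of codes) into \<open>Z\<close>. The filler
  \<open>z\<close> turns a family over \<open>ar l\<close> into one over all of
  \<open>N\<close>.\<close>

primrec wcode :: "('l \<Rightarrow> 'n set) \<Rightarrow> 'n set \<Rightarrow> 'z \<Rightarrow> ('l \<times> ('n \<Rightarrow> 'z) \<Rightarrow> 'z) \<Rightarrow> ('l, 'n) wtree \<Rightarrow> 'z"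
  where
  "wcode ar N z p WLeaf = z"
| "wcode ar N z p (WNode l c) =
    p (l, \<lambda>n\<in>N. if n \<in> ar l then wcode ar N z p (c n) else z)"

inductive_set wtrees :: "'l set \<Rightarrow> ('l \<Rightarrow> 'n set) \<Rightarrow> ('l, 'n) wtree set" for L ar where
  wtreesI: "l \<in> L \<Longrightarrow> (\<And>n. n \<in> ar l \<Longrightarrow> c n \<in> wtrees L ar) \<Longrightarrow> WNode l (restrict c (ar l)) \<in> wtrees L ar"

text \<open>Every generated element is the value of a well-founded tree, and such trees inject into
  \<open>Z\<close> through their codes: the code of a node determines its label, the label its
  arity, and the arity tells which coordinates are codes of children. No ordinal stages are
  involved.\<close>

lemma closure_under_lepoll:
  assumes N: "absorbing N Z" and L: "L \<lesssim> Z" and ar: "\<And>l. l \<in> L \<Longrightarrow> ar l \<subseteq> N"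
  shows "closure_under L ar opn \<lesssim> Z"
proof -
  have inf: "infinite Z" using N by (simp add: absorbing_def)
  then obtain z where z: "z \<in> Z" by (metis ex_in_conv finite.emptyI)
  have "L \<times> (N \<rightarrow>\<^sub>E Z) \<lesssim> Z"
    by (rule lepoll_Times[OF inf L]) (use N in \<open>simp add: absorbing_def\<close>)
  then obtain p where p: "inj_on p (L \<times> (N \<rightarrow>\<^sub>E Z))" "p ` (L \<times> (N \<rightarrow>\<^sub>E Z)) \<subseteq> Z"
    unfolding lepoll_def by blast
  let ?e = "wcode ar N z p"
  have eZ: "?e t \<in> Z" if "t \<in> wtrees L ar" for t
    using that
  proof induction
    case (wtreesI l c)
    have "(l, \<lambda>n\<in>N. if n \<in> ar l then ?e (restrict c (ar l) n) else z) \<in> L \<times> (N \<rightarrow>\<^sub>E Z)"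
      using wtreesI z by auto
    then show ?case using p(2) by auto
  qed
  have "t = t'" if "t \<in> wtrees L ar" "t' \<in> wtrees L ar" "?e t = ?e t'" for t t'
    using that
  proof (induction arbitrary: t')
    case (wtreesI l c)
    from wtreesI.prems(1) obtain l' c' where t': "t' = WNode l' (restrict c' (ar l'))" "l' \<in> L"
      "\<And>n. n \<in> ar l' \<Longrightarrow> c' n \<in> wtrees L ar"
      by (auto elim: wtrees.cases)
    let ?f = "\<lambda>n\<in>N. if n \<in> ar l then ?e (restrict c (ar l) n) else z"
    let ?f' = "\<lambda>n\<in>N. if n \<in> ar l' then ?e (restrict c' (ar l') n) else z"
    have "(l, ?f) \<in> L \<times> (N \<rightarrow>\<^sub>E Z)" "(l', ?f') \<in> L \<times> (N \<rightarrow>\<^sub>E Z)"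
      using wtreesI.hyps t' z eZ by auto
    then have eq: "l = l'" "?f = ?f'"
      using wtreesI.prems(2) t'(1) inj_onD[OF p(1)] by auto
    have "restrict c (ar l) = restrict c' (ar l)"
    proof (rule restrict_ext)
      fix n assume n: "n \<in> ar l"
      then have "?e (c n) = ?e (c' n)"
        using fun_cong[OF eq(2), of n] ar[OF wtreesI.hyps(1)] eq(1) by auto
      then show "c n = c' n" using wtreesI.IH n t' eq by auto
    qed
    then show ?case using t' eq by simp
  qed
  then have "inj_on ?e (wtrees L ar)" by (auto intro: inj_onI)
  then have W: "wtrees L ar \<lesssim> Z"
    unfolding lepoll_def using eZ by blast
  have "x \<in> weval ar opn ` wtrees L ar" if "x \<in> closure_under L ar opn" for x
    using that
  proof induction
    case (closure_underI l c)
    then have "\<forall>n\<in>ar l. \<exists>t\<in>wtrees L ar. c n = weval ar opn t" by blast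
    then obtain t where t: "\<And>n. n \<in> ar l \<Longrightarrow> t n \<in> wtrees L ar \<and> c n = weval ar opn (t n)" by metis
    have "weval ar opn (WNode l (restrict t (ar l))) = opn l (restrict c (ar l))"
      using t by (simp cong: restrict_cong)
    moreover have "WNode l (restrict t (ar l)) \<in> wtrees L ar"
      using wtrees.wtreesI[of l L ar t] closure_underI(1) t by blast
    ultimately show ?case by (metis image_eqI)
  qed
  then have "closure_under L ar opn \<subseteq> weval ar opn ` wtrees L ar" by blast
  then show ?thesis
    by (rule lepoll_trans[OF subset_image_lepoll W])
qed

section \<open>Functors on a set of objects and exact subfunctors\<close>

text \<open>\<open>Q\<close> is the set of sequences on which exactness is tested. Keeping it a
  parameter lets the same theory run twice, on all objects and on a small set of
  representatives.\<close>

locale site = preadditive_category B for B :: "('o, 'm) category" +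
  fixes S :: "'o set" and Q :: "('o \<times> 'o \<times> 'o \<times> 'm \<times> 'm) set"
  assumes S_obj: "S \<subseteq> obj B"
    and Q_null: "(a, b, c, f, g) \<in> Q \<Longrightarrow> a \<in> S \<and> b \<in> S \<and> c \<in> S \<and>
      f \<in> arr B a b \<and> g \<in> arr B b c \<and> cmp B a b c g f = zero_arr B a c"
begin

definition psh :: "('o, 'm, 'x monoid, 'x \<Rightarrow> 'x) fctr \<Rightarrow> bool" where
  "psh F \<longleftrightarrow> (\<forall>a\<in>S. comm_group (fob F a)) \<and>
     (\<forall>a\<in>S. \<forall>b\<in>S. \<forall>f\<in>arr B a b. fmap F a b f \<in> hom (fob F a) (fob F b)) \<and>
     (\<forall>a\<in>S. \<forall>x\<in>carrier (fob F a). fmap F a a (idt B a) x = x) \<and>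
     (\<forall>a\<in>S. \<forall>b\<in>S. \<forall>c\<in>S. \<forall>f\<in>arr B a b. \<forall>g\<in>arr B b c. \<forall>x\<in>carrier (fob F a).
        fmap F a c (cmp B a b c g f) x = fmap F b c g (fmap F a b f x)) \<and>
     (\<forall>a\<in>S. \<forall>b\<in>S. \<forall>f\<in>arr B a b. \<forall>g\<in>arr B a b. \<forall>x\<in>carrier (fob F a).
        fmap F a b (f \<otimes>\<^bsub>Hom B a b\<^esub> g) x = fmap F a b f x \<otimes>\<^bsub>fob F b\<^esub> fmap F a b g x)"

definition subfun :: "('o, 'm, 'x monoid, 'x \<Rightarrow> 'x) fctr \<Rightarrow> ('o \<Rightarrow> 'x set) \<Rightarrow> bool" where
  "subfun F X \<longleftrightarrow> (\<forall>a\<in>S. X a \<subseteq> carrier (fob F a) \<and> \<one>\<^bsub>fob F a\<^esub> \<in> X a \<and>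
     (\<forall>x\<in>X a. \<forall>y\<in>X a. x \<otimes>\<^bsub>fob F a\<^esub> y \<in> X a) \<and>
     (\<forall>b\<in>S. \<forall>f\<in>arr B a b. \<forall>x\<in>X a. fmap F a b f x \<in> X b))"

text \<open>Exactness of \<open>X\<close> is read off elements of the surrounding \<open>F\<close>,
  so no group structure on \<open>X\<close> has to be formed. That the composite vanishes is
  \<open>psh_null\<close>. Every clause starts from a single element, which makes unions
  harmless.\<close>

definition exfun :: "('o, 'm, 'x monoid, 'x \<Rightarrow> 'x) fctr \<Rightarrow> ('o \<Rightarrow> 'x set) \<Rightarrow> bool" where
  "exfun F X \<longleftrightarrow> (\<forall>(a, b, c, f, g)\<in>Q.
     (\<forall>x\<in>X a. fmap F a b f x = \<one>\<^bsub>fob F b\<^esub> \<longrightarrow> x = \<one>\<^bsub>fob F a\<^esub>) \<and>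
     (\<forall>y\<in>X b. fmap F b c g y = \<one>\<^bsub>fob F c\<^esub> \<longrightarrow> (\<exists>x\<in>X a. fmap F a b f x = y)) \<and>
     (\<forall>z\<in>X c. \<exists>y\<in>X b. fmap F b c g y = z))"

text \<open>The domain is a family of subsets \<open>X\<close> inside \<open>F\<close>, and values
  off \<open>X\<close> are unconstrained; extending a morphism then means agreeing with it on
  \<open>X\<close>.\<close>

definition phom :: "('o \<Rightarrow> 'x set) \<Rightarrow> ('o, 'm, 'x monoid, 'x \<Rightarrow> 'x) fctr
    \<Rightarrow> ('o, 'm, 'y monoid, 'y \<Rightarrow> 'y) fctr \<Rightarrow> ('o \<Rightarrow> 'x \<Rightarrow> 'y) \<Rightarrow> bool" where
  "phom X F G \<phi> \<longleftrightarrow> (\<forall>a\<in>S. \<forall>x\<in>X a. \<phi> a x \<in> carrier (fob G a) \<and>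
     (\<forall>y\<in>X a. \<phi> a (x \<otimes>\<^bsub>fob F a\<^esub> y) = \<phi> a x \<otimes>\<^bsub>fob G a\<^esub> \<phi> a y) \<and>
     (\<forall>b\<in>S. \<forall>f\<in>arr B a b. \<phi> b (fmap F a b f x) = fmap G a b f (\<phi> a x)))"

abbreviation car :: "('o, 'm, 'x monoid, 'x \<Rightarrow> 'x) fctr \<Rightarrow> 'o \<Rightarrow> 'x set" where
  "car F a \<equiv> carrier (fob F a)"

lemma psh_grp: "psh F \<Longrightarrow> a \<in> S \<Longrightarrow> comm_group (fob F a)"
  by (simp add: psh_def)

lemma psh_map: "psh F \<Longrightarrow> a \<in> S \<Longrightarrow> b \<in> S \<Longrightarrow> f \<in> arr B a b \<Longrightarrow> x \<in> car F a \<Longrightarrow> fmap F a b f x \<in> car F b"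
  unfolding psh_def by (blast dest: hom_in_carrier)

lemma psh_mult: "psh F \<Longrightarrow> a \<in> S \<Longrightarrow> b \<in> S \<Longrightarrow> f \<in> arr B a b \<Longrightarrow> x \<in> car F a \<Longrightarrow> y \<in> car F a \<Longrightarrow>
    fmap F a b f (x \<otimes>\<^bsub>fob F a\<^esub> y) = fmap F a b f x \<otimes>\<^bsub>fob F b\<^esub> fmap F a b f y"
  unfolding psh_def by (blast dest: hom_mult)

lemma psh_one: "psh F \<Longrightarrow> a \<in> S \<Longrightarrow> b \<in> S \<Longrightarrow> f \<in> arr B a b \<Longrightarrow> fmap F a b f \<one>\<^bsub>fob F a\<^esub> = \<one>\<^bsub>fob F b\<^esub>"
  by (rule hom_one) (auto simp: psh_def comm_group_def)

lemma psh_inv: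
  assumes "psh F" "a \<in> S" "b \<in> S" "f \<in> arr B a b" "x \<in> car F a"
  shows "fmap F a b f (inv\<^bsub>fob F a\<^esub> x) = inv\<^bsub>fob F b\<^esub> (fmap F a b f x)"
proof -
  interpret group_hom "fob F a" "fob F b" "fmap F a b f"
    using assms by (intro group_hom.intro group_hom_axioms.intro) (auto simp: psh_def comm_group_def)
  show ?thesis using assms by simp
qed

lemma psh_id: "psh F \<Longrightarrow> a \<in> S \<Longrightarrow> x \<in> car F a \<Longrightarrow> fmap F a a (idt B a) x = x"
  by (simp add: psh_def)

lemma psh_cmp: "psh F \<Longrightarrow> a \<in> S \<Longrightarrow> b \<in> S \<Longrightarrow> c \<in> S \<Longrightarrow> f \<in> arr B a b \<Longrightarrow> g \<in> arr B b c \<Longrightarrow> x \<in> car F a \<Longrightarrow>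
    fmap F a c (cmp B a b c g f) x = fmap F b c g (fmap F a b f x)"
  by (simp add: psh_def)

lemma psh_add: "psh F \<Longrightarrow> a \<in> S \<Longrightarrow> b \<in> S \<Longrightarrow> f \<in> arr B a b \<Longrightarrow> g \<in> arr B a b \<Longrightarrow> x \<in> car F a \<Longrightarrow>
    fmap F a b (f \<otimes>\<^bsub>Hom B a b\<^esub> g) x = fmap F a b f x \<otimes>\<^bsub>fob F b\<^esub> fmap F a b g x"
  by (simp add: psh_def)

lemma hom_grp: "a \<in> S \<Longrightarrow> b \<in> S \<Longrightarrow> comm_group (Hom B a b)"
  using hom_group S_obj by blast

lemma psh_zero:
  assumes F: "psh F" and ab: "a \<in> S" "b \<in> S" and x: "x \<in> car F a"
  shows "fmap F a b (zero_arr B a b) x = \<one>\<^bsub>fob F b\<^esub>"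
proof -
  interpret H: comm_group "Hom B a b" using hom_grp[OF ab] .
  interpret G: comm_group "fob F b" using psh_grp[OF F ab(2)] .
  have z: "zero_arr B a b \<in> arr B a b" by simp
  then have "fmap F a b (zero_arr B a b) x \<otimes>\<^bsub>fob F b\<^esub> fmap F a b (zero_arr B a b) x
    = fmap F a b (zero_arr B a b) x"
    using psh_add[OF F ab z z x] by simp
  then show ?thesis
    using psh_map[OF F ab z x] G.l_cancel_one' by metis
qed

lemma psh_null: "psh F \<Longrightarrow> (a, b, c, f, g) \<in> Q \<Longrightarrow> x \<in> car F a \<Longrightarrow>
    fmap F b c g (fmap F a b f x) = \<one>\<^bsub>fob F c\<^esub>"
  using Q_null psh_cmp[of F a b c f g x] psh_zero[of F a c x] by metis

lemma subfun_car: "subfun F X \<Longrightarrow> a \<in> S \<Longrightarrow> x \<in> X a \<Longrightarrow> x \<in> car F a"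
  by (auto simp: subfun_def)

lemma subfun_mult: "subfun F X \<Longrightarrow> a \<in> S \<Longrightarrow> x \<in> X a \<Longrightarrow> y \<in> X a \<Longrightarrow> x \<otimes>\<^bsub>fob F a\<^esub> y \<in> X a"
  by (auto simp: subfun_def)

lemma subfun_one: "subfun F X \<Longrightarrow> a \<in> S \<Longrightarrow> \<one>\<^bsub>fob F a\<^esub> \<in> X a"
  by (auto simp: subfun_def)

lemma subfun_map: "subfun F X \<Longrightarrow> a \<in> S \<Longrightarrow> b \<in> S \<Longrightarrow> f \<in> arr B a b \<Longrightarrow> x \<in> X a \<Longrightarrow> fmap F a b f x \<in> X b"
  by (auto simp: subfun_def)

text \<open>Inversion is the action of the negative of the identity arrow, so closure under products
  and arrows already makes each value of a subfunctor a subgroup.\<close>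

lemma subfun_inv:
  assumes F: "psh F" and X: "subfun F X" and a: "a \<in> S" and x: "x \<in> X a"
  shows "inv\<^bsub>fob F a\<^esub> x \<in> X a"
proof -
  interpret H: comm_group "Hom B a a" using hom_grp[OF a a] .
  interpret G: comm_group "fob F a" using psh_grp[OF F a] .
  have i: "idt B a \<in> arr B a a" using idt_closed a S_obj by blast
  let ?n = "inv\<^bsub>Hom B a a\<^esub> idt B a"
  have n: "?n \<in> arr B a a" using i by simp
  have x': "x \<in> car F a" using subfun_car[OF X a x] .
  have "fmap F a a ?n x \<otimes>\<^bsub>fob F a\<^esub> x = \<one>\<^bsub>fob F a\<^esub>"
    using psh_add[OF F a a n i x'] psh_zero[OF F a a x'] psh_id[OF F a x'] i by simp
  then have "inv\<^bsub>fob F a\<^esub> x = fmap F a a ?n x"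
    using psh_map[OF F a a n x'] x' G.inv_equality by simp
  then show ?thesis using subfun_map[OF X a a n x] by simp
qed

lemma subfun_subgroup: "psh F \<Longrightarrow> subfun F X \<Longrightarrow> a \<in> S \<Longrightarrow> subgroup (X a) (fob F a)"
  by (intro subgroup.intro)
    (auto intro: subfun_inv subfun_car subfun_mult subfun_one)

lemma subfun_carrier:
  assumes "psh F"
  shows "subfun F (car F)"
  unfolding subfun_def
proof (intro ballI conjI)
  fix a assume a: "a \<in> S"
  interpret comm_group "fob F a" using psh_grp[OF assms a] .
  show "car F a \<subseteq> car F a" "\<one>\<^bsub>fob F a\<^esub> \<in> car F a" by auto
  show "x \<otimes>\<^bsub>fob F a\<^esub> y \<in> car F a" if "x \<in> car F a" "y \<in> car F a" for x y
    using that by simp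
  show "fmap F a b f x \<in> car F b" if "b \<in> S" "f \<in> arr B a b" "x \<in> car F a" for b f x
    using psh_map[OF assms a that] .
qed

lemma subfun_Int: "subfun F X \<Longrightarrow> subfun F Y \<Longrightarrow> subfun F (\<lambda>a. X a \<inter> Y a)"
  unfolding subfun_def by blast

lemma exfunD:
  assumes "exfun F X" "(a, b, c, f, g) \<in> Q"
  shows "x \<in> X a \<Longrightarrow> fmap F a b f x = \<one>\<^bsub>fob F b\<^esub> \<Longrightarrow> x = \<one>\<^bsub>fob F a\<^esub>"
    and "y \<in> X b \<Longrightarrow> fmap F b c g y = \<one>\<^bsub>fob F c\<^esub> \<Longrightarrow> \<exists>x\<in>X a. fmap F a b f x = y"
    and "z \<in> X c \<Longrightarrow> \<exists>y\<in>X b. fmap F b c g y = z"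
  using assms unfolding exfun_def by blast+

lemma exfunI:
  assumes "\<And>a b c f g. (a, b, c, f, g) \<in> Q \<Longrightarrow>
    (\<forall>x\<in>X a. fmap F a b f x = \<one>\<^bsub>fob F b\<^esub> \<longrightarrow> x = \<one>\<^bsub>fob F a\<^esub>) \<and>
    (\<forall>y\<in>X b. fmap F b c g y = \<one>\<^bsub>fob F c\<^esub> \<longrightarrow> (\<exists>x\<in>X a. fmap F a b f x = y)) \<and>
    (\<forall>z\<in>X c. \<exists>y\<in>X b. fmap F b c g y = z)"
  shows "exfun F X"
  unfolding exfun_def
proof (rule ballI)
  fix q assume q: "q \<in> Q"
  obtain a b c f g where "q = (a, b, c, f, g)" by (cases q)
  with q assms[of a b c f g] show "case q of (a, b, c, f, g) \<Rightarrow>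
    (\<forall>x\<in>X a. fmap F a b f x = \<one>\<^bsub>fob F b\<^esub> \<longrightarrow> x = \<one>\<^bsub>fob F a\<^esub>) \<and>
    (\<forall>y\<in>X b. fmap F b c g y = \<one>\<^bsub>fob F c\<^esub> \<longrightarrow> (\<exists>x\<in>X a. fmap F a b f x = y)) \<and>
    (\<forall>z\<in>X c. \<exists>y\<in>X b. fmap F b c g y = z)" by simp
qed

lemma exfun_cong: "exfun F X \<Longrightarrow> (\<And>a. a \<in> S \<Longrightarrow> Y a = X a) \<Longrightarrow> exfun F Y"
  using Q_null exfunD[of F X] by (intro exfunI) auto

lemma phom_car: "phom X F G \<phi> \<Longrightarrow> a \<in> S \<Longrightarrow> x \<in> X a \<Longrightarrow> \<phi> a x \<in> car G a"
  by (auto simp: phom_def)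

lemma phom_mult: "phom X F G \<phi> \<Longrightarrow> a \<in> S \<Longrightarrow> x \<in> X a \<Longrightarrow> y \<in> X a \<Longrightarrow>
    \<phi> a (x \<otimes>\<^bsub>fob F a\<^esub> y) = \<phi> a x \<otimes>\<^bsub>fob G a\<^esub> \<phi> a y"
  by (auto simp: phom_def)

lemma phom_nat: "phom X F G \<phi> \<Longrightarrow> a \<in> S \<Longrightarrow> b \<in> S \<Longrightarrow> f \<in> arr B a b \<Longrightarrow> x \<in> X a \<Longrightarrow>
    \<phi> b (fmap F a b f x) = fmap G a b f (\<phi> a x)"
  by (auto simp: phom_def)

lemma phom_one:
  assumes "psh F" "psh G" "subfun F X" "phom X F G \<phi>" "a \<in> S"
  shows "\<phi> a \<one>\<^bsub>fob F a\<^esub> = \<one>\<^bsub>fob G a\<^esub>"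
proof -
  interpret F: comm_group "fob F a" using psh_grp assms by blast
  interpret G: comm_group "fob G a" using psh_grp assms by blast
  have o: "\<one>\<^bsub>fob F a\<^esub> \<in> X a" using subfun_one assms by blast
  have "\<phi> a \<one>\<^bsub>fob F a\<^esub> \<otimes>\<^bsub>fob G a\<^esub> \<phi> a \<one>\<^bsub>fob F a\<^esub> = \<phi> a \<one>\<^bsub>fob F a\<^esub>"
    using phom_mult[OF assms(4,5) o o] by simp
  then show ?thesis
    using phom_car[OF assms(4,5) o] G.l_cancel_one' by metis
qed

text \<open>The sum X + \<phi>(M') is the pushout of X and M' over M, because \<open>meet\<close>
  says that M' meets X exactly in M. It is an extension of M'/M by X, both exact; the proof carries
  out this argument on elements. It serves twice: to attach a cell, and to enlarge the domain of a
  partial lift.\<close>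

lemma exfun_sum:
  assumes O: "psh \<Omega>" and F: "psh F"
    and M': "subfun F M'" "exfun F M'" and M: "subfun F M" "exfun F M"
    and X: "subfun \<Omega> X" "exfun \<Omega> X" and \<phi>: "phom M' F \<Omega> \<phi>"
    and MM': "\<And>a. a \<in> S \<Longrightarrow> M a \<subseteq> M' a"
    and meet: "\<And>a m. a \<in> S \<Longrightarrow> m \<in> M' a \<Longrightarrow> \<phi> a m \<in> X a \<longleftrightarrow> m \<in> M a"
  shows "subfun \<Omega> (\<lambda>a. {x \<otimes>\<^bsub>fob \<Omega> a\<^esub> \<phi> a m |x m. x \<in> X a \<and> m \<in> M' a})" (is "subfun \<Omega> ?Y")
    and "exfun \<Omega> (\<lambda>a. {x \<otimes>\<^bsub>fob \<Omega> a\<^esub> \<phi> a m |x m. x \<in> X a \<and> m \<in> M' a})"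
proof -
  have Xc: "x \<in> car \<Omega> a" if "a \<in> S" "x \<in> X a" for a x using subfun_car[OF X(1) that] .
  have Mc: "x \<in> car F a" if "a \<in> S" "x \<in> M' a" for a x using subfun_car[OF M'(1) that] .
  have \<phi>c: "\<phi> a m \<in> car \<Omega> a" if "a \<in> S" "m \<in> M' a" for a m using phom_car[OF \<phi> that] .
  have map: "fmap \<Omega> a b f (x \<otimes>\<^bsub>fob \<Omega> a\<^esub> \<phi> a m) = fmap \<Omega> a b f x \<otimes>\<^bsub>fob \<Omega> b\<^esub> \<phi> b (fmap F a b f m)"
    if "a \<in> S" "b \<in> S" "f \<in> arr B a b" "x \<in> X a" "m \<in> M' a" for a b f x m
    using psh_mult[OF O that(1-3) Xc \<phi>c] phom_nat[OF \<phi> that(1-3)] that by simp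
  show "subfun \<Omega> ?Y"
    unfolding subfun_def
  proof (intro ballI conjI)
    fix a assume a: "a \<in> S"
    interpret comm_group "fob \<Omega> a" using psh_grp[OF O a] .
    show "?Y a \<subseteq> car \<Omega> a" using Xc[OF a] \<phi>c[OF a] by auto
    show "\<one>\<^bsub>fob \<Omega> a\<^esub> \<in> ?Y a"
      using subfun_one[OF X(1) a] subfun_one[OF M'(1) a] phom_one[OF F O M'(1) \<phi> a]
      by (intro CollectI exI[of _ "\<one>\<^bsub>fob \<Omega> a\<^esub>"] exI[of _ "\<one>\<^bsub>fob F a\<^esub>"]) simp
    fix y y' assume "y \<in> ?Y a" "y' \<in> ?Y a"
    then obtain x m x' m' where *: "y = x \<otimes>\<^bsub>fob \<Omega> a\<^esub> \<phi> a m" "x \<in> X a" "m \<in> M' a"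
      "y' = x' \<otimes>\<^bsub>fob \<Omega> a\<^esub> \<phi> a m'" "x' \<in> X a" "m' \<in> M' a" by blast
    then have "y \<otimes>\<^bsub>fob \<Omega> a\<^esub> y' = (x \<otimes>\<^bsub>fob \<Omega> a\<^esub> x') \<otimes>\<^bsub>fob \<Omega> a\<^esub> \<phi> a (m \<otimes>\<^bsub>fob F a\<^esub> m')"
      using phom_mult[OF \<phi> a] Xc[OF a] \<phi>c[OF a] by (simp add: m_ac)
    then show "y \<otimes>\<^bsub>fob \<Omega> a\<^esub> y' \<in> ?Y a"
      using * subfun_mult[OF X(1) a] subfun_mult[OF M'(1) a] by blast
  next
    fix a b f y assume a: "a \<in> S" "b \<in> S" "f \<in> arr B a b" "y \<in> ?Y a"
    then obtain x m where *: "y = x \<otimes>\<^bsub>fob \<Omega> a\<^esub> \<phi> a m" "x \<in> X a" "m \<in> M' a" by blast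
    then show "fmap \<Omega> a b f y \<in> ?Y b"
      using map[OF a(1-3)] subfun_map[OF X(1) a(1-3)] subfun_map[OF M'(1) a(1-3)] by blast
  qed
  have "(\<forall>x\<in>?Y a. fmap \<Omega> a b f x = \<one>\<^bsub>fob \<Omega> b\<^esub> \<longrightarrow> x = \<one>\<^bsub>fob \<Omega> a\<^esub>) \<and>
     (\<forall>y\<in>?Y b. fmap \<Omega> b c g y = \<one>\<^bsub>fob \<Omega> c\<^esub> \<longrightarrow> (\<exists>x\<in>?Y a. fmap \<Omega> a b f x = y)) \<and>
     (\<forall>z\<in>?Y c. \<exists>y\<in>?Y b. fmap \<Omega> b c g y = z)" if q: "(a, b, c, f, g) \<in> Q" for a b c f g
  proof (intro conjI ballI impI)
    have abc: "a \<in> S" "b \<in> S" "c \<in> S" "f \<in> arr B a b" "g \<in> arr B b c" using Q_null[OF q] by auto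
    interpret Oa: comm_group "fob \<Omega> a" using psh_grp[OF O] abc by blast
    interpret Ob: comm_group "fob \<Omega> b" using psh_grp[OF O] abc by blast
    interpret Oc: comm_group "fob \<Omega> c" using psh_grp[OF O] abc by blast
    interpret Fa: comm_group "fob F a" using psh_grp[OF F] abc by blast
    interpret Fb: comm_group "fob F b" using psh_grp[OF F] abc by blast
    interpret Fc: comm_group "fob F c" using psh_grp[OF F] abc by blast
    {
      fix y assume y: "y \<in> ?Y a" "fmap \<Omega> a b f y = \<one>\<^bsub>fob \<Omega> b\<^esub>"
      obtain x m where xm: "y = x \<otimes>\<^bsub>fob \<Omega> a\<^esub> \<phi> a m" "x \<in> X a" "m \<in> M' a" using y by blast
      have fm: "fmap F a b f m \<in> M' b" "fmap \<Omega> a b f x \<in> X b"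
        using subfun_map[OF M'(1)] subfun_map[OF X(1)] abc xm by blast+
      have "fmap \<Omega> a b f x \<otimes>\<^bsub>fob \<Omega> b\<^esub> \<phi> b (fmap F a b f m) = \<one>\<^bsub>fob \<Omega> b\<^esub>"
        using map[OF abc(1,2,4)] xm y by simp
      then have "\<phi> b (fmap F a b f m) = inv\<^bsub>fob \<Omega> b\<^esub> (fmap \<Omega> a b f x)"
        using Ob.inv_equality[of "\<phi> b (fmap F a b f m)" "fmap \<Omega> a b f x"]
          Ob.m_comm[of "\<phi> b (fmap F a b f m)" "fmap \<Omega> a b f x"]
          Xc[OF abc(2) fm(2)] \<phi>c[OF abc(2) fm(1)] by simp
      \<comment> \<open>The image of \<open>m\<close> is sent into \<open>X\<close>, hence lies in
        \<open>M\<close>. Exactness of \<open>M\<close> and injectivity on \<open>M'\<close> then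
        put \<open>m\<close> itself into \<open>M\<close>, so \<open>y\<close> was in
        \<open>X\<close> all along.\<close>
      then have "fmap F a b f m \<in> M b"
        using meet[OF abc(2) fm(1)] subfun_inv[OF O X(1) abc(2) fm(2)] by simp
      moreover have "fmap F b c g (fmap F a b f m) = \<one>\<^bsub>fob F c\<^esub>"
        using psh_null[OF F q] Mc abc xm by blast
      ultimately obtain m0 where m0: "m0 \<in> M a" "fmap F a b f m0 = fmap F a b f m"
        using exfunD(2)[OF M(2) q] by blast
      have m0': "m0 \<in> M' a" "m0 \<in> car F a" "m \<in> car F a" using m0 MM' Mc abc xm by auto
      have "fmap F a b f (m \<otimes>\<^bsub>fob F a\<^esub> inv\<^bsub>fob F a\<^esub> m0) = \<one>\<^bsub>fob F b\<^esub>"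
        using psh_mult[OF F abc(1,2,4)] psh_inv[OF F abc(1,2,4)] psh_map[OF F abc(1,2,4)] m0 m0' by simp
      moreover have "m \<otimes>\<^bsub>fob F a\<^esub> inv\<^bsub>fob F a\<^esub> m0 \<in> M' a"
        using m0' xm subfun_mult[OF M'(1)] subfun_inv[OF F M'(1)] abc by blast
      ultimately have "m \<otimes>\<^bsub>fob F a\<^esub> inv\<^bsub>fob F a\<^esub> m0 = \<one>\<^bsub>fob F a\<^esub>"
        using exfunD(1)[OF M'(2) q] by blast
      then have "m = m0" 
        using m0'(2,3) Fa.inv_equality[of m "inv\<^bsub>fob F a\<^esub> m0"] by simp
      then have "y \<in> X a"
        using m0 xm meet m0' subfun_mult[OF X(1)] abc by blast
      then show "y = \<one>\<^bsub>fob \<Omega> a\<^esub>" using exfunD(1)[OF X(2) q] y by blast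
    }
    {
      fix y assume y: "y \<in> ?Y b" "fmap \<Omega> b c g y = \<one>\<^bsub>fob \<Omega> c\<^esub>"
      obtain x m where xm: "y = x \<otimes>\<^bsub>fob \<Omega> b\<^esub> \<phi> b m" "x \<in> X b" "m \<in> M' b" using y by blast
      have gm: "fmap F b c g m \<in> M' c" "fmap \<Omega> b c g x \<in> X c"
        using subfun_map[OF M'(1)] subfun_map[OF X(1)] abc xm by blast+
      have "fmap \<Omega> b c g x \<otimes>\<^bsub>fob \<Omega> c\<^esub> \<phi> c (fmap F b c g m) = \<one>\<^bsub>fob \<Omega> c\<^esub>"
        using map[OF abc(2,3,5)] xm y by simp
      then have "\<phi> c (fmap F b c g m) = inv\<^bsub>fob \<Omega> c\<^esub> (fmap \<Omega> b c g x)"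
        using Oc.inv_equality[of "\<phi> c (fmap F b c g m)" "fmap \<Omega> b c g x"]
          Oc.m_comm[of "\<phi> c (fmap F b c g m)" "fmap \<Omega> b c g x"]
          Xc[OF abc(3) gm(2)] \<phi>c[OF abc(3) gm(1)] by simp
      then have "fmap F b c g m \<in> M c"
        using meet[OF abc(3) gm(1)] subfun_inv[OF O X(1) abc(3) gm(2)] by simp
      \<comment> \<open>\<open>m\<close> is corrected by \<open>w\<close> from \<open>M\<close>, so
        that the rest of \<open>m\<close> is killed by \<open>g\<close> and has a preimage in
        \<open>M'\<close>; the correction is absorbed into the \<open>X\<close> part.\<close>
      then obtain w where w: "w \<in> M b" "fmap F b c g w = fmap F b c g m"
        using exfunD(3)[OF M(2) q] by blast
      have w': "w \<in> M' b" "w \<in> car F b" "m \<in> car F b" using w MM' Mc abc xm by auto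
      let ?d = "m \<otimes>\<^bsub>fob F b\<^esub> inv\<^bsub>fob F b\<^esub> w"
      have "fmap F b c g ?d = \<one>\<^bsub>fob F c\<^esub>"
        using psh_mult[OF F abc(2,3,5)] psh_inv[OF F abc(2,3,5)] psh_map[OF F abc(2,3,5)] w w' by simp
      moreover have d: "?d \<in> M' b"
        using w' xm subfun_mult[OF M'(1)] subfun_inv[OF F M'(1)] abc by blast
      ultimately obtain m1 where m1: "m1 \<in> M' a" "fmap F a b f m1 = ?d"
        using exfunD(2)[OF M'(2) q] by blast
      let ?x = "x \<otimes>\<^bsub>fob \<Omega> b\<^esub> \<phi> b w"
      have x': "?x \<in> X b" using meet w w' xm abc subfun_mult[OF X(1)] by blast
      have "m = w \<otimes>\<^bsub>fob F b\<^esub> ?d" using w' by (simp add: Fb.m_ac)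
      then have "\<phi> b m = \<phi> b w \<otimes>\<^bsub>fob \<Omega> b\<^esub> \<phi> b ?d"
        using phom_mult[OF \<phi> abc(2) w'(1) d] by simp
      then have yx: "y = ?x \<otimes>\<^bsub>fob \<Omega> b\<^esub> \<phi> b ?d"
        using xm Xc \<phi>c w' d abc by (simp add: Ob.m_assoc)
      have dd: "\<phi> b ?d = fmap \<Omega> a b f (\<phi> a m1)"
        using phom_nat[OF \<phi> abc(1,2,4) m1(1)] m1(2) by simp
      have "fmap \<Omega> b c g y = fmap \<Omega> b c g ?x \<otimes>\<^bsub>fob \<Omega> c\<^esub> fmap \<Omega> b c g (\<phi> b ?d)"
        unfolding yx using psh_mult[OF O abc(2,3,5)] x' Xc \<phi>c d abc by blast
      also have "fmap \<Omega> b c g (\<phi> b ?d) = \<one>\<^bsub>fob \<Omega> c\<^esub>"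
        unfolding dd using psh_null[OF O q] \<phi>c m1 abc by blast
      finally have "fmap \<Omega> b c g ?x = \<one>\<^bsub>fob \<Omega> c\<^esub>"
        using y psh_map[OF O abc(2,3,5)] x' Xc abc by simp
      then obtain x1 where x1: "x1 \<in> X a" "fmap \<Omega> a b f x1 = ?x"
        using exfunD(2)[OF X(2) q x'] by blast
      have "fmap \<Omega> a b f (x1 \<otimes>\<^bsub>fob \<Omega> a\<^esub> \<phi> a m1) = y"
        using map[OF abc(1,2,4) x1(1) m1(1)] x1(2) m1(2) yx by simp
      then show "\<exists>x\<in>?Y a. fmap \<Omega> a b f x = y" using x1 m1 by blast
    }
    {
      fix z assume "z \<in> ?Y c"
      then obtain x m where xm: "z = x \<otimes>\<^bsub>fob \<Omega> c\<^esub> \<phi> c m" "x \<in> X c" "m \<in> M' c" by blast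
      obtain x' m' where "x' \<in> X b" "fmap \<Omega> b c g x' = x" "m' \<in> M' b" "fmap F b c g m' = m"
        using exfunD(3)[OF X(2) q] exfunD(3)[OF M'(2) q] xm by metis
      then show "\<exists>y\<in>?Y b. fmap \<Omega> b c g y = z"
        using map[OF abc(2,3,5)] xm by blast
    }
  qed
  then show "exfun \<Omega> ?Y" by (rule exfunI)
qed

section \<open>Exact hulls of small sets of elements\<close>

definition small_site :: "'z set \<Rightarrow> bool" where
  "small_site Z \<longleftrightarrow> infinite Z \<and> S \<lesssim> Z \<and> (\<forall>a\<in>S. \<forall>b\<in>S. arr B a b \<lesssim> Z)"

lemma small_site_arrows:
  assumes "small_site Z"
  shows "(SIGMA a:S. SIGMA b:S. arr B a b) \<lesssim> Z"
  using assms unfolding small_site_def by (intro lepoll_Sigma) auto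

lemma small_site_Q:
  assumes Z: "small_site Z"
  shows "Q \<lesssim> Z"
proof -
  have "Q \<subseteq> (SIGMA a:S. SIGMA b:S. SIGMA c:S. arr B a b \<times> arr B b c)"
    using Q_null by auto
  moreover have "(SIGMA a:S. SIGMA b:S. SIGMA c:S. arr B a b \<times> arr B b c) \<lesssim> Z"
    using Z unfolding small_site_def by (intro lepoll_Sigma lepoll_Times) auto
  ultimately show ?thesis using lepoll_subset by blast
qed

lemma small_site_mono:
  assumes "small_site Y" "Y \<lesssim> Z"
  shows "small_site Z"
  using assms unfolding small_site_def infinite_le_lepoll by (blast intro: lepoll_trans)

end

text \<open>\<open>Hull_surj\<close> and \<open>Hull_mid\<close> are Skolem functions for the two
  existential clauses of exactness. The injectivity clause passes to subsets and has no
  operation.\<close>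

datatype ('o, 'm, 'x) hull_op = Hull_gen "'o \<times> 'x" | Hull_one 'o | Hull_mult 'o
  | Hull_map 'o 'o 'm | Hull_surj "'o \<times> 'o \<times> 'o \<times> 'm \<times> 'm" | Hull_mid "'o \<times> 'o \<times> 'o \<times> 'm \<times> 'm"

context site
begin

primrec hull_arity :: "('o, 'm, 'x) hull_op \<Rightarrow> bool set" where
  "hull_arity (Hull_gen x) = {}"
| "hull_arity (Hull_one a) = {}"
| "hull_arity (Hull_mult a) = UNIV"
| "hull_arity (Hull_map a b f) = {True}"
| "hull_arity (Hull_surj q) = {True}"
| "hull_arity (Hull_mid q) = {True}"

text \<open>A one-sorted algebra on pairs (object, element). An operand to which the operation does
  not apply is returned unchanged, which makes the operations total without leaving the
  closure.\<close>

definition hull_opn :: "('o, 'm, 'x monoid, 'x \<Rightarrow> 'x) fctr \<Rightarrow> ('o \<Rightarrow> 'x set)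
    \<Rightarrow> ('o, 'm, 'x) hull_op \<Rightarrow> (bool \<Rightarrow> 'o \<times> 'x) \<Rightarrow> 'o \<times> 'x" where
  "hull_opn F E l k = (let x = snd (k True) in case l of
     Hull_gen y \<Rightarrow> y
   | Hull_one a \<Rightarrow> (a, \<one>\<^bsub>fob F a\<^esub>)
   | Hull_mult a \<Rightarrow> if fst (k True) = a \<and> fst (k False) = a then (a, x \<otimes>\<^bsub>fob F a\<^esub> snd (k False)) else k True
   | Hull_map a b f \<Rightarrow> if fst (k True) = a then (b, fmap F a b f x) else k True
   | Hull_surj (a, b, c, f, g) \<Rightarrow> if fst (k True) = c
       then (b, SOME y. y \<in> (if x \<in> E c then E b else car F b) \<and> fmap F b c g y = x) else k True
   | Hull_mid (a, b, c, f, g) \<Rightarrow> if fst (k True) = b \<and> fmap F b c g x = \<one>\<^bsub>fob F c\<^esub>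
       then (a, SOME y. y \<in> (if x \<in> E b then E a else car F a) \<and> fmap F a b f y = x) else k True)"

text \<open>The subfunctor \<open>E\<close> is respected because the chosen preimages of elements of \<open>E\<close> lie in \<open>E\<close>.\<close>

lemma exfun_hull:
  fixes F :: "('o, 'm, 'x monoid, 'x \<Rightarrow> 'x) fctr" and Z :: "'z set"
  assumes F: "psh F" and ex: "exfun F (car F)" and E: "subfun F E" "exfun F E"
    and Z: "small_site Z" and gens: "gens \<subseteq> Sigma S (car F)" "gens \<lesssim> Z"
  obtains H where "\<And>a x. (a, x) \<in> gens \<Longrightarrow> x \<in> H a" "subfun F H" "exfun F H"
    "subfun F (\<lambda>a. H a \<inter> E a)" "exfun F (\<lambda>a. H a \<inter> E a)" "Sigma S H \<lesssim> Z"
proof -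
  define L :: "('o, 'm, 'x) hull_op set" where
    "L = Hull_gen ` gens \<union> Hull_one ` S \<union> Hull_mult ` S \<union>
      (\<lambda>(a, b, f). Hull_map a b f) ` (SIGMA a:S. SIGMA b:S. arr B a b) \<union> Hull_surj ` Q \<union> Hull_mid ` Q"
  have inf: "infinite Z" and SZ: "S \<lesssim> Z" using Z by (auto simp: small_site_def)
  have L: "L \<lesssim> Z"
    unfolding L_def
    by (intro lepoll_Un[OF inf] lepoll_image gens small_site_arrows[OF Z] small_site_Q[OF Z] SZ)
  define W where "W = closure_under L hull_arity (hull_opn F E)"
  have WZ: "W \<lesssim> Z"
    unfolding W_def by (rule closure_under_lepoll[OF absorbing_bool[OF inf] L]) simp
  define H where "H a = {x. (a, x) \<in> W}" for a
  note WI = closure_underI[of _ L hull_arity _ "hull_opn F E", folded W_def]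
  have surj: "\<exists>y. y \<in> (if x \<in> E c then E b else car F b) \<and> fmap F b c g y = x"
    if "(a, b, c, f, g) \<in> Q" "x \<in> car F c" for a b c f g x
    using exfunD(3)[OF ex that] exfunD(3)[OF E(2) that(1)] by auto
  have mid: "\<exists>y. y \<in> (if x \<in> E b then E a else car F a) \<and> fmap F a b f y = x"
    if "(a, b, c, f, g) \<in> Q" "x \<in> car F b" "fmap F b c g x = \<one>\<^bsub>fob F c\<^esub>" for a b c f g x
    using exfunD(2)[OF ex that] exfunD(2)[OF E(2) that(1) _ that(3)] by auto
  have Ecar: "E a \<subseteq> car F a" if "a \<in> S" for a using subfun_car[OF E(1) that] by blast
  have sub: "w \<in> Sigma S (car F)" if "w \<in> W" for w
    using that unfolding W_def
  proof induction
    case (closure_underI l k)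
    show ?case
    proof (cases l)
      case (Hull_gen x)
      then show ?thesis using closure_underI(1) gens by (auto simp: L_def hull_opn_def)
    next
      case (Hull_one a)
      then show ?thesis using closure_underI(1) subfun_one[OF subfun_carrier[OF F]]
        by (auto simp: L_def hull_opn_def)
    next
      case (Hull_mult a)
      then show ?thesis using closure_underI(3)[of True] closure_underI(3)[of False]
          subfun_mult[OF subfun_carrier[OF F]]
        by (auto simp: hull_opn_def Let_def)
    next
      case (Hull_map a b f)
      then show ?thesis using closure_underI(1) closure_underI(3)[of True] psh_map[OF F]
        by (auto simp: L_def hull_opn_def Let_def)
    next
      case (Hull_surj q)
      obtain a b c f g where q: "q = (a, b, c, f, g)" by (cases q)
      have "q \<in> Q" using closure_underI(1) Hull_surj by (auto simp: L_def)
      with closure_underI(3)[of True] Hull_surj q surj[of a b c f g "snd (k True)", THEN someI_ex]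
        Q_null[of a b c f g] Ecar[of b]
      show ?thesis by (auto simp: hull_opn_def Let_def split: if_splits)
    next
      case (Hull_mid q)
      obtain a b c f g where q: "q = (a, b, c, f, g)" by (cases q)
      have "q \<in> Q" using closure_underI(1) Hull_mid by (auto simp: L_def)
      with closure_underI(3)[of True] Hull_mid q mid[of a b c f g "snd (k True)", THEN someI_ex]
        Q_null[of a b c f g] Ecar[of a]
      show ?thesis by (auto simp: hull_opn_def Let_def split: if_splits)
    qed
  qed
  have Hcar: "x \<in> car F a" if "x \<in> H a" for a x using sub that by (auto simp: H_def)
  have Hgen: "x \<in> H a" if "(a, x) \<in> gens" for a x
    using WI[of "Hull_gen (a, x)"] that by (auto simp: L_def H_def hull_opn_def)
  have sH: "subfun F H"
    unfolding subfun_def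
  proof (intro ballI conjI)
    fix a assume a: "a \<in> S"
    show "H a \<subseteq> car F a" using Hcar by blast
    show "\<one>\<^bsub>fob F a\<^esub> \<in> H a"
      using WI[of "Hull_one a"] a by (auto simp: L_def H_def hull_opn_def)
    show "x \<otimes>\<^bsub>fob F a\<^esub> y \<in> H a" if "x \<in> H a" "y \<in> H a" for x y
      using WI[of "Hull_mult a" "\<lambda>b. if b then (a, x) else (a, y)"] a that
      by (auto simp: L_def H_def hull_opn_def)
    show "fmap F a b f x \<in> H b" if "b \<in> S" "f \<in> arr B a b" "x \<in> H a" for b f x
    proof -
      have "Hull_map a b f \<in> L"
        using a that(1,2) by (auto simp: L_def intro!: image_eqI[of _ _ "(a, b, f)"])
      then show ?thesis
        using WI[of "Hull_map a b f" "\<lambda>_. (a, x)"] that(3) by (simp add: H_def hull_opn_def)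
    qed
  qed
  have Hsurj: "\<exists>y. y \<in> H b \<and> y \<in> (if x \<in> E c then E b else car F b) \<and> fmap F b c g y = x"
    if q: "(a, b, c, f, g) \<in> Q" and x: "x \<in> H c" for a b c f g x
    using WI[of "Hull_surj (a, b, c, f, g)" "\<lambda>_. (c, x)"] q x someI_ex[OF surj[OF q Hcar[OF x]]]
    by (intro exI[of _ "SOME y. y \<in> (if x \<in> E c then E b else car F b) \<and> fmap F b c g y = x"])
      (simp add: L_def H_def hull_opn_def)
  have Hmid: "\<exists>y. y \<in> H a \<and> y \<in> (if x \<in> E b then E a else car F a) \<and> fmap F a b f y = x"
    if q: "(a, b, c, f, g) \<in> Q" and x: "x \<in> H b" and 1: "fmap F b c g x = \<one>\<^bsub>fob F c\<^esub>" for a b c f g x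
    using WI[of "Hull_mid (a, b, c, f, g)" "\<lambda>_. (b, x)"] q x 1 someI_ex[OF mid[OF q Hcar[OF x] 1]]
    by (intro exI[of _ "SOME y. y \<in> (if x \<in> E b then E a else car F a) \<and> fmap F a b f y = x"])
      (simp add: L_def H_def hull_opn_def)
  have "exfun F H"
  proof (rule exfunI, intro conjI ballI impI)
    fix a b c f g assume q: "(a, b, c, f, g) \<in> Q"
    show "x = \<one>\<^bsub>fob F a\<^esub>" if "x \<in> H a" "fmap F a b f x = \<one>\<^bsub>fob F b\<^esub>" for x
      using exfunD(1)[OF ex q] Hcar that by blast
    show "\<exists>x\<in>H a. fmap F a b f x = y" if "y \<in> H b" "fmap F b c g y = \<one>\<^bsub>fob F c\<^esub>" for y
      using Hmid[OF q, of y] that by auto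
    show "\<exists>y\<in>H b. fmap F b c g y = z" if "z \<in> H c" for z
      using Hsurj[OF q, of z] that by auto
  qed
  moreover have "exfun F (\<lambda>a. H a \<inter> E a)"
  proof (rule exfunI, intro conjI ballI impI)
    fix a b c f g assume q: "(a, b, c, f, g) \<in> Q"
    show "x = \<one>\<^bsub>fob F a\<^esub>" if "x \<in> H a \<inter> E a" "fmap F a b f x = \<one>\<^bsub>fob F b\<^esub>" for x
      using exfunD(1)[OF ex q] Hcar that by blast
    show "\<exists>x\<in>H a \<inter> E a. fmap F a b f x = y"
      if "y \<in> H b \<inter> E b" "fmap F b c g y = \<one>\<^bsub>fob F c\<^esub>" for y
      using Hmid[OF q, of y] that by auto
    show "\<exists>y\<in>H b \<inter> E b. fmap F b c g y = z" if "z \<in> H c \<inter> E c" for z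
      using Hsurj[OF q, of z] that by auto
  qed
  moreover have "Sigma S H \<lesssim> Z"
    by (rule lepoll_subset[OF WZ]) (auto simp: H_def)
  ultimately show ?thesis
    using that[of H] Hgen sH subfun_Int[OF sH E(1)] by blast
qed

end

section \<open>Short exact sequences of abelian groups\<close>

lemma Ab_simps [simp]:
  "obj (Ab U) = {G. comm_group G \<and> carrier G \<in> U}"
  "carrier (Hom (Ab U) G H) = hom G H \<inter> extensional (carrier G)"
  "one (Hom (Ab U) G H) = (\<lambda>x\<in>carrier G. \<one>\<^bsub>H\<^esub>)"
  "mult (Hom (Ab U) G H) f g = (\<lambda>x\<in>carrier G. f x \<otimes>\<^bsub>H\<^esub> g x)"
  "idt (Ab U) G = (\<lambda>x\<in>carrier G. x)"
  "cmp (Ab U) G H K g f = compose (carrier G) g f"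
  by (simp_all add: Ab_def)

lemma opposite_simps [simp]:
  "obj (opposite C) = obj C" "Hom (opposite C) a b = Hom C b a" "idt (opposite C) = idt C"
  "cmp (opposite C) a b c g f = cmp C c b a f g"
  by (simp_all add: opposite_def)

definition transport_group :: "('x \<Rightarrow> 'y) \<Rightarrow> 'x set \<Rightarrow> ('x, 'z) monoid_scheme \<Rightarrow> 'y monoid" where
  "transport_group \<beta> X G = \<lparr>carrier = \<beta> ` X,
     mult = (\<lambda>x y. \<beta> (inv_into X \<beta> x \<otimes>\<^bsub>G\<^esub> inv_into X \<beta> y)), one = \<beta> \<one>\<^bsub>G\<^esub>\<rparr>"

lemma comm_group_image:
  assumes G: "comm_group G" and X: "subgroup X G"
    and T: "carrier T = \<beta> ` X" "\<one>\<^bsub>T\<^esub> = \<beta> \<one>\<^bsub>G\<^esub>"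
      "\<And>x y. x \<in> X \<Longrightarrow> y \<in> X \<Longrightarrow> \<beta> x \<otimes>\<^bsub>T\<^esub> \<beta> y = \<beta> (x \<otimes>\<^bsub>G\<^esub> y)"
  shows "comm_group T"
proof -
  interpret comm_group G by fact
  interpret X: subgroup X G by fact
  show ?thesis
  proof (rule comm_groupI)
    fix x y z
    assume "x \<in> carrier T" "y \<in> carrier T" "z \<in> carrier T"
    then obtain x' y' z' where *: "x = \<beta> x'" "y = \<beta> y'" "z = \<beta> z'" "x' \<in> X" "y' \<in> X" "z' \<in> X"
      by (auto simp: T)
    show "x \<otimes>\<^bsub>T\<^esub> y \<in> carrier T" "x \<otimes>\<^bsub>T\<^esub> y = y \<otimes>\<^bsub>T\<^esub> x"
      "x \<otimes>\<^bsub>T\<^esub> y \<otimes>\<^bsub>T\<^esub> z = x \<otimes>\<^bsub>T\<^esub> (y \<otimes>\<^bsub>T\<^esub> z)"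
      using * by (simp_all add: T m_ac)
  next
    fix x assume "x \<in> carrier T"
    then obtain x' where *: "x = \<beta> x'" "x' \<in> X" by (auto simp: T)
    show "\<one>\<^bsub>T\<^esub> \<otimes>\<^bsub>T\<^esub> x = x" using * by (simp add: T)
    show "\<exists>y\<in>carrier T. y \<otimes>\<^bsub>T\<^esub> x = \<one>\<^bsub>T\<^esub>"
      using * by (intro bexI[of _ "\<beta> (inv\<^bsub>G\<^esub> x')"]) (simp_all add: T)
  qed (simp add: T)
qed

lemma comm_group_transport:
  assumes "comm_group G" "subgroup X G" "inj_on \<beta> X"
  shows "comm_group (transport_group \<beta> X G)"
  by (rule comm_group_image[OF assms(1,2), of _ \<beta>]) (use assms(3) in \<open>auto simp: transport_group_def\<close>)

lemma universe_sub: "universe I U \<Longrightarrow> X \<in> U \<Longrightarrow> Y \<subseteq> X \<Longrightarrow> Y \<in> U"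
  using universe_subset subset_imp_lepoll by blast

lemma Ab_subobject:
  assumes U: "universe I U" and G: "G \<in> obj (Ab U)" and N: "subgroup N G"
  shows "G\<lparr>carrier := N\<rparr> \<in> obj (Ab U)"
proof -
  interpret comm_group G using G by simp
  have "N \<subseteq> carrier G" using subgroup.subset[OF N] .
  then have "N \<in> U" using universe_sub[OF U] G by auto
  moreover have "comm_group (G\<lparr>carrier := N\<rparr>)"
    using group.group_comm_groupI[OF subgroup.subgroup_is_group[OF N is_group]] \<open>N \<subseteq> carrier G\<close> m_comm
    by auto
  ultimately show ?thesis by simp
qed

text \<open>The quotient by the image of \<open>g\<close> need not have its carrier in \<open>U\<close>, so its cosets are
  replaced by representatives.\<close>

lemma Ab_quotient:
  fixes U :: "'u set set"
  assumes U: "universe I U" and L: "L \<in> obj (Ab U)" and N: "subgroup N L"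
  obtains Y p where "Y \<in> obj (Ab U)" "p \<in> arr (Ab U) L Y"
    "\<And>x. x \<in> carrier L \<Longrightarrow> p x = \<one>\<^bsub>Y\<^esub> \<longleftrightarrow> x \<in> N"
proof -
  interpret comm_group L using L by simp
  interpret N: normal N L using N normal_iff_subgroup by blast
  define \<beta> where "\<beta> c = (SOME x. x \<in> c)" for c :: "'u set"
  define X where "X = carrier (L Mod N)"
  have rep: "\<beta> c \<in> c" if "c \<in> X" for c
    using that N.rcosets_non_empty unfolding X_def \<beta>_def FactGroup_def
    by (simp add: some_in_eq N.subgroup_axioms)
  have csub: "c \<subseteq> carrier L" if "c \<in> X" for c
    using that rcosets_part_G[OF N] unfolding X_def FactGroup_def by auto
  have \<beta>: "inj_on \<beta> X"
  proof (rule inj_onI)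
    fix c d assume cd: "c \<in> X" "d \<in> X" "\<beta> c = \<beta> d"
    then have "\<beta> c \<in> c \<inter> d" using rep by (metis IntI)
    then show "c = d"
      using cd rcos_disjoint[OF N] unfolding X_def FactGroup_def pairwise_def disjnt_def by auto
  qed
  interpret Q: comm_group "L Mod N" using abelian_FactGroup[OF N] .
  define Y where "Y = transport_group \<beta> X (L Mod N)"
  have Yg: "comm_group Y"
    unfolding Y_def X_def
    using comm_group_transport[OF Q.comm_group_axioms Q.subgroup_self] \<beta> X_def by simp
  have "carrier Y \<subseteq> carrier L"
    unfolding Y_def transport_group_def using rep csub by auto
  then have YU: "carrier Y \<in> U" using universe_sub[OF U] L by auto
  define p where "p = (\<lambda>x\<in>carrier L. \<beta> (N #>\<^bsub>L\<^esub> x))"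
  have cX: "N #>\<^bsub>L\<^esub> x \<in> X" if "x \<in> carrier L" for x
    using that unfolding X_def FactGroup_def RCOSETS_def by auto
  have "p \<in> hom L Y"
  proof (rule homI)
    fix x assume x: "x \<in> carrier L"
    show "p x \<in> carrier Y" using cX x by (simp add: p_def Y_def transport_group_def)
    fix y assume y: "y \<in> carrier L"
    show "p (x \<otimes>\<^bsub>L\<^esub> y) = p x \<otimes>\<^bsub>Y\<^esub> p y"
      using x y \<beta> cX by (simp add: p_def Y_def transport_group_def N.rcos_sum)
  qed
  then have parr: "p \<in> arr (Ab U) L Y" by (simp add: p_def)
  have "p x = \<one>\<^bsub>Y\<^esub> \<longleftrightarrow> x \<in> N" if x: "x \<in> carrier L" for x
  proof -
    have "p x = \<one>\<^bsub>Y\<^esub> \<longleftrightarrow> N #>\<^bsub>L\<^esub> x = N"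
      using inj_on_eq_iff[OF \<beta> cX[OF x], of N] cX[OF one_closed] x N.subset
      by (simp add: p_def Y_def transport_group_def coset_mult_one)
    also have "\<dots> \<longleftrightarrow> x \<in> N"
      using coset_join1[OF _ x N] coset_join2[OF x N] by auto
    finally show ?thesis .
  qed
  with Yg YU parr show ?thesis using that by simp
qed

text \<open>Each elementwise condition comes from a test object in \<open>Ab U\<close>. Injectivity
  compares the inclusion of the kernel of \<open>f\<close> with the zero map; exactness in the
  middle factors the inclusion of the kernel of \<open>g\<close>; surjectivity compares the
  projection of \<open>L\<close> modulo the image of \<open>g\<close> with the zero map.\<close>

lemma short_exact_AbD:
  assumes U: "universe I U"
    and GHL: "G \<in> obj (Ab U)" "H \<in> obj (Ab U)" "L \<in> obj (Ab U)"
    and fg: "f \<in> arr (Ab U) G H" "g \<in> arr (Ab U) H L"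
    and ex: "short_exact (Ab U) G H L f g"
  shows "\<And>x. x \<in> carrier G \<Longrightarrow> f x = \<one>\<^bsub>H\<^esub> \<Longrightarrow> x = \<one>\<^bsub>G\<^esub>"
    and "\<And>y. y \<in> carrier H \<Longrightarrow> g y = \<one>\<^bsub>L\<^esub> \<Longrightarrow> \<exists>x\<in>carrier G. f x = y"
    and "\<And>z. z \<in> carrier L \<Longrightarrow> \<exists>y\<in>carrier H. g y = z"
proof -
  interpret G: comm_group G using GHL by simp
  interpret H: comm_group H using GHL by simp
  interpret L: comm_group L using GHL by simp
  interpret f: group_hom G H f using fg by unfold_locales simp
  interpret g: group_hom H L g using fg by unfold_locales simp
  have ker: "\<And>Y h. Y \<in> obj (Ab U) \<Longrightarrow> h \<in> arr (Ab U) Y H \<Longrightarrow>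
      cmp (Ab U) Y H L g h = zero_arr (Ab U) Y L \<Longrightarrow>
      \<exists>!u. u \<in> arr (Ab U) Y G \<and> cmp (Ab U) Y G H f u = h"
    and cok: "\<And>Y h. Y \<in> obj (Ab U) \<Longrightarrow> h \<in> arr (Ab U) H Y \<Longrightarrow>
      cmp (Ab U) G H Y h f = zero_arr (Ab U) G Y \<Longrightarrow>
      \<exists>!u. u \<in> arr (Ab U) L Y \<and> cmp (Ab U) H L Y u g = h"
    and gf: "cmp (Ab U) G H L g f = zero_arr (Ab U) G L"
    using ex unfolding short_exact_def kernel_of_def cokernel_of_def opposite_simps by blast+
  {
    fix x assume x: "x \<in> carrier G" "f x = \<one>\<^bsub>H\<^esub>"
    define N where "N = kernel G H f"
    have N: "subgroup N G" unfolding N_def by (rule f.subgroup_kernel)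
    let ?N = "G\<lparr>carrier := N\<rparr>"
    have 0: "zero_arr (Ab U) ?N G \<in> arr (Ab U) ?N G" "zero_arr (Ab U) ?N H \<in> arr (Ab U) ?N H"
      using subgroup.m_closed[OF N] by (auto simp: hom_def)
    have i: "(\<lambda>x\<in>N. x) \<in> arr (Ab U) ?N G"
      using subgroup.subset[OF N] subgroup.m_closed[OF N] by (auto simp: hom_def)
    have c: "cmp (Ab U) ?N G H f (zero_arr (Ab U) ?N G) = zero_arr (Ab U) ?N H"
      "cmp (Ab U) ?N G H f (\<lambda>x\<in>N. x) = zero_arr (Ab U) ?N H"
      by (auto simp: compose_def N_def kernel_def)
    have "cmp (Ab U) ?N H L g (zero_arr (Ab U) ?N H) = zero_arr (Ab U) ?N L"
      by (auto simp: compose_def)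
    from ker[OF Ab_subobject[OF U GHL(1) N] 0(2) this] 0 i c
    have "zero_arr (Ab U) ?N G = (\<lambda>x\<in>N. x)" by blast
    from fun_cong[OF this, of x] x show "x = \<one>\<^bsub>G\<^esub>"
      by (simp add: N_def kernel_def)
  }
  {
    fix y assume y: "y \<in> carrier H" "g y = \<one>\<^bsub>L\<^esub>"
    define N where "N = kernel H L g"
    have N: "subgroup N H" unfolding N_def by (rule g.subgroup_kernel)
    let ?N = "H\<lparr>carrier := N\<rparr>"
    have i: "(\<lambda>x\<in>N. x) \<in> arr (Ab U) ?N H"
      using subgroup.subset[OF N] subgroup.m_closed[OF N] by (auto simp: hom_def)
    have "cmp (Ab U) ?N H L g (\<lambda>x\<in>N. x) = zero_arr (Ab U) ?N L"
      by (auto simp: compose_def N_def kernel_def)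
    from ker[OF Ab_subobject[OF U GHL(2) N] i this] obtain u where
      u: "u \<in> arr (Ab U) ?N G" "cmp (Ab U) ?N G H f u = (\<lambda>x\<in>N. x)" by blast
    have yN: "y \<in> N" using y by (simp add: N_def kernel_def)
    from fun_cong[OF u(2), of y] yN have "f (u y) = y" by (simp add: compose_def)
    moreover have "u y \<in> carrier G" using u(1) yN by (auto simp: hom_def)
    ultimately show "\<exists>x\<in>carrier G. f x = y" by blast
  }
  {
    fix z assume z: "z \<in> carrier L"
    have N: "subgroup (g ` carrier H) L" by (rule g.img_is_subgroup)
    obtain Y p where Y: "Y \<in> obj (Ab U)" "p \<in> arr (Ab U) L Y"
      and p: "\<And>x. x \<in> carrier L \<Longrightarrow> p x = \<one>\<^bsub>Y\<^esub> \<longleftrightarrow> x \<in> g ` carrier H"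
      using Ab_quotient[OF U GHL(3) N] by blast
    interpret Y: comm_group Y using Y by simp
    have 0: "zero_arr (Ab U) L Y \<in> arr (Ab U) L Y" "zero_arr (Ab U) H Y \<in> arr (Ab U) H Y"
      by (auto simp: hom_def)
    have c: "cmp (Ab U) H L Y p g = zero_arr (Ab U) H Y"
      "cmp (Ab U) H L Y (zero_arr (Ab U) L Y) g = zero_arr (Ab U) H Y"
      using p by (auto simp: compose_def)
    have "cmp (Ab U) G H Y (zero_arr (Ab U) H Y) f = zero_arr (Ab U) G Y"
      by (auto simp: compose_def)
    from cok[OF Y(1) 0(2) this] Y(2) 0 c have "p = zero_arr (Ab U) L Y" by blast
    then have "p z = \<one>\<^bsub>Y\<^esub>" using z by simp
    then show "\<exists>y\<in>carrier H. g y = z" using p[OF z] by auto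
  }
qed

text \<open>The mediating maps are built pointwise: into \<open>G\<close> by the unique preimages
  under \<open>f\<close>, out of \<open>L\<close> by chosen preimages under \<open>g\<close>. The
  choice is harmless because two preimages differ by an element of the image of
  \<open>f\<close>.\<close>

lemma short_exact_AbI:
  assumes GHL: "G \<in> obj (Ab U)" "H \<in> obj (Ab U)" "L \<in> obj (Ab U)"
    and fg: "f \<in> arr (Ab U) G H" "g \<in> arr (Ab U) H L"
    and inj: "\<And>x. x \<in> carrier G \<Longrightarrow> f x = \<one>\<^bsub>H\<^esub> \<Longrightarrow> x = \<one>\<^bsub>G\<^esub>"
    and null: "\<And>x. x \<in> carrier G \<Longrightarrow> g (f x) = \<one>\<^bsub>L\<^esub>"
    and mid: "\<And>y. y \<in> carrier H \<Longrightarrow> g y = \<one>\<^bsub>L\<^esub> \<Longrightarrow> \<exists>x\<in>carrier G. f x = y"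
    and surj: "\<And>z. z \<in> carrier L \<Longrightarrow> \<exists>y\<in>carrier H. g y = z"
  shows "short_exact (Ab U) G H L f g"
proof -
  interpret G: comm_group G using GHL by simp
  interpret H: comm_group H using GHL by simp
  interpret L: comm_group L using GHL by simp
  interpret f: group_hom G H f using fg by unfold_locales simp
  interpret g: group_hom H L g using fg by unfold_locales simp
  have finj: "inj_on f (carrier G)"
    using inj f.inj_iff_trivial_ker by (auto simp: kernel_def)
  have gf: "cmp (Ab U) G H L g f = zero_arr (Ab U) G L"
    using null by (auto simp: compose_def)
  have "kernel_of (Ab U) H L g G f"
    unfolding kernel_of_def
  proof (intro conjI ballI impI)
    fix Y h assume Y: "Y \<in> obj (Ab U)" "h \<in> arr (Ab U) Y H"
      and h: "cmp (Ab U) Y H L g h = zero_arr (Ab U) Y L"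
    interpret Y: comm_group Y using Y by simp
    have hc: "h y \<in> carrier H" if "y \<in> carrier Y" for y using Y(2) that by (auto simp: hom_def)
    have "g (h y) = \<one>\<^bsub>L\<^esub>" if "y \<in> carrier Y" for y
      using fun_cong[OF h, of y] that by (simp add: compose_def)
    then have "\<forall>y\<in>carrier Y. \<exists>x\<in>carrier G. f x = h y" using mid hc by blast
    then obtain u where u: "\<And>y. y \<in> carrier Y \<Longrightarrow> u y \<in> carrier G \<and> f (u y) = h y" by metis
    have "restrict u (carrier Y) \<in> hom Y G"
    proof (rule homI)
      fix x y assume xy: "x \<in> carrier Y" "y \<in> carrier Y"
      have "f (u (x \<otimes>\<^bsub>Y\<^esub> y)) = f (u x \<otimes>\<^bsub>G\<^esub> u y)"
        using u xy Y(2) by (auto simp: hom_def)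
      then have "u (x \<otimes>\<^bsub>Y\<^esub> y) = u x \<otimes>\<^bsub>G\<^esub> u y"
        using inj_onD[OF finj] u xy by simp
      then show "restrict u (carrier Y) (x \<otimes>\<^bsub>Y\<^esub> y) =
          restrict u (carrier Y) x \<otimes>\<^bsub>G\<^esub> restrict u (carrier Y) y" using xy by simp
    qed (use u in auto)
    moreover have "compose (carrier Y) f (restrict u (carrier Y)) = h"
      using u Y(2) by (intro extensionalityI[of _ "carrier Y"]) (auto simp: compose_def)
    moreover have "v = restrict u (carrier Y)"
      if v: "v \<in> arr (Ab U) Y G" "cmp (Ab U) Y G H f v = h" for v
    proof (rule extensionalityI[of _ "carrier Y"])
      fix y assume y: "y \<in> carrier Y"
      have "f (v y) = h y" using fun_cong[OF v(2), of y] y by (simp add: compose_def)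
      then show "v y = restrict u (carrier Y) y"
        using inj_onD[OF finj, of "v y" "u y"] u[OF y] v(1) y by (auto simp: hom_def)
    qed (use v in auto)
    ultimately show "\<exists>!u. u \<in> arr (Ab U) Y G \<and> cmp (Ab U) Y G H f u = h" by auto
  qed (use GHL fg gf in auto)
  moreover have "cokernel_of (Ab U) G H f L g"
    unfolding cokernel_of_def kernel_of_def opposite_simps
  proof (intro conjI ballI impI)
    fix Y h assume Y: "Y \<in> obj (Ab U)" "h \<in> arr (Ab U) H Y"
      and h: "cmp (Ab U) G H Y h f = zero_arr (Ab U) G Y"
    interpret Y: comm_group Y using Y by simp
    interpret h: group_hom H Y h using Y by unfold_locales simp
    have hf: "h (f x) = \<one>\<^bsub>Y\<^esub>" if "x \<in> carrier G" for x
      using fun_cong[OF h, of x] that by (simp add: compose_def)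
    have "\<forall>z\<in>carrier L. \<exists>y\<in>carrier H. g y = z" using surj by blast
    then obtain s where s: "\<And>z. z \<in> carrier L \<Longrightarrow> s z \<in> carrier H \<and> g (s z) = z" by metis
    have indep: "h y = h y'" if yy: "y \<in> carrier H" "y' \<in> carrier H" "g y = g y'" for y y'
    proof -
      have "g (y \<otimes>\<^bsub>H\<^esub> inv\<^bsub>H\<^esub> y') = \<one>\<^bsub>L\<^esub>" using yy by simp
      moreover have "y \<otimes>\<^bsub>H\<^esub> inv\<^bsub>H\<^esub> y' \<in> carrier H" using yy(1,2) by simp
      ultimately obtain x where x: "x \<in> carrier G" "f x = y \<otimes>\<^bsub>H\<^esub> inv\<^bsub>H\<^esub> y'" using mid by blast
      have "h (y \<otimes>\<^bsub>H\<^esub> inv\<^bsub>H\<^esub> y') = \<one>\<^bsub>Y\<^esub>" using hf[OF x(1)] x(2) by simp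
      then have "h y \<otimes>\<^bsub>Y\<^esub> inv\<^bsub>Y\<^esub> (h y') = \<one>\<^bsub>Y\<^esub>" using yy(1,2) by simp
      from Y.inv_equality[OF this] yy(1,2) show ?thesis by simp
    qed
    define u where "u = (\<lambda>z\<in>carrier L. h (s z))"
    have ug: "u (g y) = h y" if "y \<in> carrier H" for y
      using indep[of "s (g y)" y] s[of "g y"] that by (simp add: u_def)
    have "u \<in> hom L Y"
    proof (rule homI)
      fix x y assume xy: "x \<in> carrier L" "y \<in> carrier L"
      have sxy: "s x \<in> carrier H" "s y \<in> carrier H" "g (s x) = x" "g (s y) = y" using s xy by auto
      have "u (g (s x \<otimes>\<^bsub>H\<^esub> s y)) = h (s x \<otimes>\<^bsub>H\<^esub> s y)" by (rule ug) (use sxy in simp)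
      then have "u (x \<otimes>\<^bsub>L\<^esub> y) = h (s x) \<otimes>\<^bsub>Y\<^esub> h (s y)" using sxy by simp
      then show "u (x \<otimes>\<^bsub>L\<^esub> y) = u x \<otimes>\<^bsub>Y\<^esub> u y" using xy by (simp add: u_def)
    qed (use s in \<open>simp add: u_def\<close>)
    moreover have "compose (carrier H) u g = h"
      using ug Y(2) by (intro extensionalityI[of _ "carrier H"]) (auto simp: compose_def)
    moreover have "v = u" if v: "v \<in> arr (Ab U) L Y" "cmp (Ab U) H L Y v g = h" for v
    proof (rule extensionalityI[of _ "carrier L"])
      fix z assume z: "z \<in> carrier L"
      have "v (g (s z)) = h (s z)"
        using fun_cong[OF v(2), of "s z"] s[OF z] by (simp add: compose_def)
      then show "v z = u z" using s[OF z] z by (simp add: u_def)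
    qed (use v in \<open>auto simp: u_def\<close>)
    ultimately show "\<exists>!u. u \<in> arr (Ab U) L Y \<and> cmp (Ab U) H L Y u g = h"
      by (auto simp: u_def)
  qed (use GHL fg gf in auto)
  ultimately show ?thesis by (simp add: short_exact_def)
qed

section \<open>Exact functors determined on a skeleton\<close>

context preadditive_category
begin

lemma zero_closed: "a \<in> obj C \<Longrightarrow> b \<in> obj C \<Longrightarrow> zero_arr C a b \<in> arr C a b"
  using hom_group[of a b] by (simp add: comm_group_def monoid.one_closed group.is_monoid)

lemma cmp_zero_right:
  assumes "a \<in> obj C" "b \<in> obj C" "c \<in> obj C" "g \<in> arr C b c"
  shows "cmp C a b c g (zero_arr C a b) = zero_arr C a c"
proof -
  interpret ab: comm_group "Hom C a b" using hom_group assms by blast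
  interpret ac: comm_group "Hom C a c" using hom_group assms by blast
  have "cmp C a b c g (zero_arr C a b) \<otimes>\<^bsub>Hom C a c\<^esub> cmp C a b c g (zero_arr C a b)
    = cmp C a b c g (zero_arr C a b)"
    using cmp_add_right[of a b c "zero_arr C a b" "zero_arr C a b" g] assms by simp
  then show ?thesis
    using cmp_closed[OF assms(1-3) ab.one_closed assms(4)] ac.l_cancel_one' by metis
qed

lemma cmp_zero_left:
  assumes "a \<in> obj C" "b \<in> obj C" "c \<in> obj C" "f \<in> arr C a b"
  shows "cmp C a b c (zero_arr C b c) f = zero_arr C a c"
proof -
  interpret bc: comm_group "Hom C b c" using hom_group assms by blast
  interpret ac: comm_group "Hom C a c" using hom_group assms by blast
  have "cmp C a b c (zero_arr C b c) f \<otimes>\<^bsub>Hom C a c\<^esub> cmp C a b c (zero_arr C b c) f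
    = cmp C a b c (zero_arr C b c) f"
    using cmp_add_left[of a b c f "zero_arr C b c" "zero_arr C b c"] assms by simp
  then show ?thesis
    using cmp_closed[OF assms(1-4) bc.one_closed] ac.l_cancel_one' by metis
qed

lemma preadditive_opposite: "preadditive_category (opposite C)"
proof (rule preadditive_category.intro)
  show "comm_group (Hom (opposite C) a b)" if "a \<in> obj (opposite C)" "b \<in> obj (opposite C)" for a b
    using that hom_group[of b a] by simp
qed (simp_all add: idt_closed cmp_closed cmp_idt_left cmp_idt_right cmp_assoc cmp_add_left cmp_add_right)

lemma cmp_cancel:
  assumes "cmp C a b a v u = idt C a" "a \<in> obj C" "b \<in> obj C" "y \<in> obj C"
    "u \<in> arr C a b" "v \<in> arr C b a" "x \<in> arr C y a"
  shows "cmp C y b a v (cmp C y a b u x) = x"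
  using cmp_assoc[of y a b a x u v] assms by (simp add: cmp_idt_left)

lemma kernel_of_iso:
  assumes k: "kernel_of C b c g a f" and g: "g \<in> arr C b c"
    and o: "a \<in> obj C" "b \<in> obj C" "c \<in> obj C" "a' \<in> obj C" "b' \<in> obj C" "c' \<in> obj C"
    and u: "ua \<in> arr C a a'" "ub \<in> arr C b b'" "uc \<in> arr C c c'"
    and v: "va \<in> arr C a' a" "vb \<in> arr C b' b" "vc \<in> arr C c' c"
    and vu: "cmp C a a' a va ua = idt C a" "cmp C b b' b vb ub = idt C b" "cmp C c c' c vc uc = idt C c"
    and uv: "cmp C a' a a' ua va = idt C a'" "cmp C b' b b' ub vb = idt C b'" "cmp C c' c c' uc vc = idt C c'"
  shows "kernel_of C b' c' (cmp C b' b c' (cmp C b c c' uc g) vb) a' (cmp C a' a b' (cmp C a b b' ub f) va)"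
proof -
  have f: "f \<in> arr C a b" and gf: "cmp C a b c g f = zero_arr C a c"
    and ker: "\<And>y h. y \<in> obj C \<Longrightarrow> h \<in> arr C y b \<Longrightarrow> cmp C y b c g h = zero_arr C y c \<Longrightarrow>
        \<exists>!u. u \<in> arr C y a \<and> cmp C y a b f u = h"
    using k by (auto simp: kernel_of_def)
  note cs = cmp_closed zero_closed cmp_zero_left cmp_zero_right
  note cn = cmp_cancel[OF vu(1) o(1,4)] cmp_cancel[OF vu(2) o(2,5)] cmp_cancel[OF vu(3) o(3,6)]
    cmp_cancel[OF uv(1) o(4,1)] cmp_cancel[OF uv(2) o(5,2)] cmp_cancel[OF uv(3) o(6,3)]
  have gf': "cmp C y b c g (cmp C y a b f x) = zero_arr C y c" if "y \<in> obj C" "x \<in> arr C y a" for y x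
    using cmp_assoc[of y a b c x f g] that o f g gf by (simp add: cs)
  show ?thesis
    unfolding kernel_of_def
  proof (intro conjI ballI impI)
    show "cmp C a' b' c' (cmp C b' b c' (cmp C b c c' uc g) vb) (cmp C a' a b' (cmp C a b b' ub f) va)
      = zero_arr C a' c'"
      using o u v f g by (simp add: cmp_assoc cs cn gf')
    fix y h assume y: "y \<in> obj C" and h: "h \<in> arr C y b'"
      and 0: "cmp C y b' c' (cmp C b' b c' (cmp C b c c' uc g) vb) h = zero_arr C y c'"
    have "cmp C y c' c vc (cmp C y c c' uc (cmp C y b c g (cmp C y b' b vb h))) = zero_arr C y c"
      using 0 o u v f g y h by (simp add: cmp_assoc cs)
    then have "cmp C y b c g (cmp C y b' b vb h) = zero_arr C y c"
      using o u v f g y h by (simp add: cn cs)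
    from ker[OF y _ this] obtain w where w: "w \<in> arr C y a" "cmp C y a b f w = cmp C y b' b vb h"
      and uniq: "\<And>w'. w' \<in> arr C y a \<Longrightarrow> cmp C y a b f w' = cmp C y b' b vb h \<Longrightarrow> w' = w"
      using o v y h cmp_closed by metis
    show "\<exists>!z. z \<in> arr C y a' \<and> cmp C y a' b' (cmp C a' a b' (cmp C a b b' ub f) va) z = h"
    proof (rule ex1I[of _ "cmp C y a a' ua w"])
      show "cmp C y a a' ua w \<in> arr C y a' \<and>
        cmp C y a' b' (cmp C a' a b' (cmp C a b b' ub f) va) (cmp C y a a' ua w) = h"
        using o u v f y h w by (simp add: cmp_assoc cs cn)
      fix z assume "z \<in> arr C y a' \<and> cmp C y a' b' (cmp C a' a b' (cmp C a b b' ub f) va) z = h"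
      then have z: "z \<in> arr C y a'"
        and zh: "cmp C y a' b' (cmp C a' a b' (cmp C a b b' ub f) va) z = h" by auto
      from zh z have "cmp C y b b' ub (cmp C y a b f (cmp C y a' a va z)) = h"
        using o u v f y by (simp add: cmp_assoc cs)
      then have "cmp C y a b f (cmp C y a' a va z) = cmp C y b' b vb h"
        using o u v f y z cmp_cancel[OF vu(2) o(2,5) y u(2) v(2)] cmp_closed by metis
      then have "cmp C y a' a va z = w" using uniq o v y z cmp_closed by metis
      then show "z = cmp C y a a' ua w" using cn(4)[OF y v(1) u(1)] z by auto
    qed
  qed (use o u v f cmp_closed in auto)
qed

end

lemma (in preadditive_category) short_exact_iso:
  assumes se: "short_exact C a b c f g" and fg: "f \<in> arr C a b" "g \<in> arr C b c"
    and o: "a \<in> obj C" "b \<in> obj C" "c \<in> obj C" "a' \<in> obj C" "b' \<in> obj C" "c' \<in> obj C"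
    and u: "ua \<in> arr C a a'" "ub \<in> arr C b b'" "uc \<in> arr C c c'"
    and v: "va \<in> arr C a' a" "vb \<in> arr C b' b" "vc \<in> arr C c' c"
    and vu: "cmp C a a' a va ua = idt C a" "cmp C b b' b vb ub = idt C b" "cmp C c c' c vc uc = idt C c"
    and uv: "cmp C a' a a' ua va = idt C a'" "cmp C b' b b' ub vb = idt C b'" "cmp C c' c c' uc vc = idt C c'"
  shows "short_exact C a' b' c' (cmp C a' a b' (cmp C a b b' ub f) va) (cmp C b' b c' (cmp C b c c' uc g) vb)"
proof -
  interpret op: preadditive_category "opposite C" by (rule preadditive_opposite)
  have "kernel_of C b' c' (cmp C b' b c' (cmp C b c c' uc g) vb) a' (cmp C a' a b' (cmp C a b b' ub f) va)"
    using se unfolding short_exact_def by (intro kernel_of_iso[OF _ fg(2) o u v vu uv]) blast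
  \<comment> \<open>The cokernel half is the kernel half in the opposite category. Arrows are
    reversed there, so the isomorphisms and their inverses trade places, as do the two ends of the
    sequence.\<close>
  moreover have "kernel_of (opposite C) b' a' (cmp (opposite C) b' b a' (cmp (opposite C) b a a' va f) ub)
      c' (cmp (opposite C) c' c b' (cmp (opposite C) c b b' vb g) uc)"
    using se fg o u v vu uv unfolding short_exact_def cokernel_of_def
    by (intro op.kernel_of_iso[where ua = vc and va = uc and vb = ub and vc = ua]) simp_all
  then have "kernel_of (opposite C) b' a' (cmp C a' a b' (cmp C a b b' ub f) va)
      c' (cmp C b' b c' (cmp C b c c' uc g) vb)"
    using fg o u v by (simp add: cmp_assoc)
  ultimately show ?thesis by (simp add: short_exact_def cokernel_of_def)
qed

definition exact_seqs :: "('o, 'm) category \<Rightarrow> 'o set \<Rightarrow> ('o \<times> 'o \<times> 'o \<times> 'm \<times> 'm) set" where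
  "exact_seqs B X = {(a, b, c, f, g). a \<in> X \<and> b \<in> X \<and> c \<in> X \<and> f \<in> arr B a b \<and> g \<in> arr B b c \<and>
     short_exact B a b c f g}"

lemma (in preadditive_category) site_exact_seqs: "X \<subseteq> obj C \<Longrightarrow> site C X (exact_seqs C X)"
  by unfold_locales (auto simp: exact_seqs_def short_exact_def kernel_of_def)

text \<open>\<open>S\<close> meets every isomorphism class, possibly more than once, and
  \<open>r s\<close> may differ from \<open>s\<close> even for \<open>s\<close> in \<open>S\<close>.
  Statements on \<open>S\<close> are therefore compared with statements at \<open>r s\<close>
  through \<open>e\<close> and \<open>e'\<close>.\<close>

locale skeleton = preadditive_category B for B :: "('o, 'm) category" +
  fixes S :: "'o set" and r :: "'o \<Rightarrow> 'o" and e e' :: "'o \<Rightarrow> 'm"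
    and I :: "'i set" and U :: "'u set set"
  assumes universe: "universe I U"
    and S_obj: "S \<subseteq> obj B"
    and r: "a \<in> obj B \<Longrightarrow> r a \<in> S"
    and e: "a \<in> obj B \<Longrightarrow> e a \<in> arr B a (r a)"
    and e': "a \<in> obj B \<Longrightarrow> e' a \<in> arr B (r a) a"
    and e'e: "a \<in> obj B \<Longrightarrow> cmp B a (r a) a (e' a) (e a) = idt B a"
    and ee': "a \<in> obj B \<Longrightarrow> cmp B (r a) a (r a) (e a) (e' a) = idt B (r a)"
    and S_small: "S \<lesssim> I"
    and arr_small: "a \<in> S \<Longrightarrow> b \<in> S \<Longrightarrow> arr B a b \<lesssim> I"

sublocale skeleton \<subseteq> full: site B "obj B" "exact_seqs B (obj B)"
  by (rule site_exact_seqs) simp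

sublocale skeleton \<subseteq> site B S "exact_seqs B S"
  by (rule site_exact_seqs[OF S_obj])

context skeleton
begin

lemma small_site_I: "small_site I"
  using universe S_small arr_small by (simp add: small_site_def universe_def)

lemma SO: "a \<in> S \<Longrightarrow> a \<in> obj B" using S_obj by blast

definition conj :: "'o \<Rightarrow> 'o \<Rightarrow> 'm \<Rightarrow> 'm" where
  "conj a b f = cmp B (r a) a (r b) (cmp B a b (r b) (e b) f) (e' a)"

lemma conj_arr: "a \<in> obj B \<Longrightarrow> b \<in> obj B \<Longrightarrow> f \<in> arr B a b \<Longrightarrow> conj a b f \<in> arr B (r a) (r b)"
  unfolding conj_def by (simp add: cmp_closed r SO e e')

lemma conj_id: "a \<in> obj B \<Longrightarrow> conj a a (idt B a) = idt B (r a)"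
  unfolding conj_def by (simp add: cmp_idt_right r SO e e' ee')

lemma conj_cmp:
  assumes "a \<in> obj B" "b \<in> obj B" "c \<in> obj B" "f \<in> arr B a b" "g \<in> arr B b c"
  shows "conj a c (cmp B a b c g f) = cmp B (r a) (r b) (r c) (conj b c g) (conj a b f)"
  using assms cmp_cancel[OF e'e[of b], of "r a" "cmp B (r a) a b f (e' a)"]
  unfolding conj_def by (simp add: cmp_assoc cmp_closed r SO e e')

lemma conj_add:
  assumes "a \<in> obj B" "b \<in> obj B" "f \<in> arr B a b" "g \<in> arr B a b"
  shows "conj a b (f \<otimes>\<^bsub>Hom B a b\<^esub> g) = conj a b f \<otimes>\<^bsub>Hom B (r a) (r b)\<^esub> conj a b g"
  using assms unfolding conj_def by (simp add: cmp_add_left cmp_add_right cmp_closed r SO e e')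

lemma conj_exact:
  assumes "(a, b, c, f, g) \<in> exact_seqs B (obj B)"
  shows "(r a, r b, r c, conj a b f, conj b c g) \<in> exact_seqs B S"
proof -
  have *: "a \<in> obj B" "b \<in> obj B" "c \<in> obj B" "f \<in> arr B a b" "g \<in> arr B b c" "short_exact B a b c f g"
    using assms by (auto simp: exact_seqs_def)
  have "short_exact B (r a) (r b) (r c) (conj a b f) (conj b c g)"
    unfolding conj_def
    by (rule short_exact_iso[OF *(6,4,5) *(1-3) SO SO SO e e e e' e' e' e'e e'e e'e ee' ee' ee'])
      (use * r in simp_all)
  then show ?thesis
    using * conj_arr r by (simp add: exact_seqs_def)
qed

lemma conj_e:
  assumes "a \<in> obj B" "b \<in> obj B" "f \<in> arr B a b"
  shows "cmp B a (r a) (r b) (conj a b f) (e a) = cmp B a b (r b) (e b) f"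
    and "cmp B (r a) (r b) b (e' b) (conj a b f) = cmp B (r a) a b f (e' a)"
proof -
  show "cmp B a (r a) (r b) (conj a b f) (e a) = cmp B a b (r b) (e b) f"
    using assms unfolding conj_def by (simp add: cmp_assoc cmp_closed r SO e e' e'e cmp_idt_right)
  show "cmp B (r a) (r b) b (e' b) (conj a b f) = cmp B (r a) a b f (e' a)"
    using assms cmp_cancel[OF e'e[of b], of "r a" "cmp B (r a) a b f (e' a)"]
    unfolding conj_def by (simp add: cmp_assoc cmp_closed r SO e e')
qed

lemma full_psh_restrict: "full.psh F \<Longrightarrow> psh F"
  by (simp add: full.psh_def psh_def SO)

lemma full_exfun_restrict:
  assumes "full.exfun F X"
  shows "exfun F X"
proof (rule exfunI)
  fix a b c f g assume "(a, b, c, f, g) \<in> exact_seqs B S"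
  then have "(a, b, c, f, g) \<in> exact_seqs B (obj B)" using SO by (auto simp: exact_seqs_def)
  from full.exfunD[OF assms this]
  show "(\<forall>x\<in>X a. fmap F a b f x = \<one>\<^bsub>fob F b\<^esub> \<longrightarrow> x = \<one>\<^bsub>fob F a\<^esub>) \<and>
    (\<forall>y\<in>X b. fmap F b c g y = \<one>\<^bsub>fob F c\<^esub> \<longrightarrow> (\<exists>x\<in>X a. fmap F a b f x = y)) \<and>
    (\<forall>z\<in>X c. \<exists>y\<in>X b. fmap F b c g y = z)" by blast
qed

lemma full_phom_restrict: "full.phom X F G \<phi> \<Longrightarrow> phom X F G \<phi>"
  by (simp add: full.phom_def phom_def SO)

text \<open>\<open>B\<close> plays the role of the opposite of \<open>A\<close>; for that choice
  this is \<open>Ex U A\<close>.\<close>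

definition Exc :: "(('o, 'm, 'u monoid, 'u \<Rightarrow> 'u) fctr, 'o \<Rightarrow> 'u \<Rightarrow> 'u) category" where
  "Exc = full_subcategory (functor_category B (Ab U)) {F. exact_functor B (Ab U) F}"

lemma Exc_simps:
  "obj Exc = {F. additive_functor B (Ab U) F \<and> exact_functor B (Ab U) F}"
  "arr Exc F G = {\<eta>. nat_trans B (Ab U) F G \<eta>} \<inter> extensional (obj B)"
  "zero_arr Exc F G = (\<lambda>a\<in>obj B. zero_arr (Ab U) (fob F a) (fob G a))"
  "idt Exc F = (\<lambda>a\<in>obj B. idt (Ab U) (fob F a))"
  "cmp Exc F G H \<theta> \<eta> = (\<lambda>a\<in>obj B. cmp (Ab U) (fob F a) (fob G a) (fob H a) (\<theta> a) (\<eta> a))"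
  by (simp_all add: Collect_conj_eq Exc_def full_subcategory_def functor_category_def)


lemma Exc_psh:
  assumes F: "F \<in> obj Exc"
  shows "full.psh F"
proof -
  have ad: "fmap F a b \<in> hom (Hom B a b) (Hom (Ab U) (fob F a) (fob F b))"
    if "a \<in> obj B" "b \<in> obj B" for a b
    using F that by (simp add: Exc_simps additive_functor_def)
  have fu: "\<And>a. a \<in> obj B \<Longrightarrow> comm_group (fob F a)"
    "\<And>a b f. a \<in> obj B \<Longrightarrow> b \<in> obj B \<Longrightarrow> f \<in> arr B a b \<Longrightarrow> fmap F a b f \<in> hom (fob F a) (fob F b)"
    "\<And>a. a \<in> obj B \<Longrightarrow> fmap F a a (idt B a) = (\<lambda>x\<in>car F a. x)"
    "\<And>a b c f g. a \<in> obj B \<Longrightarrow> b \<in> obj B \<Longrightarrow> c \<in> obj B \<Longrightarrow> f \<in> arr B a b \<Longrightarrow> g \<in> arr B b c \<Longrightarrow>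
      fmap F a c (cmp B a b c g f) = compose (car F a) (fmap F b c g) (fmap F a b f)"
    using F by (auto simp: Exc_simps additive_functor_def is_functor_def)
  show ?thesis
    using hom_mult[OF ad]
    unfolding full.psh_def by (simp add: fu compose_def)
qed

lemma Exc_U: "F \<in> obj Exc \<Longrightarrow> a \<in> obj B \<Longrightarrow> car F a \<in> U"
  by (auto simp: Exc_simps additive_functor_def is_functor_def)

lemma Exc_exfun:
  assumes F: "F \<in> obj Exc"
  shows "full.exfun F (car F)"
proof (rule full.exfunI)
  fix a b c f g assume "(a, b, c, f, g) \<in> exact_seqs B (obj B)"
  then have *: "a \<in> obj B" "b \<in> obj B" "c \<in> obj B" "f \<in> arr B a b" "g \<in> arr B b c" "short_exact B a b c f g"
    by (auto simp: exact_seqs_def)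
  have ob: "fob F a \<in> obj (Ab U)" if "a \<in> obj B" for a
    using F that by (auto simp: Exc_simps additive_functor_def is_functor_def)
  have ar: "fmap F a b f \<in> arr (Ab U) (fob F a) (fob F b)" if "a \<in> obj B" "b \<in> obj B" "f \<in> arr B a b" for a b f
    using F that by (auto simp: Exc_simps additive_functor_def is_functor_def)
  have "short_exact (Ab U) (fob F a) (fob F b) (fob F c) (fmap F a b f) (fmap F b c g)"
    using F * by (auto simp: Exc_simps exact_functor_def)
  from short_exact_AbD[OF universe ob ob ob ar ar this] *
  show "(\<forall>x\<in>car F a. fmap F a b f x = \<one>\<^bsub>fob F b\<^esub> \<longrightarrow> x = \<one>\<^bsub>fob F a\<^esub>) \<and>
    (\<forall>y\<in>car F b. fmap F b c g y = \<one>\<^bsub>fob F c\<^esub> \<longrightarrow> (\<exists>x\<in>car F a. fmap F a b f x = y)) \<and>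
    (\<forall>z\<in>car F c. \<exists>y\<in>car F b. fmap F b c g y = z)" by blast
qed

text \<open>Arrows of \<open>Ab\<close> are extensional functions, whereas \<open>psh\<close>
  constrains \<open>fmap\<close> on carriers only.\<close>

definition extensionalize :: "('o, 'm, 'u monoid, 'u \<Rightarrow> 'u) fctr \<Rightarrow> ('o, 'm, 'u monoid, 'u \<Rightarrow> 'u) fctr" where
  "extensionalize F = \<lparr>fob = fob F, fmap = (\<lambda>a b f. restrict (fmap F a b f) (car F a))\<rparr>"

lemma Exc_extensionalize:
  assumes F: "full.psh F" and ex: "full.exfun F (car F)" and FU: "\<And>a. a \<in> obj B \<Longrightarrow> car F a \<in> U"
  shows "extensionalize F \<in> obj Exc"
proof -
  have ob: "fob F a \<in> obj (Ab U)" if "a \<in> obj B" for a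
    using full.psh_grp[OF F that] FU[OF that] by simp
  have hm: "restrict (fmap F a b f) (car F a) \<in> hom (fob F a) (fob F b)"
    if "a \<in> obj B" "b \<in> obj B" "f \<in> arr B a b" for a b f
  proof (rule homI)
    interpret comm_group "fob F a" using full.psh_grp[OF F that(1)] .
    fix x y assume "x \<in> car F a" "y \<in> car F a"
    then show "restrict (fmap F a b f) (car F a) (x \<otimes>\<^bsub>fob F a\<^esub> y) =
        restrict (fmap F a b f) (car F a) x \<otimes>\<^bsub>fob F b\<^esub> restrict (fmap F a b f) (car F a) y"
      using full.psh_mult[OF F that] by simp
  qed (use full.psh_map[OF F that] in simp)
  have fn: "is_functor B (Ab U) (extensionalize F)"
    unfolding is_functor_def
  proof (intro conjI ballI)
    show "fmap (extensionalize F) a c (cmp B a b c g f) =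
      cmp (Ab U) (fob (extensionalize F) a) (fob (extensionalize F) b) (fob (extensionalize F) c)
        (fmap (extensionalize F) b c g) (fmap (extensionalize F) a b f)"
      if "a \<in> obj B" "b \<in> obj B" "c \<in> obj B" "f \<in> arr B a b" "g \<in> arr B b c" for a b c f g
      using full.psh_cmp[OF F that] full.psh_map[OF F that(1,2,4)]
      by (auto simp: extensionalize_def compose_def fun_eq_iff)
    show "fmap (extensionalize F) a a (idt B a) = idt (Ab U) (fob (extensionalize F) a)"
      if "a \<in> obj B" for a
      using full.psh_id[OF F that] by (auto simp: extensionalize_def fun_eq_iff)
  qed (use ob hm in \<open>simp_all add: extensionalize_def\<close>)
  moreover have "fmap (extensionalize F) a b \<in>
      hom (Hom B a b) (Hom (Ab U) (fob (extensionalize F) a) (fob (extensionalize F) b))"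
    if "a \<in> obj B" "b \<in> obj B" for a b
  proof (rule homI)
    interpret H: comm_group "Hom B a b" using hom_group that by blast
    fix f g assume fg: "f \<in> arr B a b" "g \<in> arr B a b"
    then show "fmap (extensionalize F) a b (f \<otimes>\<^bsub>Hom B a b\<^esub> g) = fmap (extensionalize F) a b f
        \<otimes>\<^bsub>Hom (Ab U) (fob (extensionalize F) a) (fob (extensionalize F) b)\<^esub> fmap (extensionalize F) a b g"
      using full.psh_add[OF F that fg] by (auto simp: extensionalize_def fun_eq_iff)
  qed (use hm that in \<open>simp add: extensionalize_def\<close>)
  ultimately have ad: "additive_functor B (Ab U) (extensionalize F)"
    by (simp add: additive_functor_def)
  have "short_exact (Ab U) (fob F a) (fob F b) (fob F c)
      (restrict (fmap F a b f) (car F a)) (restrict (fmap F b c g) (car F b))"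
    if *: "a \<in> obj B" "b \<in> obj B" "c \<in> obj B" "f \<in> arr B a b" "g \<in> arr B b c" "short_exact B a b c f g"
    for a b c f g
  proof -
    have q: "(a, b, c, f, g) \<in> exact_seqs B (obj B)" using * by (simp add: exact_seqs_def)
    show ?thesis
      using full.exfunD[OF ex q] full.psh_null[OF F q] full.psh_map[OF F *(1,2,4)] ob hm *
      by (intro short_exact_AbI) auto
  qed
  with ad show ?thesis
    by (simp add: Exc_simps exact_functor_def extensionalize_def)
qed

text \<open>Precomposition with the equivalence onto the representatives, whose action on arrows is
  \<open>conj\<close>. It turns a functor known on \<open>S\<close> into one on all of
  \<open>B\<close>.\<close>

definition pullback_fctr :: "('o, 'm, 'x monoid, 'x \<Rightarrow> 'x) fctr \<Rightarrow> ('o, 'm, 'x monoid, 'x \<Rightarrow> 'x) fctr" where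
  "pullback_fctr F = \<lparr>fob = (\<lambda>a. fob F (r a)), fmap = (\<lambda>a b f. fmap F (r a) (r b) (conj a b f))\<rparr>"

lemma full_psh_pullback: "psh F \<Longrightarrow> full.psh (pullback_fctr F)"
  unfolding full.psh_def pullback_fctr_def
  by (simp add: r conj_arr conj_id conj_cmp conj_add psh_grp psh_id psh_cmp psh_add)
    (simp add: psh_def r conj_arr)

lemma full_exfun_pullback:
  assumes "exfun F (car F)"
  shows "full.exfun (pullback_fctr F) (car (pullback_fctr F))"
proof (rule full.exfunI)
  fix a b c f g assume "(a, b, c, f, g) \<in> exact_seqs B (obj B)"
  from exfunD[OF assms conj_exact[OF this]]
  show "(\<forall>x\<in>car (pullback_fctr F) a. fmap (pullback_fctr F) a b f x = \<one>\<^bsub>fob (pullback_fctr F) b\<^esub> \<longrightarrow>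
       x = \<one>\<^bsub>fob (pullback_fctr F) a\<^esub>) \<and>
    (\<forall>y\<in>car (pullback_fctr F) b. fmap (pullback_fctr F) b c g y = \<one>\<^bsub>fob (pullback_fctr F) c\<^esub> \<longrightarrow>
       (\<exists>x\<in>car (pullback_fctr F) a. fmap (pullback_fctr F) a b f x = y)) \<and>
    (\<forall>z\<in>car (pullback_fctr F) c. \<exists>y\<in>car (pullback_fctr F) b. fmap (pullback_fctr F) b c g y = z)"
    by (simp add: pullback_fctr_def)
qed

end

section \<open>Transport of a subfunctor to another type\<close>

context site
begin

definition transport_fctr :: "('o, 'm, 'x monoid, 'x \<Rightarrow> 'x) fctr \<Rightarrow> ('o \<Rightarrow> 'x set) \<Rightarrow> ('o \<Rightarrow> 'x \<Rightarrow> 'y)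
    \<Rightarrow> ('o, 'm, 'y monoid, 'y \<Rightarrow> 'y) fctr" where
  "transport_fctr F X \<beta> = \<lparr>fob = (\<lambda>a. transport_group (\<beta> a) (X a) (fob F a)),
     fmap = (\<lambda>a b f x. \<beta> b (fmap F a b f (inv_into (X a) (\<beta> a) x)))\<rparr>"

text \<open>Stated for an arbitrary target \<open>T\<close>, because it also has to recognise
  functors that are decoded from sets of facts and are not of the form
  \<open>transport_fctr\<close>.\<close>

definition fiso :: "('o, 'm, 'x monoid, 'x \<Rightarrow> 'x) fctr \<Rightarrow> ('o \<Rightarrow> 'x set) \<Rightarrow> ('o \<Rightarrow> 'x \<Rightarrow> 'y)
    \<Rightarrow> ('o, 'm, 'y monoid, 'y \<Rightarrow> 'y) fctr \<Rightarrow> bool" where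
  "fiso F X \<beta> T \<longleftrightarrow> (\<forall>a\<in>S. inj_on (\<beta> a) (X a) \<and> car T a = \<beta> a ` X a \<and>
     \<one>\<^bsub>fob T a\<^esub> = \<beta> a \<one>\<^bsub>fob F a\<^esub> \<and>
     (\<forall>x\<in>X a. \<forall>y\<in>X a. \<beta> a x \<otimes>\<^bsub>fob T a\<^esub> \<beta> a y = \<beta> a (x \<otimes>\<^bsub>fob F a\<^esub> y)) \<and>
     (\<forall>b\<in>S. \<forall>f\<in>arr B a b. \<forall>x\<in>X a. fmap T a b f (\<beta> a x) = \<beta> b (fmap F a b f x)))"

lemma fiso_transport:
  "(\<And>a. a \<in> S \<Longrightarrow> inj_on (\<beta> a) (X a)) \<Longrightarrow> fiso F X \<beta> (transport_fctr F X \<beta>)"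
  by (simp add: fiso_def transport_fctr_def transport_group_def)

lemma fisoD:
  assumes "fiso F X \<beta> T" "a \<in> S"
  shows "inj_on (\<beta> a) (X a)" "car T a = \<beta> a ` X a" "\<one>\<^bsub>fob T a\<^esub> = \<beta> a \<one>\<^bsub>fob F a\<^esub>"
    "x \<in> X a \<Longrightarrow> y \<in> X a \<Longrightarrow> \<beta> a x \<otimes>\<^bsub>fob T a\<^esub> \<beta> a y = \<beta> a (x \<otimes>\<^bsub>fob F a\<^esub> y)"
    "b \<in> S \<Longrightarrow> f \<in> arr B a b \<Longrightarrow> x \<in> X a \<Longrightarrow> fmap T a b f (\<beta> a x) = \<beta> b (fmap F a b f x)"
  using assms by (simp_all add: fiso_def)

lemma psh_fiso:
  assumes F: "psh F" and X: "subfun F X" and T: "fiso F X \<beta> T"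
  shows "psh T"
proof -
  have grp: "comm_group (fob T a)" if "a \<in> S" for a
    by (rule comm_group_image[OF psh_grp[OF F that] subfun_subgroup[OF F X that] fisoD(2-4)[OF T that]])
  note ts = fisoD(2-5)[OF T]
  have hm: "fmap T a b f \<in> hom (fob T a) (fob T b)" if *: "a \<in> S" "b \<in> S" "f \<in> arr B a b" for a b f
  proof (rule homI)
    fix x assume "x \<in> car T a"
    then obtain x' where x: "x = \<beta> a x'" "x' \<in> X a" using * by (auto simp: ts)
    then show "fmap T a b f x \<in> car T b"
      using subfun_map[OF X *] * by (simp add: ts)
    fix y assume "y \<in> car T a"
    then obtain y' where y: "y = \<beta> a y'" "y' \<in> X a" using * by (auto simp: ts)
    show "fmap T a b f (x \<otimes>\<^bsub>fob T a\<^esub> y) = fmap T a b f x \<otimes>\<^bsub>fob T b\<^esub> fmap T a b f y"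
      using x y * subfun_map[OF X *] subfun_mult[OF X *(1)] psh_mult[OF F *] subfun_car[OF X *(1)]
      by (simp add: ts)
  qed
  show ?thesis
    unfolding psh_def
  proof (intro conjI ballI grp hm)
    fix a x assume a: "a \<in> S" and "x \<in> car T a"
    then obtain x' where x: "x = \<beta> a x'" "x' \<in> X a" using a by (auto simp: ts)
    show "fmap T a a (idt B a) x = x"
      using x a psh_id[OF F a] subfun_car[OF X a] idt_closed S_obj by (simp add: ts subset_iff)
    fix b f g assume b: "b \<in> S" and f: "f \<in> arr B a b"
    show "fmap T a c (cmp B a b c h f) x = fmap T b c h (fmap T a b f x)"
      if "c \<in> S" "h \<in> arr B b c" for c h
    proof -
      have "cmp B a b c h f \<in> arr B a c" using cmp_closed[of a b c f h] that a b f S_obj by blast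
      then show ?thesis
        using that x a b f subfun_map[OF X a b f] psh_cmp[OF F a b that(1) f that(2)] subfun_car[OF X a]
        by (simp add: ts)
    qed
    assume g: "g \<in> arr B a b"
    have "f \<otimes>\<^bsub>Hom B a b\<^esub> g \<in> arr B a b"
      using hom_grp[OF a b] f g by (simp add: comm_group_def monoid.m_closed group.is_monoid)
    then show "fmap T a b (f \<otimes>\<^bsub>Hom B a b\<^esub> g) x = fmap T a b f x \<otimes>\<^bsub>fob T b\<^esub> fmap T a b g x"
      using f g x a b subfun_map[OF X a b f] subfun_map[OF X a b g] psh_add[OF F a b f g] subfun_car[OF X a]
      by (simp add: ts)
  qed
qed

lemma subfun_fiso:
  assumes X: "subfun F X" and T: "fiso F X \<beta> T"
    and Y: "subfun F Y" "\<And>a. a \<in> S \<Longrightarrow> Y a \<subseteq> X a"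
  shows "subfun T (\<lambda>a. \<beta> a ` Y a)"
proof -
  note ts = fisoD(2-5)[OF T]
  have YX: "y \<in> X a" if "a \<in> S" "y \<in> Y a" for a y using Y(2) that by blast
  show ?thesis
    unfolding subfun_def
    by (auto simp: ts YX subfun_one[OF Y(1)] subfun_mult[OF Y(1)] subfun_map[OF Y(1)])
qed

lemma exfun_fiso:
  assumes X: "subfun F X" and T: "fiso F X \<beta> T"
    and Y: "exfun F Y" "\<And>a. a \<in> S \<Longrightarrow> Y a \<subseteq> X a"
  shows "exfun T (\<lambda>a. \<beta> a ` Y a)"
proof (rule exfunI, intro conjI ballI impI)
  fix a b c f g assume q: "(a, b, c, f, g) \<in> Q"
  note * = Q_null[OF q]
  note ts = fisoD(2-5)[OF T]
  have YX: "y \<in> X a" if "a \<in> S" "y \<in> Y a" for a y using Y(2) that by blast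
  {
    fix x assume x: "x \<in> \<beta> a ` Y a"
      and 1: "fmap T a b f x = \<one>\<^bsub>fob T b\<^esub>"
    then obtain x' where x': "x = \<beta> a x'" "x' \<in> Y a" by auto
    with 1 have "\<beta> b (fmap F a b f x') = \<beta> b \<one>\<^bsub>fob F b\<^esub>" using * YX by (simp add: ts)
    then have "fmap F a b f x' = \<one>\<^bsub>fob F b\<^esub>"
      using inj_onD[OF fisoD(1)[OF T]] * x' YX subfun_map[OF X] subfun_one[OF X] by blast
    then show "x = \<one>\<^bsub>fob T a\<^esub>"
      using exfunD(1)[OF Y(1) q] x' * by (simp add: ts)
  }
  {
    fix y assume y: "y \<in> \<beta> b ` Y b"
      and 1: "fmap T b c g y = \<one>\<^bsub>fob T c\<^esub>"
    then obtain y' where y': "y = \<beta> b y'" "y' \<in> Y b" by auto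
    with 1 have "\<beta> c (fmap F b c g y') = \<beta> c \<one>\<^bsub>fob F c\<^esub>" using * YX by (simp add: ts)
    then have "fmap F b c g y' = \<one>\<^bsub>fob F c\<^esub>"
      using inj_onD[OF fisoD(1)[OF T]] * y' YX subfun_map[OF X] subfun_one[OF X] by blast
    then obtain x where "x \<in> Y a" "fmap F a b f x = y'"
      using exfunD(2)[OF Y(1) q] y' by blast
    then show "\<exists>x\<in>\<beta> a ` Y a. fmap T a b f x = y"
      using y' YX * by (auto simp: ts)
  }
  {
    fix z assume "z \<in> \<beta> c ` Y c"
    then obtain z' where z': "z = \<beta> c z'" "z' \<in> Y c" by auto
    then obtain y where "y \<in> Y b" "fmap F b c g y = z'"
      using exfunD(3)[OF Y(1) q] by blast
    then show "\<exists>y\<in>\<beta> b ` Y b. fmap T b c g y = z"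
      using z' YX * by (auto simp: ts)
  }
qed

end

section \<open>Morphisms of exact functors and realization inside the universe\<close>

context skeleton
begin

lemma Exc_arrD:
  assumes "F \<in> obj Exc" "G \<in> obj Exc" "\<eta> \<in> arr Exc F G"
  shows "full.phom (car F) F G \<eta>"
proof -
  have ar: "\<eta> a \<in> hom (fob F a) (fob G a)" if "a \<in> obj B" for a
    using assms that by (auto simp: Exc_simps nat_trans_def)
  have na: "compose (car F a) (\<eta> b) (fmap F a b f) = compose (car F a) (fmap G a b f) (\<eta> a)"
    if "a \<in> obj B" "b \<in> obj B" "f \<in> arr B a b" for a b f
    using assms that by (auto simp: Exc_simps nat_trans_def)
  show ?thesis
    unfolding full.phom_def
  proof (intro ballI conjI)
    fix a x assume a: "a \<in> obj B" and x: "x \<in> car F a"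
    show "\<eta> a x \<in> car G a" using ar[OF a] x by (rule hom_in_carrier)
    show "\<eta> a (x \<otimes>\<^bsub>fob F a\<^esub> y) = \<eta> a x \<otimes>\<^bsub>fob G a\<^esub> \<eta> a y" if "y \<in> car F a" for y
      using ar[OF a] x that by (rule hom_mult)
    show "\<eta> b (fmap F a b f x) = fmap G a b f (\<eta> a x)" if "b \<in> obj B" "f \<in> arr B a b" for b f
      using fun_cong[OF na[OF a that], of x] x by (simp add: compose_def)
  qed
qed

definition restrict_family :: "('o, 'm, 'u monoid, 'u \<Rightarrow> 'u) fctr \<Rightarrow> ('o \<Rightarrow> 'u \<Rightarrow> 'u) \<Rightarrow> 'o \<Rightarrow> 'u \<Rightarrow> 'u" where
  "restrict_family F \<phi> = (\<lambda>a\<in>obj B. restrict (\<phi> a) (car F a))"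

lemma restrict_family_app [simp]: "a \<in> obj B \<Longrightarrow> x \<in> car F a \<Longrightarrow> restrict_family F \<phi> a x = \<phi> a x"
  by (simp add: restrict_family_def)

lemma Exc_arrI:
  assumes F: "F \<in> obj Exc" and G: "G \<in> obj Exc" and \<phi>: "full.phom (car F) F G \<phi>"
  shows "restrict_family F \<phi> \<in> arr Exc F G"
proof -
  note pF = Exc_psh[OF F]
  have hm: "restrict (\<phi> a) (car F a) \<in> hom (fob F a) (fob G a)" if a: "a \<in> obj B" for a
  proof (rule homI)
    interpret comm_group "fob F a" using full.psh_grp[OF pF a] .
    fix x y assume "x \<in> car F a" "y \<in> car F a"
    then show "restrict (\<phi> a) (car F a) (x \<otimes>\<^bsub>fob F a\<^esub> y) =
        restrict (\<phi> a) (car F a) x \<otimes>\<^bsub>fob G a\<^esub> restrict (\<phi> a) (car F a) y"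
      using full.phom_mult[OF \<phi> a] by simp
  qed (use full.phom_car[OF \<phi> a] in simp)
  have "nat_trans B (Ab U) F G (restrict_family F \<phi>)"
    unfolding nat_trans_def
  proof (intro conjI ballI)
    fix a b f assume *: "a \<in> obj B" "b \<in> obj B" "f \<in> arr B a b"
    show "cmp (Ab U) (fob F a) (fob F b) (fob G b) (restrict_family F \<phi> b) (fmap F a b f) =
      cmp (Ab U) (fob F a) (fob G a) (fob G b) (fmap G a b f) (restrict_family F \<phi> a)"
      using full.psh_map[OF pF *] full.phom_nat[OF \<phi> *] *
      by (auto simp: compose_def fun_eq_iff)
  qed (simp add: hm restrict_family_def)
  then show ?thesis by (simp add: Exc_simps restrict_family_def)
qed

lemma Exc_eqI:
  assumes "F \<in> obj Exc" "G \<in> obj Exc" "\<eta> \<in> arr Exc F G" "\<theta> \<in> arr Exc F G"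
    and eq: "\<And>a x. a \<in> obj B \<Longrightarrow> x \<in> car F a \<Longrightarrow> \<eta> a x = \<theta> a x"
  shows "\<eta> = \<theta>"
proof (rule extensionalityI[of _ "obj B"])
  fix a assume a: "a \<in> obj B"
  show "\<eta> a = \<theta> a"
    by (rule extensionalityI[of _ "car F a"]) (use assms a in \<open>auto simp: Exc_simps nat_trans_def\<close>)
qed (use assms in \<open>simp_all add: Exc_simps\<close>)

lemma fmap_e':
  assumes "full.psh F" "a \<in> obj B" "x \<in> car F a"
  shows "fmap F (r a) a (e' a) (fmap F a (r a) (e a) x) = x"
  using assms full.psh_cmp[of F a "r a" a "e a" "e' a" x] full.psh_id[of F a x]
  by (simp add: r SO e e' e'e)

lemma fmap_e:
  assumes "full.psh F" "a \<in> obj B" "x \<in> car F (r a)"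
  shows "fmap F a (r a) (e a) (fmap F (r a) a (e' a) x) = x"
  using assms full.psh_cmp[of F "r a" a "r a" "e' a" "e a" x] full.psh_id[of F "r a" x]
  by (simp add: r SO e e' ee')

text \<open>Naturality along \<open>e' a\<close> determines the component at \<open>a\<close> from
  the component at \<open>r a\<close>.\<close>

lemma Exc_eqI_skeleton:
  assumes FG: "F \<in> obj Exc" "G \<in> obj Exc" and \<eta>: "\<eta> \<in> arr Exc F G" and \<theta>: "\<theta> \<in> arr Exc F G"
    and eq: "\<And>s x. s \<in> S \<Longrightarrow> x \<in> car F s \<Longrightarrow> \<eta> s x = \<theta> s x"
  shows "\<eta> = \<theta>"
proof (rule Exc_eqI[OF FG \<eta> \<theta>])
  fix a x assume a: "a \<in> obj B" and x: "x \<in> car F a"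
  note pF = Exc_psh[OF FG(1)] and pG = Exc_psh[OF FG(2)]
  note h\<eta> = Exc_arrD[OF FG \<eta>] and h\<theta> = Exc_arrD[OF FG \<theta>]
  let ?y = "fmap F a (r a) (e a) x"
  have y: "?y \<in> car F (r a)" using full.psh_map[OF pF a _ _ x] e r SO a by blast
  have "\<eta> a x = fmap G (r a) a (e' a) (\<eta> (r a) ?y)"
    using full.phom_nat[OF h\<eta> _ _ _ y, of a "e' a"] fmap_e'[OF pF a x] a e' r SO by simp
  also have "\<dots> = fmap G (r a) a (e' a) (\<theta> (r a) ?y)" using eq[OF r[OF a] y] by simp
  also have "\<dots> = \<theta> a x"
    using full.phom_nat[OF h\<theta> _ _ _ y, of a "e' a"] fmap_e'[OF pF a x] a e' r SO by simp
  finally show "\<eta> a x = \<theta> a x" .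
qed

lemma Exc_cmp_app: "a \<in> obj B \<Longrightarrow> x \<in> car F a \<Longrightarrow> cmp Exc F G H \<theta> \<eta> a x = \<theta> a (\<eta> a x)"
  by (simp add: Exc_simps compose_def)

lemma Exc_cmp_closed:
  assumes o: "F \<in> obj Exc" "G \<in> obj Exc" "H \<in> obj Exc"
    and \<eta>: "\<eta> \<in> arr Exc F G" and \<theta>: "\<theta> \<in> arr Exc G H"
  shows "cmp Exc F G H \<theta> \<eta> \<in> arr Exc F H"
proof -
  note h\<eta> = Exc_arrD[OF o(1,2) \<eta>] and h\<theta> = Exc_arrD[OF o(2,3) \<theta>]
  have "full.phom (car F) F H (\<lambda>a x. \<theta> a (\<eta> a x))"
    unfolding full.phom_def
    using full.phom_car[OF h\<eta>] full.phom_car[OF h\<theta>] full.phom_mult[OF h\<eta>] full.phom_mult[OF h\<theta>]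
      full.phom_nat[OF h\<eta>] full.phom_nat[OF h\<theta>] by simp
  moreover have "cmp Exc F G H \<theta> \<eta> = restrict_family F (\<lambda>a x. \<theta> a (\<eta> a x))"
    by (simp add: Exc_simps restrict_family_def compose_def)
  ultimately show ?thesis using Exc_arrI[OF o(1,3)] by simp
qed

lemma Exc_zero_app: "a \<in> obj B \<Longrightarrow> x \<in> car F a \<Longrightarrow> zero_arr Exc F G a x = \<one>\<^bsub>fob G a\<^esub>"
  by (simp add: Exc_simps)

lemma Exc_zero_closed:
  assumes o: "F \<in> obj Exc" "G \<in> obj Exc"
  shows "zero_arr Exc F G \<in> arr Exc F G"
proof -
  note pG = Exc_psh[OF o(2)]
  have "full.phom (car F) F G (\<lambda>a x. \<one>\<^bsub>fob G a\<^esub>)"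
    unfolding full.phom_def
  proof (intro ballI conjI)
    fix a assume a: "a \<in> obj B"
    interpret comm_group "fob G a" using full.psh_grp[OF pG a] .
    show "\<one>\<^bsub>fob G a\<^esub> \<in> car G a" "\<one>\<^bsub>fob G a\<^esub> = \<one>\<^bsub>fob G a\<^esub> \<otimes>\<^bsub>fob G a\<^esub> \<one>\<^bsub>fob G a\<^esub>" by simp_all
    show "\<one>\<^bsub>fob G b\<^esub> = fmap G a b f \<one>\<^bsub>fob G a\<^esub>" if "b \<in> obj B" "f \<in> arr B a b" for b f
      using full.psh_one[OF pG a that] by simp
  qed
  moreover have "zero_arr Exc F G = restrict_family F (\<lambda>a x. \<one>\<^bsub>fob G a\<^esub>)"
    by (simp add: Exc_simps restrict_family_def)
  ultimately show ?thesis using Exc_arrI[OF o] by simp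
qed

lemma Exc_idt_app: "a \<in> obj B \<Longrightarrow> x \<in> car F a \<Longrightarrow> idt Exc F a x = x"
  by (simp add: Exc_simps)

lemma Exc_idt_closed:
  assumes F: "F \<in> obj Exc"
  shows "idt Exc F \<in> arr Exc F F"
proof -
  have "full.phom (car F) F F (\<lambda>a x. x)" by (simp add: full.phom_def)
  moreover have "idt Exc F = restrict_family F (\<lambda>a x. x)"
    by (simp add: Exc_simps restrict_family_def)
  ultimately show ?thesis using Exc_arrI[OF F F] by simp
qed

end

text \<open>\<open>Y\<close> is an object of \<open>Exc\<close> isomorphic on the skeleton to the subfunctor \<open>X\<close> of \<open>\<Omega>\<close>; \<open>inA\<close> and
  \<open>outA\<close> turn morphisms into and out of \<open>X\<close> on the skeleton into morphisms of \<open>Exc\<close>.\<close>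

locale realization = skeleton B S r e e' I U
  for B :: "('o, 'm) category" and S and r :: "'o \<Rightarrow> 'o" and e e' :: "'o \<Rightarrow> 'm"
    and I :: "'i set" and U :: "'u set set" +
  fixes \<Omega> :: "('o, 'm, 'x monoid, 'x \<Rightarrow> 'x) fctr" and X :: "'o \<Rightarrow> 'x set"
    and Y :: "('o, 'm, 'u monoid, 'u \<Rightarrow> 'u) fctr"
    and inA :: "('o, 'm, 'u monoid, 'u \<Rightarrow> 'u) fctr \<Rightarrow> ('o \<Rightarrow> 'u \<Rightarrow> 'x) \<Rightarrow> 'o \<Rightarrow> 'u \<Rightarrow> 'u"
    and outA :: "('o, 'm, 'u monoid, 'u \<Rightarrow> 'u) fctr \<Rightarrow> ('o \<Rightarrow> 'x \<Rightarrow> 'u) \<Rightarrow> 'o \<Rightarrow> 'u \<Rightarrow> 'u"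
  assumes real_obj: "Y \<in> obj Exc"
    and in_arr: "\<lbrakk>F \<in> obj Exc; phom (car F) F \<Omega> \<zeta>; \<And>s x. s \<in> S \<Longrightarrow> x \<in> car F s \<Longrightarrow> \<zeta> s x \<in> X s\<rbrakk> \<Longrightarrow>
      inA F \<zeta> \<in> arr Exc F Y"
    and out_arr: "\<lbrakk>G \<in> obj Exc; phom X \<Omega> G \<xi>\<rbrakk> \<Longrightarrow> outA G \<xi> \<in> arr Exc Y G"
    and out_in: "\<lbrakk>F \<in> obj Exc; G \<in> obj Exc;
      phom (car F) F \<Omega> \<zeta>; \<And>s x. s \<in> S \<Longrightarrow> x \<in> car F s \<Longrightarrow> \<zeta> s x \<in> X s;
      phom X \<Omega> G \<xi>; \<eta> \<in> arr Exc F G; \<And>s x. s \<in> S \<Longrightarrow> x \<in> car F s \<Longrightarrow> \<xi> s (\<zeta> s x) = \<eta> s x\<rbrakk> \<Longrightarrow>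
      cmp Exc F Y G (outA G \<xi>) (inA F \<zeta>) = \<eta>"
    and in_out: "\<lbrakk>F \<in> obj Exc; phom (car F) F \<Omega> \<zeta>; \<And>s x. s \<in> S \<Longrightarrow> x \<in> car F s \<Longrightarrow> \<zeta> s x \<in> X s;
      phom X \<Omega> F \<xi>; \<And>s x. s \<in> S \<Longrightarrow> x \<in> X s \<Longrightarrow> \<zeta> s (\<xi> s x) = x\<rbrakk> \<Longrightarrow>
      cmp Exc Y F Y (inA F \<zeta>) (outA F \<xi>) = idt Exc Y"
    and in_zero: "\<lbrakk>F \<in> obj Exc; G \<in> obj Exc;
      phom (car G) G \<Omega> \<zeta>; \<And>s x. s \<in> S \<Longrightarrow> x \<in> car G s \<Longrightarrow> \<zeta> s x \<in> X s;
      \<theta> \<in> arr Exc F G; \<And>s x. s \<in> S \<Longrightarrow> x \<in> car F s \<Longrightarrow> \<zeta> s (\<theta> s x) = \<one>\<^bsub>fob \<Omega> s\<^esub>\<rbrakk> \<Longrightarrow>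
      cmp Exc F G Y (inA G \<zeta>) \<theta> = zero_arr Exc F Y"
    and zero_out: "\<lbrakk>F \<in> obj Exc; G \<in> obj Exc; phom X \<Omega> F \<xi>; \<theta> \<in> arr Exc F G;
      \<And>s x. s \<in> S \<Longrightarrow> x \<in> X s \<Longrightarrow> \<theta> s (\<xi> s x) = \<one>\<^bsub>fob G s\<^esub>\<rbrakk> \<Longrightarrow>
      cmp Exc Y F G \<theta> (outA F \<xi>) = zero_arr Exc Y G"

context skeleton
begin

text \<open>\<open>X\<close> may live in any type, while objects of \<open>Exc\<close> have carriers
  in \<open>U\<close>. Smallness provides injections \<open>\<beta>\<close> with images in
  \<open>U\<close>, since \<open>U\<close> is closed under subsets; the structure of
  \<open>X\<close> is moved along them on \<open>S\<close>, and the result is extended to all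
  objects by \<open>pullback_fctr\<close>.\<close>

lemma realize:
  fixes \<Omega> :: "('o, 'm, 'x monoid, 'x \<Rightarrow> 'x) fctr"
  assumes O: "psh \<Omega>" and X: "subfun \<Omega> X" "exfun \<Omega> X"
    and small: "\<And>s. s \<in> S \<Longrightarrow> \<exists>Z\<in>U. X s \<lesssim> Z"
  obtains Y inA outA where "realization B S r e e' I U \<Omega> X Y inA outA"
proof -
  have "\<forall>s\<in>S. \<exists>\<beta>. inj_on \<beta> (X s) \<and> \<beta> ` X s \<in> U"
  proof
    fix s assume "s \<in> S"
    then obtain Z \<beta> where "Z \<in> U" "inj_on \<beta> (X s)" "\<beta> ` X s \<subseteq> Z"
      using small unfolding lepoll_def by blast
    then show "\<exists>\<beta>. inj_on \<beta> (X s) \<and> \<beta> ` X s \<in> U"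
      using universe_sub[OF universe] by blast
  qed
  then obtain \<beta> :: "'o \<Rightarrow> 'x \<Rightarrow> 'u" where \<beta>: "\<And>s. s \<in> S \<Longrightarrow> inj_on (\<beta> s) (X s)" "\<And>s. s \<in> S \<Longrightarrow> \<beta> s ` X s \<in> U"
    by metis
  define T where "T = transport_fctr \<Omega> X \<beta>"
  define \<gamma> where "\<gamma> s = inv_into (X s) (\<beta> s)" for s
  define Y where "Y = extensionalize (pullback_fctr T)"
  have T: "fiso \<Omega> X \<beta> T" unfolding T_def by (rule fiso_transport[OF \<beta>(1)])
  have pT: "psh T" by (rule psh_fiso[OF O X(1) T])
  have carT: "car T s = \<beta> s ` X s" for s by (simp add: T_def transport_fctr_def transport_group_def)
  have eT: "exfun T (car T)"
    using exfun_fiso[OF X(1) T X(2)] by (simp add: carT[abs_def])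
  have YE: "Y \<in> obj Exc"
    unfolding Y_def
    by (rule Exc_extensionalize[OF full_psh_pullback[OF pT] full_exfun_pullback[OF eT]])
      (simp add: pullback_fctr_def carT \<beta>(2) r)
  have carY: "car Y a = \<beta> (r a) ` X (r a)" for a
    by (simp add: Y_def extensionalize_def pullback_fctr_def carT)
  have \<gamma>\<beta>: "\<gamma> s (\<beta> s x) = x" if "s \<in> S" "x \<in> X s" for s x
    using \<beta>(1) that by (simp add: \<gamma>_def)
  have oneY: "\<one>\<^bsub>fob Y a\<^esub> = \<beta> (r a) \<one>\<^bsub>fob \<Omega> (r a)\<^esub>" for a
    by (simp add: Y_def extensionalize_def pullback_fctr_def T_def transport_fctr_def transport_group_def)
  have multY: "\<beta> (r a) x \<otimes>\<^bsub>fob Y a\<^esub> \<beta> (r a) y = \<beta> (r a) (x \<otimes>\<^bsub>fob \<Omega> (r a)\<^esub> y)"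
    if "a \<in> obj B" "x \<in> X (r a)" "y \<in> X (r a)" for a x y
    using \<beta>(1) that r by (simp add: Y_def extensionalize_def pullback_fctr_def T_def transport_fctr_def transport_group_def)
  have mapY: "fmap Y a b f (\<beta> (r a) x) = \<beta> (r b) (fmap \<Omega> (r a) (r b) (conj a b f) x)"
    if "a \<in> obj B" "x \<in> X (r a)" for a b f x
    using \<beta>(1) that r by (simp add: Y_def extensionalize_def pullback_fctr_def T_def transport_fctr_def transport_group_def)
  define inF where "inF F \<zeta> a x = \<beta> (r a) (\<zeta> (r a) (fmap F a (r a) (e a) x))"
    for F :: "('o, 'm, 'u monoid, 'u \<Rightarrow> 'u) fctr" and \<zeta> :: "'o \<Rightarrow> 'u \<Rightarrow> 'x" and a x
  define outF where "outF G \<xi> a y = fmap G (r a) a (e' a) (\<xi> (r a) (\<gamma> (r a) y))"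
    for G :: "('o, 'm, 'u monoid, 'u \<Rightarrow> 'u) fctr" and \<xi> :: "'o \<Rightarrow> 'x \<Rightarrow> 'u" and a y
  define inA where "inA F \<zeta> = restrict_family F (inF F \<zeta>)" for F \<zeta>
  define outA where "outA G \<xi> = restrict_family Y (outF G \<xi>)" for G \<xi>
  have Fe: "fmap F a (r a) (e a) x \<in> car F (r a)" if "F \<in> obj Exc" "a \<in> obj B" "x \<in> car F a" for F a x
    using full.psh_map[OF Exc_psh] that e r SO by blast
  have outF\<beta>: "outF G \<xi> a (\<beta> (r a) x) = fmap G (r a) a (e' a) (\<xi> (r a) x)"
    if "a \<in> obj B" "x \<in> X (r a)" for G \<xi> a x
    using that by (simp add: outF_def \<gamma>\<beta> r)
  have inA: "inA F \<zeta> \<in> arr Exc F Y"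
    if F: "F \<in> obj Exc" and \<zeta>: "phom (car F) F \<Omega> \<zeta>" "\<And>s x. s \<in> S \<Longrightarrow> x \<in> car F s \<Longrightarrow> \<zeta> s x \<in> X s" for F \<zeta>
    unfolding inA_def
  proof (rule Exc_arrI[OF F YE], unfold full.phom_def, intro ballI conjI)
    note pF = Exc_psh[OF F]
    fix a x assume a: "a \<in> obj B" and x: "x \<in> car F a"
    have zx: "\<zeta> (r a) (fmap F a (r a) (e a) x) \<in> X (r a)" if "x \<in> car F a" for x
      using \<zeta>(2)[OF r[OF a]] Fe[OF F a that] by blast
    show "inF F \<zeta> a x \<in> car Y a" using zx[OF x] by (simp add: inF_def carY)
    show "inF F \<zeta> a (x \<otimes>\<^bsub>fob F a\<^esub> y) = inF F \<zeta> a x \<otimes>\<^bsub>fob Y a\<^esub> inF F \<zeta> a y" if y: "y \<in> car F a" for y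
      using full.psh_mult[OF pF a SO[OF r[OF a]] e[OF a] x y] Fe[OF F a] x y zx
        phom_mult[OF \<zeta>(1) r[OF a]] a by (simp add: inF_def multY)
    fix b f assume b: "b \<in> obj B" and f: "f \<in> arr B a b"
    have "fmap F b (r b) (e b) (fmap F a b f x) =
        fmap F (r a) (r b) (conj a b f) (fmap F a (r a) (e a) x)"
      using full.psh_cmp[OF pF a b SO[OF r[OF b]] f e[OF b] x]
        full.psh_cmp[OF pF a SO[OF r[OF a]] SO[OF r[OF b]] e[OF a] conj_arr[OF a b f] x]
        conj_e(1)[OF a b f] by simp
    then show "inF F \<zeta> b (fmap F a b f x) = fmap Y a b f (inF F \<zeta> a x)"
      using phom_nat[OF \<zeta>(1) r[OF a] r[OF b] conj_arr[OF a b f] Fe[OF F a x]] a zx[OF x]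
      by (simp add: inF_def mapY)
  qed
  have outA: "outA G \<xi> \<in> arr Exc Y G" if G: "G \<in> obj Exc" and \<xi>: "phom X \<Omega> G \<xi>" for G \<xi>
    unfolding outA_def
  proof (rule Exc_arrI[OF YE G], unfold full.phom_def, intro ballI conjI)
    note pG = Exc_psh[OF G]
    fix a y assume a: "a \<in> obj B" and "y \<in> car Y a"
    then obtain x where y: "y = \<beta> (r a) x" and x: "x \<in> X (r a)" by (auto simp: carY)
    note ra = r[OF a] SO[OF r[OF a]]
    have xx: "\<xi> (r a) x \<in> car G (r a)" if "x \<in> X (r a)" for x using phom_car[OF \<xi> ra(1) that] .
    show "outF G \<xi> a y \<in> car G a"
      using full.psh_map[OF pG ra(2) a e'[OF a] xx[OF x]] a x by (simp add: y outF\<beta>)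
    show "outF G \<xi> a (y \<otimes>\<^bsub>fob Y a\<^esub> y') = outF G \<xi> a y \<otimes>\<^bsub>fob G a\<^esub> outF G \<xi> a y'"
      if "y' \<in> car Y a" for y'
    proof -
      obtain x' where y': "y' = \<beta> (r a) x'" and x': "x' \<in> X (r a)" using \<open>y' \<in> car Y a\<close> by (auto simp: carY)
      show ?thesis
        using full.psh_mult[OF pG ra(2) a e'[OF a] xx[OF x] xx[OF x']] a x x'
          phom_mult[OF \<xi> ra(1) x x'] subfun_mult[OF X(1) ra(1) x x']
        by (simp add: y y' outF\<beta> multY)
    qed
    fix b f assume b: "b \<in> obj B" and f: "f \<in> arr B a b"
    note rb = r[OF b] SO[OF r[OF b]]
    have "fmap G (r b) b (e' b) (fmap G (r a) (r b) (conj a b f) (\<xi> (r a) x)) =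
        fmap G a b f (fmap G (r a) a (e' a) (\<xi> (r a) x))"
      using full.psh_cmp[OF pG ra(2) rb(2) b conj_arr[OF a b f] e'[OF b] xx[OF x]]
        full.psh_cmp[OF pG ra(2) a b e'[OF a] f xx[OF x]] conj_e(2)[OF a b f] by simp
    then show "outF G \<xi> b (fmap Y a b f y) = fmap G a b f (outF G \<xi> a y)"
      using phom_nat[OF \<xi> ra(1) rb(1) conj_arr[OF a b f] x] subfun_map[OF X(1) ra(1) rb(1) conj_arr[OF a b f] x]
        a b x by (simp add: y mapY outF\<beta>)
  qed
  \<comment> \<open>The detour through \<open>r s\<close> leaves no trace on composites of natural
    maps, although \<open>r s\<close> need not be \<open>s\<close>.\<close>
  have at_S: "fmap G (r s) s (e' s) (\<xi> (r s) (\<zeta> (r s) (fmap F s (r s) (e s) x))) = \<xi> s (\<zeta> s x)"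
    if F: "F \<in> obj Exc" and G: "G \<in> obj Exc"
      and \<zeta>: "phom (car F) F \<Omega> \<zeta>" "\<And>s x. s \<in> S \<Longrightarrow> x \<in> car F s \<Longrightarrow> \<zeta> s x \<in> X s" and \<xi>: "phom X \<Omega> G \<xi>"
      and s: "s \<in> S" and x: "x \<in> car F s" for F G \<zeta> \<xi> s x
    using phom_nat[OF \<zeta>(1) s r[OF SO[OF s]] e[OF SO[OF s]] x]
      phom_nat[OF \<xi> s r[OF SO[OF s]] e[OF SO[OF s]] \<zeta>(2)[OF s x]]
      fmap_e'[OF Exc_psh[OF G] SO[OF s] phom_car[OF \<xi> s \<zeta>(2)[OF s x]]] by simp
  show ?thesis
  proof (rule that[of Y inA outA], unfold_locales, rule YE, fact inA, fact outA)
    fix F G \<zeta> \<xi> \<eta>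
    assume F: "F \<in> obj Exc" and G: "G \<in> obj Exc"
      and \<zeta>: "phom (car F) F \<Omega> \<zeta>" "\<And>s x. s \<in> S \<Longrightarrow> x \<in> car F s \<Longrightarrow> \<zeta> s x \<in> X s" and \<xi>: "phom X \<Omega> G \<xi>"
      and \<eta>: "\<eta> \<in> arr Exc F G" "\<And>s x. s \<in> S \<Longrightarrow> x \<in> car F s \<Longrightarrow> \<xi> s (\<zeta> s x) = \<eta> s x"
    show "cmp Exc F Y G (outA G \<xi>) (inA F \<zeta>) = \<eta>"
    proof (rule Exc_eqI_skeleton[OF F G Exc_cmp_closed[OF F YE G inA[OF F \<zeta>] outA[OF G \<xi>]] \<eta>(1)])
      fix s x assume s: "s \<in> S" and x: "x \<in> car F s"
      have "inA F \<zeta> s x = \<beta> (r s) (\<zeta> (r s) (fmap F s (r s) (e s) x))"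
        using SO[OF s] x by (simp add: inA_def inF_def)
      moreover have "\<zeta> (r s) (fmap F s (r s) (e s) x) \<in> X (r s)"
        using \<zeta>(2)[OF r[OF SO[OF s]] Fe[OF F SO[OF s] x]] .
      ultimately show "cmp Exc F Y G (outA G \<xi>) (inA F \<zeta>) s x = \<eta> s x"
        using at_S[OF F G \<zeta> \<xi> s x] \<eta>(2)[OF s x] SO[OF s] x
        by (simp add: Exc_cmp_app outA_def carY outF\<beta>)
    qed
  next
    fix F \<zeta> \<xi>
    assume F: "F \<in> obj Exc"
      and \<zeta>: "phom (car F) F \<Omega> \<zeta>" "\<And>s x. s \<in> S \<Longrightarrow> x \<in> car F s \<Longrightarrow> \<zeta> s x \<in> X s" and \<xi>: "phom X \<Omega> F \<xi>"
      and id: "\<And>s x. s \<in> S \<Longrightarrow> x \<in> X s \<Longrightarrow> \<zeta> s (\<xi> s x) = x"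
    show "cmp Exc Y F Y (inA F \<zeta>) (outA F \<xi>) = idt Exc Y"
    proof (rule Exc_eqI[OF YE YE Exc_cmp_closed[OF YE F YE outA[OF F \<xi>] inA[OF F \<zeta>]] Exc_idt_closed[OF YE]])
      fix a y assume a: "a \<in> obj B" and ya: "y \<in> car Y a"
      then obtain x where y: "y = \<beta> (r a) x" and x: "x \<in> X (r a)" by (auto simp: carY)
      have xc: "\<xi> (r a) x \<in> car F (r a)" using phom_car[OF \<xi> r[OF a] x] .
      have "outA F \<xi> a y = fmap F (r a) a (e' a) (\<xi> (r a) x)"
        using a ya x by (simp add: outA_def y outF\<beta>)
      moreover have "fmap F (r a) a (e' a) (\<xi> (r a) x) \<in> car F a"
        using full.psh_map[OF Exc_psh[OF F] SO[OF r[OF a]] a e'[OF a] xc] .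
      ultimately have "cmp Exc Y F Y (inA F \<zeta>) (outA F \<xi>) a y = \<beta> (r a) (\<zeta> (r a) (\<xi> (r a) x))"
        using a ya fmap_e[OF Exc_psh[OF F] a xc] by (simp add: Exc_cmp_app inA_def inF_def)
      then show "cmp Exc Y F Y (inA F \<zeta>) (outA F \<xi>) a y = idt Exc Y a y"
        using id[OF r[OF a] x] a ya by (simp add: y Exc_idt_app)
    qed
  next
    fix F G \<zeta> \<theta>
    assume F: "F \<in> obj Exc" and G: "G \<in> obj Exc"
      and \<zeta>: "phom (car G) G \<Omega> \<zeta>" "\<And>s x. s \<in> S \<Longrightarrow> x \<in> car G s \<Longrightarrow> \<zeta> s x \<in> X s"
      and \<theta>: "\<theta> \<in> arr Exc F G" and 0: "\<And>s x. s \<in> S \<Longrightarrow> x \<in> car F s \<Longrightarrow> \<zeta> s (\<theta> s x) = \<one>\<^bsub>fob \<Omega> s\<^esub>"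
    show "cmp Exc F G Y (inA G \<zeta>) \<theta> = zero_arr Exc F Y"
    proof (rule Exc_eqI[OF F YE Exc_cmp_closed[OF F G YE \<theta> inA[OF G \<zeta>]] Exc_zero_closed[OF F YE]])
      fix a x assume a: "a \<in> obj B" and x: "x \<in> car F a"
      have "\<theta> a x \<in> car G a" using full.phom_car[OF Exc_arrD[OF F G \<theta>] a x] .
      moreover have "fmap G a (r a) (e a) (\<theta> a x) = \<theta> (r a) (fmap F a (r a) (e a) x)"
        using full.phom_nat[OF Exc_arrD[OF F G \<theta>] a SO[OF r[OF a]] e[OF a] x] by simp
      ultimately show "cmp Exc F G Y (inA G \<zeta>) \<theta> a x = zero_arr Exc F Y a x"
        using a x 0[OF r[OF a] Fe[OF F a x]]
        by (simp add: Exc_cmp_app inA_def inF_def Exc_zero_app oneY)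
    qed
  next
    fix F G \<xi> \<theta>
    assume F: "F \<in> obj Exc" and G: "G \<in> obj Exc" and \<xi>: "phom X \<Omega> F \<xi>"
      and \<theta>: "\<theta> \<in> arr Exc F G" and 0: "\<And>s x. s \<in> S \<Longrightarrow> x \<in> X s \<Longrightarrow> \<theta> s (\<xi> s x) = \<one>\<^bsub>fob G s\<^esub>"
    show "cmp Exc Y F G \<theta> (outA F \<xi>) = zero_arr Exc Y G"
    proof (rule Exc_eqI[OF YE G Exc_cmp_closed[OF YE F G outA[OF F \<xi>] \<theta>] Exc_zero_closed[OF YE G]])
      fix a y assume a: "a \<in> obj B" and ya: "y \<in> car Y a"
      then obtain x where y: "y = \<beta> (r a) x" and x: "x \<in> X (r a)" by (auto simp: carY)
      have xc: "\<xi> (r a) x \<in> car F (r a)" using phom_car[OF \<xi> r[OF a] x] .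
      have "\<theta> a (fmap F (r a) a (e' a) (\<xi> (r a) x)) = fmap G (r a) a (e' a) (\<theta> (r a) (\<xi> (r a) x))"
        using full.phom_nat[OF Exc_arrD[OF F G \<theta>] SO[OF r[OF a]] a e'[OF a] xc] .
      then show "cmp Exc Y F G \<theta> (outA F \<xi>) a y = zero_arr Exc Y G a y"
        using a ya x 0[OF r[OF a] x] full.psh_one[OF Exc_psh[OF G] SO[OF r[OF a]] a e'[OF a]]
        by (simp add: Exc_cmp_app Exc_zero_app outA_def y outF\<beta>)
    qed
  qed
qed

end

section \<open>Split idempotents and pseudocokernels\<close>

text \<open>One bound for a whole family is extracted from closure under products: if all factors
  are nonempty, each factor embeds into the product by freezing the other coordinates.\<close>

lemma universe_family_bound:
  assumes U: "universe I U" and S: "S \<lesssim> I" and X: "\<And>s. s \<in> S \<Longrightarrow> X s \<in> U"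
  obtains Z where "Z \<in> U" "absorbing I Z" "\<And>s. s \<in> S \<Longrightarrow> X s \<lesssim> Z"
proof -
  obtain h where h: "inj_on h S" "h ` S \<subseteq> I" using S unfolding lepoll_def by blast
  obtain D where D: "D \<in> U" "infinite D" using U unfolding universe_def by (elim conjE bexE) (rule that)
  obtain d where d: "d \<in> D" using D by (metis ex_in_conv finite.emptyI)
  define P where "P i \<longleftrightarrow> i \<in> h ` S \<and> X (inv_into S h i) \<noteq> {}" for i
  \<comment> \<open>Empty members, and indices outside the image of \<open>S\<close>, receive the
    factor \<open>D\<close>, since a single empty factor would make the product empty.\<close>
  define V where "V i = (if P i then X (inv_into S h i) else D)" for i
  have V: "V i \<in> U" "V i \<noteq> {}" for i
    using X inv_into_into[of i h S] D d by (auto simp: V_def P_def)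
  obtain Z1 where Z1: "Z1 \<in> U" "PiE I V \<lesssim> Z1"
    using U V(1) unfolding universe_def by (elim conjE allE[of _ V]) (auto intro: that)
  obtain Z where Z: "Z \<in> U" "Z1 \<lesssim> Z" "absorbing I Z" using universe_absorbing[OF U Z1(1)] by blast
  have "X s \<lesssim> Z" if s: "s \<in> S" for s
  proof (cases "X s = {}")
    case False
    have hs: "h s \<in> I" "V (h s) = X s" using h s False by (auto simp: V_def P_def)
    define q where "q x = (\<lambda>i\<in>I. if i = h s then x else SOME y. y \<in> V i)" for x
    have "inj_on q (X s)"
    proof (rule inj_onI)
      fix x y assume "q x = q y"
      from fun_cong[OF this, of "h s"] hs show "x = y" by (simp add: q_def)
    qed
    moreover have "q ` X s \<subseteq> PiE I V"
      using hs V(2) by (auto simp: q_def some_in_eq)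
    ultimately have "X s \<lesssim> PiE I V" unfolding lepoll_def by blast
    then show ?thesis using lepoll_trans[OF _ lepoll_trans[OF Z1(2) Z(2)]] by blast
  qed simp
  with Z show ?thesis using that by blast
qed

lemma (in site) phom_subset: "phom X F G \<phi> \<Longrightarrow> (\<And>a. a \<in> S \<Longrightarrow> Y a \<subseteq> X a) \<Longrightarrow> phom Y F G \<phi>"
  unfolding phom_def by (meson subsetD)

context skeleton
begin

lemma Exc_S:
  assumes "F \<in> obj Exc"
  shows "psh F" "exfun F (car F)" "subfun F (car F)"
  using full_psh_restrict[OF Exc_psh] full_exfun_restrict[OF Exc_exfun] assms subfun_carrier by blast+

lemma Exc_arr_S:
  assumes "F \<in> obj Exc" "G \<in> obj Exc" "\<eta> \<in> arr Exc F G"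
  shows "phom (car F) F G \<eta>"
  using full_phom_restrict[OF Exc_arrD] assms by blast

text \<open>The splitting object is the image of \<open>\<epsilon>\<close>, which is also its set of
  fixed points. By naturality a preimage found in \<open>F\<close> is turned into one inside the
  image by applying \<open>\<epsilon>\<close> to it.\<close>

lemma Exc_split_idempotents: "has_split_idempotents Exc"
  unfolding has_split_idempotents_def
proof (intro ballI impI)
  fix F \<epsilon> assume F: "F \<in> obj Exc" and \<epsilon>: "\<epsilon> \<in> arr Exc F F" and idem: "cmp Exc F F F \<epsilon> \<epsilon> = \<epsilon>"
  note pF = Exc_S[OF F] and h = Exc_arr_S[OF F F \<epsilon>]
  have ee: "\<epsilon> s (\<epsilon> s x) = \<epsilon> s x" if "s \<in> S" "x \<in> car F s" for s x
    using Exc_cmp_app[OF SO[OF that(1)] that(2), of F F \<epsilon> \<epsilon>] idem by simp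
  have ec: "\<epsilon> s x \<in> car F s" if "s \<in> S" "x \<in> car F s" for s x using phom_car[OF h that] .
  define X where "X s = \<epsilon> s ` car F s" for s
  have Xc: "X s \<subseteq> car F s" if "s \<in> S" for s using ec that by (auto simp: X_def)
  have Xe: "\<epsilon> s x = x" if "s \<in> S" "x \<in> X s" for s x using that ee by (auto simp: X_def)
  have Xm: "\<epsilon> s x \<in> X s" if "x \<in> car F s" for s x using that by (auto simp: X_def)
  have sX: "subfun F X"
    unfolding subfun_def
  proof (intro ballI conjI)
    fix a assume a: "a \<in> S"
    interpret comm_group "fob F a" using psh_grp[OF pF(1) a] .
    show "X a \<subseteq> car F a" using Xc a .
    show "\<one>\<^bsub>fob F a\<^esub> \<in> X a" using Xm[of "\<one>\<^bsub>fob F a\<^esub>" a] phom_one[OF pF(1,1,3) h a] by simp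
    show "x \<otimes>\<^bsub>fob F a\<^esub> y \<in> X a" if xy: "x \<in> X a" "y \<in> X a" for x y
    proof -
      have "x \<in> car F a" "y \<in> car F a" using Xc a xy by blast+
      then show ?thesis
        using Xm[of "x \<otimes>\<^bsub>fob F a\<^esub> y" a] phom_mult[OF h a] Xe[OF a] xy by simp
    qed
    fix b f x assume b: "b \<in> S" and f: "f \<in> arr B a b" and x: "x \<in> X a"
    have xc: "x \<in> car F a" using Xc a x by blast
    show "fmap F a b f x \<in> X b"
      using Xm[OF psh_map[OF pF(1) a b f xc]] phom_nat[OF h a b f xc] Xe[OF a x] by simp
  qed
  have eX: "exfun F X"
  proof (rule exfunI, intro conjI ballI impI)
    fix a b c f g assume q: "(a, b, c, f, g) \<in> exact_seqs B S"
    note * = Q_null[OF q]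
    show "x = \<one>\<^bsub>fob F a\<^esub>" if "x \<in> X a" "fmap F a b f x = \<one>\<^bsub>fob F b\<^esub>" for x
      using exfunD(1)[OF pF(2) q] Xc * that by blast
    show "\<exists>x\<in>X a. fmap F a b f x = y" if y: "y \<in> X b" "fmap F b c g y = \<one>\<^bsub>fob F c\<^esub>" for y
    proof -
      have "y \<in> car F b" using Xc * y by blast
      then obtain x where x: "x \<in> car F a" "fmap F a b f x = y" using exfunD(2)[OF pF(2) q] y by blast
      have "fmap F a b f (\<epsilon> a x) = y"
        using phom_nat[OF h, of a b f x] x Xe[of b y] y * by simp
      then show ?thesis using Xm x by blast
    qed
    show "\<exists>y\<in>X b. fmap F b c g y = z" if z: "z \<in> X c" for z
    proof -
      have "z \<in> car F c" using Xc * z by blast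
      then obtain y where y: "y \<in> car F b" "fmap F b c g y = z" using exfunD(3)[OF pF(2) q] by blast
      have "fmap F b c g (\<epsilon> b y) = z"
        using phom_nat[OF h, of b c g y] y Xe[of c z] z * by simp
      then show ?thesis using Xm y by blast
    qed
  qed
  have small: "\<exists>Z\<in>U. X s \<lesssim> Z" if "s \<in> S" for s
    using Exc_U[OF F SO[OF that]] Xc[OF that] subset_imp_lepoll by blast
  have \<xi>: "phom X F F (\<lambda>_ x. x)" using Xc by (auto simp: phom_def)
  obtain Y inA outA where "realization B S r e e' I U F X Y inA outA"
    by (rule realize[OF pF(1) sX eX small])
  then interpret R: realization B S r e e' I U F X Y inA outA .
  have "inA F \<epsilon> \<in> arr Exc F Y" by (rule R.in_arr[OF F h Xm])
  moreover have "outA F (\<lambda>_ x. x) \<in> arr Exc Y F" by (rule R.out_arr[OF F \<xi>])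
  moreover have "cmp Exc F Y F (outA F (\<lambda>_ x. x)) (inA F \<epsilon>) = \<epsilon>"
    by (rule R.out_in[OF F F h Xm \<xi> \<epsilon>]) simp_all
  moreover have "cmp Exc Y F Y (inA F \<epsilon>) (outA F (\<lambda>_ x. x)) = idt Exc Y"
    by (rule R.in_out[OF F h Xm \<xi>]) (simp_all add: Xe)
  ultimately show "\<exists>Y\<in>obj Exc. \<exists>p\<in>arr Exc F Y. \<exists>i\<in>arr Exc Y F.
      cmp Exc F Y F i p = \<epsilon> \<and> cmp Exc Y F Y p i = idt Exc Y" using R.real_obj by blast
qed

text \<open>All morphisms out of \<open>G\<close> that kill \<open>\<theta>\<close> are combined into one morphism to a product, which may
  be too large for \<open>U\<close>; the exact hull of the image of \<open>G\<close> is small.\<close>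

lemma Exc_pseudocokernels: "has_pseudocokernels Exc"
  unfolding has_pseudocokernels_def
proof (intro ballI)
  fix F G \<theta> assume F: "F \<in> obj Exc" and G: "G \<in> obj Exc" and \<theta>: "\<theta> \<in> arr Exc F G"
  \<comment> \<open>Each competing morphism is its own index, paired with its target, so the
    coordinate \<open>(Y', g)\<close> of the product will supply the factorization of
    \<open>g\<close>.\<close>
  define J where "J = {(Y, g). Y \<in> obj Exc \<and> g \<in> arr Exc G Y \<and> cmp Exc F G Y g \<theta> = zero_arr Exc F Y}"
  define \<Omega> where "\<Omega> = \<lparr>fob = (\<lambda>s. product_group J (\<lambda>j. fob (fst j) s)),
    fmap = (\<lambda>a b f x. \<lambda>j\<in>J. fmap (fst j) a b f (x j))\<rparr>"
  have Jo: "fst j \<in> obj Exc" if "j \<in> J" for j using that by (auto simp: J_def)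
  note Jp = Exc_S[OF Jo]
  have carO: "car \<Omega> s = (\<Pi>\<^sub>E j\<in>J. car (fst j) s)" for s by (simp add: \<Omega>_def)
  have O1: "\<one>\<^bsub>fob \<Omega> s\<^esub> = (\<lambda>j\<in>J. \<one>\<^bsub>fob (fst j) s\<^esub>)" for s by (simp add: \<Omega>_def)
  have Om: "x \<otimes>\<^bsub>fob \<Omega> s\<^esub> y = (\<lambda>j\<in>J. x j \<otimes>\<^bsub>fob (fst j) s\<^esub> y j)" for s x y by (simp add: \<Omega>_def)
  have Of: "fmap \<Omega> a b f x = (\<lambda>j\<in>J. fmap (fst j) a b f (x j))" for a b f x by (simp add: \<Omega>_def)
  have pO: "psh \<Omega>"
    unfolding psh_def
  proof (intro conjI ballI)
    fix a assume a: "a \<in> S"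
    show "comm_group (fob \<Omega> a)"
    proof (rule group.group_comm_groupI)
      show "group (fob \<Omega> a)"
        using psh_grp[OF Jp(1) a] by (simp add: \<Omega>_def comm_group_def)
      fix x y assume "x \<in> car \<Omega> a" "y \<in> car \<Omega> a"
      then have "x j \<in> car (fst j) a" "y j \<in> car (fst j) a" if "j \<in> J" for j
        using that by (auto simp: carO)
      then show "x \<otimes>\<^bsub>fob \<Omega> a\<^esub> y = y \<otimes>\<^bsub>fob \<Omega> a\<^esub> x"
        unfolding Om using comm_monoid.m_comm[OF comm_group.axioms(1)[OF psh_grp[OF Jp(1) a]]]
        by (simp cong: restrict_cong)
    qed
    fix x assume "x \<in> car \<Omega> a"
    then have x: "x \<in> (\<Pi>\<^sub>E j\<in>J. car (fst j) a)" by (simp add: carO)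
    then have xj: "x j \<in> car (fst j) a" if "j \<in> J" for j using that by auto
    show "fmap \<Omega> a a (idt B a) x = x"
      unfolding Of using psh_id[OF Jp(1) a xj] x by (intro extensionalityI[of _ J]) (auto simp: PiE_def)
    fix b f g assume b: "b \<in> S" and f: "f \<in> arr B a b"
    show "fmap \<Omega> a c (cmp B a b c h f) x = fmap \<Omega> b c h (fmap \<Omega> a b f x)"
      if "c \<in> S" "h \<in> arr B b c" for c h
      unfolding Of using psh_cmp[OF Jp(1) a b that(1) f that(2) xj] by (simp cong: restrict_cong)
    assume g: "g \<in> arr B a b"
    show "fmap \<Omega> a b (f \<otimes>\<^bsub>Hom B a b\<^esub> g) x = fmap \<Omega> a b f x \<otimes>\<^bsub>fob \<Omega> b\<^esub> fmap \<Omega> a b g x"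
      unfolding Of Om using psh_add[OF Jp(1) a b f g xj] by (simp cong: restrict_cong)
  next
    fix a b f assume a: "a \<in> S" and b: "b \<in> S" and f: "f \<in> arr B a b"
    show "fmap \<Omega> a b f \<in> hom (fob \<Omega> a) (fob \<Omega> b)"
    proof (rule homI)
      fix x assume x: "x \<in> car \<Omega> a"
      then have xj: "x j \<in> car (fst j) a" if "j \<in> J" for j using that by (auto simp: carO)
      show "fmap \<Omega> a b f x \<in> car \<Omega> b"
        unfolding carO Of using psh_map[OF Jp(1) a b f xj] by simp
      fix y assume y: "y \<in> car \<Omega> a"
      then have yj: "y j \<in> car (fst j) a" if "j \<in> J" for j using that by (auto simp: carO)
      show "fmap \<Omega> a b f (x \<otimes>\<^bsub>fob \<Omega> a\<^esub> y) = fmap \<Omega> a b f x \<otimes>\<^bsub>fob \<Omega> b\<^esub> fmap \<Omega> a b f y"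
        unfolding Of Om using psh_mult[OF Jp(1) a b f xj yj] by (simp cong: restrict_cong)
    qed
  qed
  have eO: "exfun \<Omega> (car \<Omega>)"
  proof (rule exfunI, intro conjI ballI impI)
    fix a b c f g assume q: "(a, b, c, f, g) \<in> exact_seqs B S"
    note ex = exfunD[OF Jp(2) q]
    show "x = \<one>\<^bsub>fob \<Omega> a\<^esub>" if x: "x \<in> car \<Omega> a" "fmap \<Omega> a b f x = \<one>\<^bsub>fob \<Omega> b\<^esub>" for x
      unfolding O1
    proof (rule extensionalityI[of _ J])
      show "x j = (\<lambda>j\<in>J. \<one>\<^bsub>fob (fst j) a\<^esub>) j" if j: "j \<in> J" for j
        using ex(1)[OF j, of "x j"] fun_cong[OF x(2), of j] x(1) j by (auto simp: Of O1 carO)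
    qed (use x in \<open>auto simp: carO PiE_def\<close>)
    show "\<exists>x\<in>car \<Omega> a. fmap \<Omega> a b f x = y" if y: "y \<in> car \<Omega> b" "fmap \<Omega> b c g y = \<one>\<^bsub>fob \<Omega> c\<^esub>" for y
    proof -
      have "\<exists>x\<in>car (fst j) a. fmap (fst j) a b f x = y j" if j: "j \<in> J" for j
        using ex(2)[OF j, of "y j"] fun_cong[OF y(2), of j] y(1) j by (auto simp: Of O1 carO)
      then obtain x where x: "\<And>j. j \<in> J \<Longrightarrow> x j \<in> car (fst j) a \<and> fmap (fst j) a b f (x j) = y j" by metis
      have "fmap \<Omega> a b f (restrict x J) = y"
        unfolding Of using x y(1) by (intro extensionalityI[of _ J]) (auto simp: carO PiE_def)
      then show ?thesis using x by (intro bexI[of _ "restrict x J"]) (auto simp: carO)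
    qed
    show "\<exists>y\<in>car \<Omega> b. fmap \<Omega> b c g y = z" if z: "z \<in> car \<Omega> c" for z
    proof -
      have "\<exists>y\<in>car (fst j) b. fmap (fst j) b c g y = z j" if j: "j \<in> J" for j
        using ex(3)[OF j, of "z j"] z j by (auto simp: carO)
      then obtain y where y: "\<And>j. j \<in> J \<Longrightarrow> y j \<in> car (fst j) b \<and> fmap (fst j) b c g (y j) = z j" by metis
      have "fmap \<Omega> b c g (restrict y J) = z"
        unfolding Of using y z by (intro extensionalityI[of _ J]) (auto simp: carO PiE_def)
      then show ?thesis using y by (intro bexI[of _ "restrict y J"]) (auto simp: carO)
    qed
  qed
  define \<zeta> where "\<zeta> s x = (\<lambda>j\<in>J. snd j s x)" for s and x :: 'u
  have Jh: "phom (car G) G (fst j) (snd j)" if "j \<in> J" for j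
    using Exc_arr_S[OF G Jo[OF that]] that by (auto simp: J_def)
  have \<zeta>: "phom (car G) G \<Omega> \<zeta>"
    unfolding phom_def
  proof (intro ballI conjI)
    fix a x assume a: "a \<in> S" and x: "x \<in> car G a"
    show "\<zeta> a x \<in> car \<Omega> a" using phom_car[OF Jh a x] by (simp add: carO \<zeta>_def)
    show "\<zeta> a (x \<otimes>\<^bsub>fob G a\<^esub> y) = \<zeta> a x \<otimes>\<^bsub>fob \<Omega> a\<^esub> \<zeta> a y" if "y \<in> car G a" for y
      using phom_mult[OF Jh a x that] by (simp add: Om \<zeta>_def cong: restrict_cong)
    show "\<zeta> b (fmap G a b f x) = fmap \<Omega> a b f (\<zeta> a x)" if "b \<in> S" "f \<in> arr B a b" for b f
      using phom_nat[OF Jh a that x] by (simp add: Of \<zeta>_def cong: restrict_cong)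
  qed
  obtain Z where Z: "Z \<in> U" "absorbing I Z" and GZ: "\<And>s. s \<in> S \<Longrightarrow> car G s \<lesssim> Z"
    using universe_family_bound[OF universe S_small, of "car G"] Exc_U[OF G SO] by blast
  have sZ: "small_site Z" using small_site_mono[OF small_site_I absorbing_self_lepoll[OF Z(2)]] .
  \<comment> \<open>The image of \<open>G\<close> is no larger than \<open>G\<close>, whatever the
    size of \<open>J\<close>; this is what makes the hull small.\<close>
  define gens where "gens = (\<lambda>(s, x). (s, \<zeta> s x)) ` Sigma S (car G)"
  have "Sigma S (car G) \<lesssim> Z"
    using sZ GZ by (intro lepoll_Sigma) (auto simp: small_site_def)
  then have gZ: "gens \<lesssim> Z" unfolding gens_def by (rule lepoll_image)
  have gc: "gens \<subseteq> Sigma S (car \<Omega>)" using phom_car[OF \<zeta>] by (auto simp: gens_def)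
  obtain H where H: "\<And>a x. (a, x) \<in> gens \<Longrightarrow> x \<in> H a" "subfun \<Omega> H" "exfun \<Omega> H" "Sigma S H \<lesssim> Z"
    by (rule exfun_hull[OF pO eO subfun_carrier[OF pO] eO sZ gc gZ]) (rule that)
  have small: "\<exists>Z\<in>U. H s \<lesssim> Z" if "s \<in> S" for s
  proof -
    have "H s \<subseteq> snd ` Sigma S H" using that by force
    then show ?thesis
      using lepoll_subset[OF lepoll_image[OF H(4), of snd]] Z(1) by blast
  qed
  have \<zeta>H: "\<zeta> s x \<in> H s" if "s \<in> S" "x \<in> car G s" for s x
    using H(1)[of s "\<zeta> s x"] that by (force simp: gens_def)
  have \<theta>c: "\<theta> s x \<in> car G s" if "s \<in> S" "x \<in> car F s" for s x
    using phom_car[OF Exc_arr_S[OF F G \<theta>] that] .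
  have \<zeta>\<theta>: "\<zeta> s (\<theta> s x) = \<one>\<^bsub>fob \<Omega> s\<^esub>" if s: "s \<in> S" and x: "x \<in> car F s" for s x
    unfolding \<zeta>_def O1
  proof (rule restrict_ext)
    fix j assume j: "j \<in> J"
    then have "cmp Exc F G (fst j) (snd j) \<theta> s x = zero_arr Exc F (fst j) s x" by (auto simp: J_def)
    then show "snd j s (\<theta> s x) = \<one>\<^bsub>fob (fst j) s\<^esub>"
      using SO[OF s] x by (simp add: Exc_cmp_app Exc_zero_app)
  qed
  define pr where "pr j s x = x j"
    for j and s :: 'o and x :: "('o, 'm, 'u monoid, 'u \<Rightarrow> 'u) fctr \<times> ('o \<Rightarrow> 'u \<Rightarrow> 'u) \<Rightarrow> 'u"
  have \<xi>: "phom H \<Omega> (fst j) (pr j)" if j: "j \<in> J" for j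
    using subfun_car[OF H(2)] j unfolding phom_def by (auto simp: Om Of carO pr_def)
  obtain Y inA outA where "realization B S r e e' I U \<Omega> H Y inA outA"
    by (rule realize[OF pO H(2,3) small])
  then interpret R: realization B S r e e' I U \<Omega> H Y inA outA .
  have "pseudocokernel_of Exc F G \<theta> Y (inA G \<zeta>)"
    unfolding pseudocokernel_of_def pseudokernel_of_def opposite_simps
  proof (intro conjI ballI impI R.real_obj R.in_arr[OF G \<zeta> \<zeta>H] R.in_zero[OF F G \<zeta> \<zeta>H \<theta> \<zeta>\<theta>])
    fix Y' g assume "Y' \<in> obj Exc" "g \<in> arr Exc G Y'" "cmp Exc F G Y' g \<theta> = zero_arr Exc F Y'"
    then have j: "(Y', g) \<in> J" by (simp add: J_def)
    have "cmp Exc G Y Y' (outA Y' (pr (Y', g))) (inA G \<zeta>) = g"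
      by (rule R.out_in[OF G Jo[OF j, unfolded fst_conv] \<zeta> \<zeta>H \<xi>[OF j, unfolded fst_conv]])
        (use j in \<open>auto simp: J_def \<zeta>_def pr_def\<close>)
    then show "\<exists>u. u \<in> arr Exc Y Y' \<and> cmp Exc G Y Y' u (inA G \<zeta>) = g"
      using R.out_arr[OF Jo[OF j] \<xi>[OF j]] by auto
  qed
  then show "\<exists>Y k. pseudocokernel_of Exc F G \<theta> Y k" by blast
qed

end

section \<open>Unitary characters\<close>

text \<open>Homomorphisms into the circle. The circle is divisible, so they extend, and it has
  nontrivial roots of unity of every order above 1, so they separate points from subgroups.\<close>

definition character :: "('a, 'b) monoid_scheme \<Rightarrow> 'a set \<Rightarrow> ('a \<Rightarrow> complex) \<Rightarrow> bool" where
  "character G H \<chi> \<longleftrightarrow> (\<forall>x\<in>H. cmod (\<chi> x) = 1 \<and> (\<forall>y\<in>H. \<chi> (x \<otimes>\<^bsub>G\<^esub> y) = \<chi> x * \<chi> y))"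

text \<open>Divisibility of the circle with the extra demand w \<noteq> 1. If the root with the
  argument of z divided by n happens to be 1, then z = 1, and the primitive root cis (2 pi / n) is
  taken instead.\<close>

lemma nontrivial_unit_root:
  assumes n: "n \<ge> 2" and z: "cmod z = 1"
  shows "\<exists>w. cmod w = 1 \<and> w \<noteq> 1 \<and> w ^ n = z"
proof -
  have nz: "z \<noteq> 0" using z by auto
  define w where "w = cis (Arg z / n)"
  have w: "w ^ n = z" "cmod w = 1"
    using n nz z by (simp_all add: w_def Complex.DeMoivre cis_Arg sgn_div_norm)
  show ?thesis
  proof (cases "w = 1")
    case True
    define u where "u = cis (2 * pi / n)"
    have "u ^ n = 1" using n by (simp add: u_def Complex.DeMoivre cis_2pi)
    moreover have "u \<noteq> 1"
    proof
      assume "u = 1"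
      then have c: "cos (2 * pi / n) = 1" by (simp add: u_def complex_eq_iff)
      have "2 * pi / n \<le> pi" "0 < 2 * pi / n" using n by (simp_all add: field_simps)
      then have "cos (2 * pi / n) < cos 0" by (intro cos_monotone_0_pi) auto
      with c show False by simp
    qed
    ultimately show ?thesis using True w by (intro exI[of _ u]) (simp add: u_def)
  qed (use w in blast)
qed

context comm_group
begin

lemma character_one:
  assumes "subgroup H G" "character G H \<chi>"
  shows "\<chi> \<one> = 1"
proof -
  have o: "\<one> \<in> H" using assms(1) by (rule subgroup.one_closed)
  then have "\<chi> \<one> * \<chi> \<one> = \<chi> \<one>" "cmod (\<chi> \<one>) = 1" using assms(2) unfolding character_def by fastforce+
  then show ?thesis by (metis mult_cancel_left2 norm_zero zero_neq_one)
qed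

lemma character_inv:
  assumes "subgroup H G" "character G H \<chi>" "x \<in> H"
  shows "\<chi> (inv x) = inverse (\<chi> x)"
proof -
  have i: "inv x \<in> H" using assms by (blast intro: subgroup.m_inv_closed)
  have x: "x \<in> carrier G" using assms(1,3) subgroup.mem_carrier by fast
  have "\<chi> (inv x) * \<chi> x = 1"
    using assms(2,3) i x character_one[OF assms(1,2)] unfolding character_def
    by (metis l_inv)
  then show ?thesis by (metis inverse_unique mult.commute)
qed

lemma character_int_pow:
  assumes H: "subgroup H G" and \<chi>: "character G H \<chi>" and x: "x \<in> H"
  shows "\<chi> (x [^] (k::int)) = \<chi> x powi k"
proof -
  have p: "x [^] (n::nat) \<in> H \<and> \<chi> (x [^] n) = \<chi> x ^ n" for n
  proof (induction n)
    case 0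
    then show ?case using character_one[OF H \<chi>] subgroup.one_closed[OF H] by simp
  next
    case (Suc n)
    then show ?case
      using x \<chi> subgroup.m_closed[OF H] by (simp add: character_def)
  qed
  show ?thesis
  proof (cases k rule: int_cases2)
    case (nonneg n)
    then show ?thesis using p[of n] by (simp only: int_pow_int power_int_of_nat)
  next
    case (nonpos n)
    have "x \<in> carrier G" using subgroup.mem_carrier[OF H x] .
    then show ?thesis
      unfolding nonpos using p[of n] character_inv[OF H \<chi>, of "x [^] n"]
      by (simp only: int_pow_neg_int power_int_minus power_int_of_nat)
  qed
qed

text \<open>The value w at \<open>g\<close> only has to be compatible with the powers of
  \<open>g\<close> that lie in \<open>H\<close>. If n is the least positive exponent with g^n in
  \<open>H\<close>, the constraint is w^n = \<chi>(g^n); since \<open>g\<close> is not in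
  \<open>H\<close>, n \<ge> 2, and this leaves room for w \<noteq> 1.\<close>

lemma character_extend_one:
  assumes H: "subgroup H G" and \<chi>: "character G H \<chi>" and g: "g \<in> carrier G" "g \<notin> H"
  obtains K \<psi> where "subgroup K G" "H \<subseteq> K" "g \<in> K" "character G K \<psi>" "\<And>x. x \<in> H \<Longrightarrow> \<psi> x = \<chi> x" "\<psi> g \<noteq> 1"
proof -
  have Hc: "x \<in> carrier G" if "x \<in> H" for x using subgroup.mem_carrier[OF H that] .
  note pow = int_pow_closed[OF g(1)] int_pow_mult[OF g(1), symmetric] int_pow_neg[OF g(1), symmetric]
  have "\<exists>w. cmod w = 1 \<and> w \<noteq> 1 \<and> (\<forall>k::int. g [^] k \<in> H \<longrightarrow> \<chi> (g [^] k) = w powi k)"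
  proof (cases "\<exists>k::int. k \<noteq> 0 \<and> g [^] k \<in> H")
    case False
    then have "\<chi> (g [^] k) = (- 1) powi k" if "g [^] k \<in> H" for k :: int
    proof -
      have "k = 0" using False that by blast
      then show ?thesis using character_one[OF H \<chi>] by simp
    qed
    \<comment> \<open>Only the exponent 0 gives an element of \<open>H\<close>, so w is
      unconstrained and -1 is just a convenient unit other than 1.\<close>
    then show ?thesis by (intro exI[of _ "-1"]) auto
  next
    case True
    then obtain k :: int where k: "k \<noteq> 0" "g [^] k \<in> H" by blast
    have "g [^] (- k) \<in> H" using k subgroup.m_inv_closed[OF H] int_pow_neg[OF g(1)] by metis
    with k have "g [^] \<bar>k\<bar> \<in> H" "\<bar>k\<bar> > 0" by (auto simp: abs_if)
    then have ex: "nat \<bar>k\<bar> > 0 \<and> g [^] int (nat \<bar>k\<bar>) \<in> H" by simp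
    define n where "n = (LEAST n. n > 0 \<and> g [^] int n \<in> H)"
    have n: "n > 0" "g [^] int n \<in> H" using LeastI[of "\<lambda>n. n > 0 \<and> g [^] int n \<in> H", OF ex] by (simp_all add: n_def)
    have least: "m = 0" if "m < n" "g [^] int m \<in> H" for m
      using not_less_Least[of m "\<lambda>n. n > 0 \<and> g [^] int n \<in> H"] that by (auto simp: n_def)
    have "n \<noteq> 1" using n(2) g by (auto simp: int_pow_int)
    with n have "n \<ge> 2" by simp
    then obtain w where w: "cmod w = 1" "w \<noteq> 1" "w ^ n = \<chi> (g [^] int n)"
      using nontrivial_unit_root[of n "\<chi> (g [^] int n)"] n(2) \<chi> by (auto simp: character_def)
    \<comment> \<open>Division with remainder by n: the power of \<open>g\<close> with the remainder
      as exponent lies in \<open>H\<close>, so the remainder is 0 by minimality of n.\<close>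
    have "\<chi> (g [^] j) = w powi j" if j: "g [^] j \<in> H" for j :: int
    proof -
      let ?q = "j div int n"
      have q: "(g [^] int n) [^] ?q \<in> H"
        using n(2) by (rule subgroup_int_pow_closed[OF H])
      have jq: "j = int n * ?q + j mod int n" by simp
      have e: "g [^] j = (g [^] int n) [^] ?q \<otimes> g [^] (j mod int n)"
        using int_pow_mult[OF g(1), of "int n * ?q" "j mod int n"] int_pow_pow[OF g(1)] jq by simp
      then have "g [^] (j mod int n) = inv ((g [^] int n) [^] ?q) \<otimes> g [^] j"
        unfolding e using Hc[OF q] g(1) by (simp add: m_assoc[symmetric])
      then have "g [^] (j mod int n) \<in> H"
        using subgroup.m_closed[OF H subgroup.m_inv_closed[OF H q] j] by simp
      then have "nat (j mod int n) = 0"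
        using n(1) by (intro least) (simp_all add: nat_less_iff)
      then have 0: "j mod int n = 0" using n(1) by (simp add: order_antisym)
      then have "g [^] j = (g [^] int n) [^] ?q" using e q Hc by simp
      then have "\<chi> (g [^] j) = (w ^ n) powi ?q" using character_int_pow[OF H \<chi> n(2)] w(3) by simp
      also have "\<dots> = w powi j"
        using jq 0 by (metis add.right_neutral power_int_mult power_int_of_nat)
      finally show ?thesis .
    qed
    then show ?thesis using w by blast
  qed
  then obtain w where w: "cmod w = 1" "w \<noteq> 1" and W: "\<And>k::int. g [^] k \<in> H \<Longrightarrow> \<chi> (g [^] k) = w powi k" by blast
  have w0: "w \<noteq> 0" using w by auto
  define K where "K = {h \<otimes> g [^] (k::int) |h k. h \<in> H}"
  have wd: "\<chi> h * w powi k = \<chi> h' * w powi k'"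
    if hk: "h \<in> H" "h' \<in> H" "h \<otimes> g [^] k = h' \<otimes> g [^] k'" for h h' and k k' :: int
  proof -
    have i: "inv h' \<in> H" using hk H by (blast intro: subgroup.m_inv_closed)
    have "g [^] (k' - k) = g [^] k' \<otimes> inv (g [^] k)"
      using int_pow_diff[OF g(1)] by simp
    also have "\<dots> = inv h' \<otimes> h"
    proof -
      have "h' \<otimes> (g [^] k' \<otimes> inv (g [^] k)) = h"
        using hk g Hc by (simp add: m_assoc[symmetric] flip: hk(3)) (simp add: m_assoc)
      then show ?thesis using hk g Hc by (metis inv_solve_left' int_pow_closed inv_closed m_closed)
    qed
    finally have e: "g [^] (k' - k) = inv h' \<otimes> h" .
    then have "\<chi> (inv h' \<otimes> h) = w powi (k' - k)"
      using W[of "k' - k"] subgroup.m_closed[OF H i hk(1)] by simp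
    then have "inverse (\<chi> h') * \<chi> h = w powi k' / w powi k"
      using \<chi> i hk character_inv[OF H \<chi> hk(2)] w0 by (simp add: character_def power_int_diff)
    moreover have "\<chi> h' \<noteq> 0" using \<chi> hk(2) by (auto simp: character_def)
    ultimately show ?thesis using w0 by (simp add: field_simps)
  qed
  define \<psi> where "\<psi> y = (SOME z. \<exists>h k. h \<in> H \<and> y = h \<otimes> g [^] (k::int) \<and> z = \<chi> h * w powi k)" for y
  have \<psi>: "\<psi> (h \<otimes> g [^] k) = \<chi> h * w powi k" if "h \<in> H" for h and k :: int
    unfolding \<psi>_def
  proof (rule some_equality)
    show "\<exists>h' k'. h' \<in> H \<and> h \<otimes> g [^] k = h' \<otimes> g [^] (k'::int) \<and> \<chi> h * w powi k = \<chi> h' * w powi k'"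
      using that by blast
    show "z = \<chi> h * w powi k"
      if "\<exists>h' k'. h' \<in> H \<and> h \<otimes> g [^] k = h' \<otimes> g [^] (k'::int) \<and> z = \<chi> h' * w powi k'" for z
      using wd[OF \<open>h \<in> H\<close>] that by fastforce
  qed
  have sK: "subgroup K G"
  proof (rule subgroupI)
    show "K \<subseteq> carrier G" using Hc g by (auto simp: K_def)
    show "K \<noteq> {}" using subgroup.one_closed[OF H] by (auto simp: K_def)
    fix x assume "x \<in> K"
    then obtain h k where x: "x = h \<otimes> g [^] (k::int)" "h \<in> H" by (auto simp: K_def)
    then have "inv x = inv h \<otimes> g [^] (- k)"
      using Hc g by (simp add: inv_mult int_pow_neg)
    then show "inv x \<in> K" using subgroup.m_inv_closed[OF H x(2)] by (auto simp: K_def)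
    fix y assume "y \<in> K"
    then obtain h' k' where y: "y = h' \<otimes> g [^] (k'::int)" "h' \<in> H" by (auto simp: K_def)
    have "x \<otimes> y = (h \<otimes> h') \<otimes> g [^] (k + k')"
      unfolding x y int_pow_mult[OF g(1)]
      using Hc[OF x(2)] Hc[OF y(2)] int_pow_closed[OF g(1)] by (simp add: m_ac)
    then show "x \<otimes> y \<in> K" using subgroup.m_closed[OF H x(2) y(2)] by (auto simp: K_def)
  qed
  have cK: "character G K \<psi>"
    unfolding character_def
  proof (intro ballI conjI)
    fix x assume "x \<in> K"
    then obtain h k where x: "x = h \<otimes> g [^] (k::int)" "h \<in> H" by (auto simp: K_def)
    show "cmod (\<psi> x) = 1"
      using x \<psi>[OF x(2)] \<chi> w by (simp add: character_def norm_mult norm_power_int)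
    fix y assume "y \<in> K"
    then obtain h' k' where y: "y = h' \<otimes> g [^] (k'::int)" "h' \<in> H" by (auto simp: K_def)
    have "x \<otimes> y = (h \<otimes> h') \<otimes> g [^] (k + k')"
      unfolding x y int_pow_mult[OF g(1)]
      using Hc[OF x(2)] Hc[OF y(2)] int_pow_closed[OF g(1)] by (simp add: m_ac)
    then have "\<psi> (x \<otimes> y) = \<chi> (h \<otimes> h') * w powi (k + k')"
      using \<psi>[OF subgroup.m_closed[OF H x(2) y(2)]] by simp
    then show "\<psi> (x \<otimes> y) = \<psi> x * \<psi> y"
      using \<psi>[OF x(2)] \<psi>[OF y(2)] x y \<chi> w0 by (simp add: character_def power_int_add)
  qed
  have HK: "x \<in> K \<and> \<psi> x = \<chi> x" if "x \<in> H" for x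
  proof -
    have x: "x = x \<otimes> g [^] (0::int)" using Hc that by simp
    then have "x \<in> K" using that unfolding K_def by blast
    moreover have "\<psi> x = \<chi> x" using \<psi>[OF that, of 0] Hc[OF that] by simp
    ultimately show ?thesis by blast
  qed
  have "g = \<one> \<otimes> g [^] (1::int)" using g by simp
  then have "g \<in> K" "\<psi> g = w"
    using \<psi>[OF subgroup.one_closed[OF H], of 1] subgroup.one_closed[OF H] character_one[OF H \<chi>]
    unfolding K_def by auto
  with sK cK HK w(2) show ?thesis using that[of K \<psi>] by blast
qed

text \<open>Inclusion of graphs encodes both a larger domain and agreement on the smaller one, so
  Zorn's lemma applies to graphs of partial characters. A maximal graph has full domain by the
  extension to one more element.\<close>

lemma character_extend:
  assumes H: "subgroup H G" and \<chi>: "character G H \<chi>"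
  obtains \<psi> where "character G (carrier G) \<psi>" "\<And>x. x \<in> H \<Longrightarrow> \<psi> x = \<chi> x"
proof -
  define graph where "graph K \<psi> = (\<lambda>x. (x, \<psi> x)) ` K" for K and \<psi> :: "'a \<Rightarrow> complex"
  define \<A> where "\<A> = {graph K \<psi> |K \<psi>. subgroup K G \<and> character G K \<psi> \<and> graph H \<chi> \<subseteq> graph K \<psi>}"
  have ne: "\<A> \<noteq> {}" using assms unfolding \<A>_def by blast
  have "\<Union>C \<in> \<A>" if C: "C \<noteq> {}" "subset.chain \<A> C" for C
  proof -
    define R where "R = \<Union>C"
    have CA: "\<Gamma> \<in> \<A>" if "\<Gamma> \<in> C" for \<Gamma> using C(2) that by (auto simp: subset.chain_def)
    have two: "\<exists>K \<psi>. graph K \<psi> \<in> C \<and> subgroup K G \<and> character G K \<psi> \<and> p \<in> graph K \<psi> \<and> q \<in> graph K \<psi>"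
      if pq: "p \<in> R" "q \<in> R" for p q
    proof -
      obtain \<Gamma> \<Delta> where "\<Gamma> \<in> C" "p \<in> \<Gamma>" "\<Delta> \<in> C" "q \<in> \<Delta>" using pq unfolding R_def by blast
      then have "\<exists>\<Gamma>\<in>C. p \<in> \<Gamma> \<and> q \<in> \<Gamma>" using C(2) unfolding subset.chain_def by blast
      then show ?thesis using CA unfolding \<A>_def by blast
    qed
    have fn: "z = z'" if "(x, z) \<in> R" "(x, z') \<in> R" for x z z'
      using two[OF that] by (auto simp: graph_def)
    define K where "K = fst ` R"
    define \<psi> where "\<psi> x = (SOME z. (x, z) \<in> R)" for x
    have \<psi>R: "\<psi> x = z" if "(x, z) \<in> R" for x z
      using someI[of "\<lambda>z. (x, z) \<in> R", OF that] fn that unfolding \<psi>_def by blast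
    have Rg: "R = graph K \<psi>"
      using \<psi>R by (force simp: graph_def K_def image_iff)
    have grp: "x \<in> carrier G \<and> x \<otimes> y \<in> K \<and> inv x \<in> K \<and> cmod (\<psi> x) = 1 \<and> \<psi> (x \<otimes> y) = \<psi> x * \<psi> y"
      if "x \<in> K" "y \<in> K" for x y
    proof -
      have "(x, \<psi> x) \<in> R" "(y, \<psi> y) \<in> R" using that Rg by (auto simp: graph_def)
      from two[OF this] obtain L \<phi> where L: "graph L \<phi> \<in> C" "subgroup L G" "character G L \<phi>"
        and xy: "x \<in> L" "y \<in> L" "\<psi> x = \<phi> x" "\<psi> y = \<phi> y" by (auto simp: graph_def)
      have LR: "(u, \<phi> u) \<in> R" if "u \<in> L" for u using L(1) that by (auto simp: R_def graph_def)
      have m: "x \<otimes> y \<in> L" "inv x \<in> L" 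
        using subgroup.m_closed[OF L(2) xy(1,2)] subgroup.m_inv_closed[OF L(2) xy(1)] .
      show ?thesis
      proof (intro conjI)
        show "x \<in> carrier G" using subgroup.mem_carrier[OF L(2) xy(1)] .
        show "x \<otimes> y \<in> K" "inv x \<in> K" using m[THEN LR] unfolding K_def by force+
        show "cmod (\<psi> x) = 1" using L(3) xy by (simp add: character_def)
        show "\<psi> (x \<otimes> y) = \<psi> x * \<psi> y"
          using L(3) xy(1,2) unfolding \<psi>R[OF LR[OF m(1)]] xy(3,4) character_def by blast
      qed
    qed
    obtain \<Gamma> where \<Gamma>: "\<Gamma> \<in> C" using C(1) by blast
    then have HR: "graph H \<chi> \<subseteq> R" using CA[OF \<Gamma>] unfolding \<A>_def R_def by blast
    have "\<one> \<in> K" using HR subgroup.one_closed[OF H] by (force simp: K_def graph_def)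
    then have "subgroup K G" using grp by (intro subgroupI) auto
    moreover have "character G K \<psi>" unfolding character_def using grp by blast
    ultimately have "R \<in> \<A>" using HR Rg unfolding \<A>_def by blast
    then show ?thesis by (simp add: R_def)
  qed
  from subset_Zorn_nonempty[OF ne this] obtain \<Gamma> where \<Gamma>: "\<Gamma> \<in> \<A>" "\<And>\<Delta>. \<Delta> \<in> \<A> \<Longrightarrow> \<Gamma> \<subseteq> \<Delta> \<Longrightarrow> \<Delta> = \<Gamma>" by blast
  then obtain K \<psi> where K: "\<Gamma> = graph K \<psi>" "subgroup K G" "character G K \<psi>" "graph H \<chi> \<subseteq> graph K \<psi>"
    unfolding \<A>_def by blast
  have "g \<in> K" if g: "g \<in> carrier G" for g
  proof (rule ccontr)
    assume "g \<notin> K"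
    from character_extend_one[OF K(2,3) g this] obtain K' \<psi>' where
      K': "subgroup K' G" "K \<subseteq> K'" "g \<in> K'" "character G K' \<psi>'" "\<And>x. x \<in> K \<Longrightarrow> \<psi>' x = \<psi> x" by metis
    have "graph K \<psi> \<subseteq> graph K' \<psi>'" using K' by (auto simp: graph_def)
    then have "graph K' \<psi>' = \<Gamma>" using \<Gamma>(2)[of "graph K' \<psi>'"] K K' unfolding \<A>_def by blast
    then show False using K'(3) \<open>g \<notin> K\<close> K(1) by (auto simp: graph_def)
  qed
  moreover have "K \<subseteq> carrier G" using K(2) by (rule subgroup.subset)
  ultimately have "K = carrier G" by blast
  moreover have "\<psi> x = \<chi> x" if "x \<in> H" for x using K(4) that by (auto simp: graph_def)
  ultimately show ?thesis using that K(3) by blast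
qed

text \<open>The trivial character of \<open>H\<close> is extended across \<open>g\<close> with a
  value other than 1, and from there to the whole group.\<close>

lemma character_separates:
  assumes H: "subgroup H G" and g: "g \<in> carrier G" "g \<notin> H"
  obtains \<psi> where "character G (carrier G) \<psi>" "\<And>x. x \<in> H \<Longrightarrow> \<psi> x = 1" "\<psi> g \<noteq> 1"
proof -
  have "character G H (\<lambda>_. 1)" by (simp add: character_def)
  from character_extend_one[OF H this g] obtain K \<chi> where K: "subgroup K G" "H \<subseteq> K" "g \<in> K"
    "character G K \<chi>" "\<And>x. x \<in> H \<Longrightarrow> \<chi> x = 1" "\<chi> g \<noteq> 1" by metis
  from character_extend[OF K(1,4)] obtain \<psi> where "character G (carrier G) \<psi>" "\<And>x. x \<in> K \<Longrightarrow> \<psi> x = \<chi> x" by blast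
  moreover have "\<psi> x = 1" if "x \<in> H" for x using calculation(2)[of x] K(2,5) that by auto
  moreover have "\<psi> g \<noteq> 1" using calculation(2)[OF K(3)] K(6) by simp
  ultimately show ?thesis using that by blast
qed

end

section \<open>A saturated exact functor over a given functor\<close>

context site
begin

text \<open>A value \<open>v (t, c, k)\<close> is to be thought of as \<open>\<chi> (k x)\<close> for a character \<open>\<chi>\<close> of the value at \<open>c\<close>
  of some functor, where \<open>\<chi>\<close> depends on \<open>t\<close> and \<open>c\<close>.\<close>

definition coords :: "'o \<Rightarrow> ('t \<times> 'o \<times> 'm \<Rightarrow> complex) set" where
  "coords a = {v. (\<forall>j. cmod (v j) = 1) \<and> (\<forall>t c k. \<not> (c \<in> S \<and> k \<in> arr B a c) \<longrightarrow> v (t, c, k) = 1) \<and>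
     (\<forall>t. \<forall>c\<in>S. \<forall>k\<in>arr B a c. \<forall>k'\<in>arr B a c. v (t, c, k \<otimes>\<^bsub>Hom B a c\<^esub> k') = v (t, c, k) * v (t, c, k'))}"

text \<open>Forced by reading v (t, c, k) as \<chi> (k x): the coordinate of f x at k is the
  coordinate of x at the composite of k with f.\<close>

definition twist :: "'o \<Rightarrow> 'o \<Rightarrow> 'm \<Rightarrow> ('t \<times> 'o \<times> 'm \<Rightarrow> complex) \<Rightarrow> 't \<times> 'o \<times> 'm \<Rightarrow> complex" where
  "twist a b f v = (\<lambda>(t, c, k). if c \<in> S \<and> k \<in> arr B b c then v (t, c, cmp B a b c k f) else 1)"

text \<open>The product of \<open>P\<close> with cofree functors, one for each \<open>t\<close> and
  each c in \<open>S\<close>, namely a \<mapsto> Hom (B (a, c), circle). A morphism from F to such a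
  factor amounts to a character of F c, so extending morphisms reduces to extending characters. The
  component in \<open>P\<close> remembers where an element lies over \<open>P\<close>.\<close>

definition ambient :: "('o, 'm, 'u monoid, 'u \<Rightarrow> 'u) fctr \<Rightarrow>
    ('o, 'm, (('t \<times> 'o \<times> 'm \<Rightarrow> complex) \<times> 'u) monoid,
      ('t \<times> 'o \<times> 'm \<Rightarrow> complex) \<times> 'u \<Rightarrow> ('t \<times> 'o \<times> 'm \<Rightarrow> complex) \<times> 'u) fctr" where
  "ambient P = \<lparr>fob = (\<lambda>a. \<lparr>carrier = coords a \<times> car P a,
       mult = (\<lambda>x y. (\<lambda>j. fst x j * fst y j, snd x \<otimes>\<^bsub>fob P a\<^esub> snd y)),
       one = (\<lambda>_. 1, \<one>\<^bsub>fob P a\<^esub>)\<rparr>),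
     fmap = (\<lambda>a b f x. (twist a b f (fst x), fmap P a b f (snd x)))\<rparr>"

lemma ambient_simps [simp]:
  "car (ambient P) a = coords a \<times> car P a"
  "x \<otimes>\<^bsub>fob (ambient P) a\<^esub> y = (\<lambda>j. fst x j * fst y j, snd x \<otimes>\<^bsub>fob P a\<^esub> snd y)"
  "\<one>\<^bsub>fob (ambient P) a\<^esub> = (\<lambda>_. 1, \<one>\<^bsub>fob P a\<^esub>)"
  "fmap (ambient P) a b f x = (twist a b f (fst x), fmap P a b f (snd x))"
  by (simp_all add: ambient_def)

lemma coordsD:
  assumes "v \<in> coords a"
  shows "cmod (v j) = 1" "\<not> (c \<in> S \<and> k \<in> arr B a c) \<Longrightarrow> v (t, c, k) = 1"
    "c \<in> S \<Longrightarrow> k \<in> arr B a c \<Longrightarrow> k' \<in> arr B a c \<Longrightarrow>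
      v (t, c, k \<otimes>\<^bsub>Hom B a c\<^esub> k') = v (t, c, k) * v (t, c, k')"
  using assms unfolding coords_def by blast+

lemma coordsI:
  assumes "\<And>j. cmod (v j) = 1" "\<And>t c k. \<not> (c \<in> S \<and> k \<in> arr B a c) \<Longrightarrow> v (t, c, k) = 1"
    "\<And>t c k k'. c \<in> S \<Longrightarrow> k \<in> arr B a c \<Longrightarrow> k' \<in> arr B a c \<Longrightarrow>
      v (t, c, k \<otimes>\<^bsub>Hom B a c\<^esub> k') = v (t, c, k) * v (t, c, k')"
  shows "v \<in> coords a"
  using assms unfolding coords_def by blast

lemma S_cmp: "a \<in> S \<Longrightarrow> b \<in> S \<Longrightarrow> c \<in> S \<Longrightarrow> f \<in> arr B a b \<Longrightarrow> g \<in> arr B b c \<Longrightarrow> cmp B a b c g f \<in> arr B a c"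
  using cmp_closed S_obj by blast

lemma S_idt: "a \<in> S \<Longrightarrow> idt B a \<in> arr B a a"
  using idt_closed S_obj by blast

lemma S_add: "a \<in> S \<Longrightarrow> b \<in> S \<Longrightarrow> f \<in> arr B a b \<Longrightarrow> g \<in> arr B a b \<Longrightarrow> f \<otimes>\<^bsub>Hom B a b\<^esub> g \<in> arr B a b"
  using hom_grp[of a b] by (simp add: comm_group_def monoid.m_closed group.is_monoid)

lemma twist_coords:
  assumes a: "a \<in> S" and b: "b \<in> S" and f: "f \<in> arr B a b" and v: "v \<in> coords a"
  shows "twist a b f v \<in> coords b"
proof (rule coordsI)
  fix t c k k' assume c: "c \<in> S" and k: "k \<in> arr B b c" "k' \<in> arr B b c"
  have "cmp B a b c (k \<otimes>\<^bsub>Hom B b c\<^esub> k') f = cmp B a b c k f \<otimes>\<^bsub>Hom B a c\<^esub> cmp B a b c k' f"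
    using cmp_add_left[of a b c f k k'] a b c f k S_obj by blast
  then show "twist a b f v (t, c, k \<otimes>\<^bsub>Hom B b c\<^esub> k') = twist a b f v (t, c, k) * twist a b f v (t, c, k')"
    using coordsD(3)[OF v c S_cmp[OF a b c f k(1)] S_cmp[OF a b c f k(2)]] c k S_add[OF b c k]
    by (simp add: twist_def)
qed (use coordsD(1)[OF v] in \<open>auto simp: twist_def split: prod.split\<close>)

lemma coords_one: "(\<lambda>_. 1) \<in> coords a"
  by (simp add: coords_def)

lemma coords_mult:
  assumes "v \<in> coords a" "w \<in> coords a"
  shows "(\<lambda>j. v j * w j) \<in> coords a"
  by (rule coordsI) (simp_all add: norm_mult coordsD[OF assms(1)] coordsD[OF assms(2)])

lemma coords_inverse:
  assumes "v \<in> coords a"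
  shows "(\<lambda>j. inverse (v j)) \<in> coords a"
  by (rule coordsI) (simp_all add: norm_inverse coordsD[OF assms])

lemma psh_ambient:
  assumes P: "psh P"
  shows "psh (ambient P)" (is "psh ?A")
  unfolding psh_def
proof (intro conjI ballI)
  fix a assume a: "a \<in> S"
  interpret P: comm_group "fob P a" using psh_grp[OF P a] .
  show "comm_group (fob ?A a)"
  proof (rule comm_groupI)
    fix x y assume xy: "x \<in> car ?A a" "y \<in> car ?A a"
    show "x \<otimes>\<^bsub>fob ?A a\<^esub> y \<in> car ?A a"
      using xy coords_mult[of "fst x" a "fst y"] by auto
    show "x \<otimes>\<^bsub>fob ?A a\<^esub> y = y \<otimes>\<^bsub>fob ?A a\<^esub> x"
      using xy by (auto simp: mult.commute P.m_comm)
    fix z assume "z \<in> car ?A a"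
    with xy show "x \<otimes>\<^bsub>fob ?A a\<^esub> y \<otimes>\<^bsub>fob ?A a\<^esub> z = x \<otimes>\<^bsub>fob ?A a\<^esub> (y \<otimes>\<^bsub>fob ?A a\<^esub> z)"
      by (auto simp: mult.assoc P.m_assoc)
  next
    fix x assume x: "x \<in> car ?A a"
    then have c: "fst x \<in> coords a" by auto
    have "fst x j \<noteq> 0" for j using coordsD(1)[OF c, of j] by auto
    then show "\<exists>y\<in>car ?A a. y \<otimes>\<^bsub>fob ?A a\<^esub> x = \<one>\<^bsub>fob ?A a\<^esub>"
      using x coords_inverse[OF c]
      by (intro bexI[of _ "(\<lambda>j. inverse (fst x j), inv\<^bsub>fob P a\<^esub> snd x)"]) auto
    show "\<one>\<^bsub>fob ?A a\<^esub> \<otimes>\<^bsub>fob ?A a\<^esub> x = x" using x by auto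
  qed (simp add: coords_one)
  fix x assume x: "x \<in> car ?A a"
  have "twist a a (idt B a) (fst x) = fst x"
  proof (rule ext, unfold split_paired_all)
    fix t c k
    show "twist a a (idt B a) (fst x) (t, c, k) = fst x (t, c, k)"
      using coordsD(2)[of "fst x" a c k t] x a cmp_idt_right[OF subsetD[OF S_obj a] subsetD[OF S_obj]]
      by (auto simp: twist_def)
  qed
  then show "fmap ?A a a (idt B a) x = x"
    using psh_id[OF P a] x by auto
  fix b f g assume b: "b \<in> S" and f: "f \<in> arr B a b"
  show "fmap ?A a c (cmp B a b c h f) x = fmap ?A b c h (fmap ?A a b f x)"
    if c: "c \<in> S" and h: "h \<in> arr B b c" for c h
  proof -
    have "twist a c (cmp B a b c h f) (fst x) = twist b c h (twist a b f (fst x))"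
    proof (rule ext, unfold split_paired_all)
      fix t d k
      show "twist a c (cmp B a b c h f) (fst x) (t, d, k) = twist b c h (twist a b f (fst x)) (t, d, k)"
        using cmp_assoc[OF subsetD[OF S_obj a] subsetD[OF S_obj b] subsetD[OF S_obj c] subsetD[OF S_obj] f h]
          S_cmp[OF b c _ h, of d k] by (auto simp: twist_def)
    qed
    then show ?thesis using psh_cmp[OF P a b c f h] x by auto
  qed
  assume g: "g \<in> arr B a b"
  have "twist a b (f \<otimes>\<^bsub>Hom B a b\<^esub> g) (fst x) = (\<lambda>j. twist a b f (fst x) j * twist a b g (fst x) j)"
  proof (rule ext, unfold split_paired_all)
    fix t c k
    show "twist a b (f \<otimes>\<^bsub>Hom B a b\<^esub> g) (fst x) (t, c, k) = twist a b f (fst x) (t, c, k) * twist a b g (fst x) (t, c, k)"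
    proof (cases "c \<in> S \<and> k \<in> arr B b c")
      case True
      then show ?thesis
        using cmp_add_right[OF subsetD[OF S_obj a] subsetD[OF S_obj b] subsetD[OF S_obj] f g] coordsD(3)[of "fst x" a c "cmp B a b c k f" "cmp B a b c k g" t]
          S_cmp[OF a b _ f] S_cmp[OF a b _ g] x by (auto simp: twist_def)
    qed (auto simp: twist_def)
  qed
  then show "fmap ?A a b (f \<otimes>\<^bsub>Hom B a b\<^esub> g) x =
      fmap ?A a b f x \<otimes>\<^bsub>fob ?A b\<^esub> fmap ?A a b g x"
    using psh_add[OF P a b f g] x by auto
next
  fix a b f assume *: "a \<in> S" "b \<in> S" "f \<in> arr B a b"
  show "fmap ?A a b f \<in> hom (fob ?A a) (fob ?A b)"
  proof (rule homI)
    fix x assume x: "x \<in> car ?A a"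
    then show "fmap ?A a b f x \<in> car ?A b"
      using twist_coords[OF *] psh_map[OF P *] by auto
    fix y assume "y \<in> car ?A a"
    with x show "fmap ?A a b f (x \<otimes>\<^bsub>fob ?A a\<^esub> y) =
        fmap ?A a b f x \<otimes>\<^bsub>fob ?A b\<^esub> fmap ?A a b f y"
      using psh_mult[OF P *] by (auto simp: twist_def fun_eq_iff)
  qed
qed

end

section \<open>Terms for iterated pushouts and their evaluation\<close>

datatype ('l, 'o, 'i) cterm = Zero 'o | Add 'o "('l, 'o, 'i) cterm" "('l, 'o, 'i) cterm"
  | Ext 'l "'o \<times> 'i \<Rightarrow> ('l, 'o, 'i) cterm" 'o 'i

text \<open>A cell \<open>(l, \<phi>)\<close> consists of exact functors \<open>lM l \<subseteq> lF l\<close>, a morphism \<open>lpsi l\<close> from \<open>lF l\<close> to \<open>P\<close> and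
  a map \<open>\<phi>\<close> that names the images of the elements of \<open>lM l\<close> in the functor under construction. The
  term \<open>Ext l \<phi> a m\<close> names the image of the element \<open>m\<close> of \<open>lF l\<close> at \<open>a\<close> in the pushout.\<close>

locale cells = site B S Q for B :: "('o, 'm) category" and S Q +
  fixes P :: "('o, 'm, 'u monoid, 'u \<Rightarrow> 'u) fctr" and K :: "'o \<Rightarrow> 'u set"
    and L :: "'l set" and lF :: "'l \<Rightarrow> ('o, 'm, 'i monoid, 'i \<Rightarrow> 'i) fctr"
    and lM :: "'l \<Rightarrow> 'o \<Rightarrow> 'i set" and lpsi :: "'l \<Rightarrow> 'o \<Rightarrow> 'i \<Rightarrow> 'u"
  assumes P: "psh P" and K: "subfun P K"
    and lF: "l \<in> L \<Longrightarrow> psh (lF l)" "l \<in> L \<Longrightarrow> exfun (lF l) (car (lF l))"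
    and lM: "l \<in> L \<Longrightarrow> subfun (lF l) (lM l)" "l \<in> L \<Longrightarrow> exfun (lF l) (lM l)"
    and lpsi: "l \<in> L \<Longrightarrow> phom (car (lF l)) (lF l) P (lpsi l)"
      "l \<in> L \<Longrightarrow> a \<in> S \<Longrightarrow> m \<in> car (lF l) a \<Longrightarrow> lpsi l a m \<in> K a"
begin

abbreviation Amb :: "('o, 'm, ((('l, 'o, 'i) cterm \<times> 'o \<times> 'm \<Rightarrow> complex) \<times> 'u) monoid,
    (('l, 'o, 'i) cterm \<times> 'o \<times> 'm \<Rightarrow> complex) \<times> 'u \<Rightarrow> (('l, 'o, 'i) cterm \<times> 'o \<times> 'm \<Rightarrow> complex) \<times> 'u) fctr"
  where "Amb \<equiv> ambient P"

primrec pval :: "('l, 'o, 'i) cterm \<Rightarrow> 'u" where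
  "pval (Zero a) = \<one>\<^bsub>fob P a\<^esub>"
| "pval (Add a s t) = pval s \<otimes>\<^bsub>fob P a\<^esub> pval t"
| "pval (Ext l \<phi> a m) = lpsi l a m"

primrec elt :: "('l, 'o, 'i) cterm \<Rightarrow> 'i" where
  "elt (Ext l \<phi> a m) = m"

text \<open>At the coordinates named by elements of the cell itself the character is chosen to detect the
  elements outside \<open>lM l\<close>; at all others it extends the one already given on \<open>lM l\<close>.\<close>

definition cellchar :: "'l \<Rightarrow> ('o \<times> 'i \<Rightarrow> ('l, 'o, 'i) cterm) \<Rightarrow>
    ('o \<times> 'i \<Rightarrow> ('l, 'o, 'i) cterm \<times> 'o \<times> 'm \<Rightarrow> complex) \<Rightarrow> ('l, 'o, 'i) cterm \<Rightarrow> 'o \<Rightarrow> 'i \<Rightarrow> complex" where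
  "cellchar l \<phi> w t b =
     (if \<exists>a m. t = Ext l \<phi> a m
      then SOME \<chi>. character (fob (lF l) b) (car (lF l) b) \<chi> \<and> (\<forall>m\<in>lM l b. \<chi> m = 1) \<and>
        (elt t \<in> car (lF l) b - lM l b \<longrightarrow> \<chi> (elt t) \<noteq> 1)
      else if \<forall>m\<in>lM l b. w (b, m) (t, b, idt B b) = 1 then (\<lambda>_. 1)
      else SOME \<chi>. character (fob (lF l) b) (car (lF l) b) \<chi> \<and> (\<forall>m\<in>lM l b. \<chi> m = w (b, m) (t, b, idt B b)))"

text \<open>The morphism into the cofree factors that corresponds to the characters
  \<open>cellchar\<close>. The parameter \<open>w\<close> stands for the values of the children, so
  that \<open>cval\<close> can recurse through the attaching map.\<close>

definition cellval :: "'l \<Rightarrow> ('o \<times> 'i \<Rightarrow> ('l, 'o, 'i) cterm) \<Rightarrow>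
    ('o \<times> 'i \<Rightarrow> ('l, 'o, 'i) cterm \<times> 'o \<times> 'm \<Rightarrow> complex) \<Rightarrow> 'o \<Rightarrow> 'i \<Rightarrow> ('l, 'o, 'i) cterm \<times> 'o \<times> 'm \<Rightarrow> complex" where
  "cellval l \<phi> w a m = (\<lambda>(t, b, h). if b \<in> S \<and> h \<in> arr B a b
     then cellchar l \<phi> w t b (fmap (lF l) a b h m) else 1)"

primrec cval :: "('l, 'o, 'i) cterm \<Rightarrow> ('l, 'o, 'i) cterm \<times> 'o \<times> 'm \<Rightarrow> complex" where
  "cval (Zero a) = (\<lambda>_. 1)"
| "cval (Add a s t) = (\<lambda>j. cval s j * cval t j)"
| "cval (Ext l \<phi> a m) = cellval l \<phi> (\<lambda>p. cval (\<phi> p)) a m"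

definition tval :: "('l, 'o, 'i) cterm \<Rightarrow> (('l, 'o, 'i) cterm \<times> 'o \<times> 'm \<Rightarrow> complex) \<times> 'u" where
  "tval t = (cval t, pval t)"

primrec subcells :: "('l, 'o, 'i) cterm \<Rightarrow> ('l \<times> ('o \<times> 'i \<Rightarrow> ('l, 'o, 'i) cterm)) set" where
  "subcells (Zero a) = {}"
| "subcells (Add a s t) = subcells s \<union> subcells t"
| "subcells (Ext l \<phi> a m) = insert (l, \<phi>) (\<Union>p. subcells (\<phi> p))"

text \<open>Only the cells whose elements occur as summands, not those hidden in attaching maps.
  This set is finite, unlike \<open>subcells\<close> in general, and so is contained in a single
  member of a chain as soon as it is contained in the union.\<close>

primrec topcells :: "('l, 'o, 'i) cterm \<Rightarrow> ('l \<times> ('o \<times> 'i \<Rightarrow> ('l, 'o, 'i) cterm)) set" where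
  "topcells (Zero a) = {}"
| "topcells (Add a s t) = topcells s \<union> topcells t"
| "topcells (Ext l \<phi> a m) = {(l, \<phi>)}"

text \<open>Evaluation is already defined on raw terms, so that \<open>\<phi>\<close> evaluates to a
  morphism is a mere side condition of the rule. The fixed default of \<open>\<phi>\<close> off its
  domain makes a term depend on boundedly many children, which is what lets the terms be
  counted.\<close>

inductive_set terms :: "('o \<times> ('l, 'o, 'i) cterm) set" where
  terms_Zero: "a \<in> S \<Longrightarrow> (a, Zero a) \<in> terms"
| terms_Add: "(a, s) \<in> terms \<Longrightarrow> (a, t) \<in> terms \<Longrightarrow> (a, Add a s t) \<in> terms"
| terms_Ext: "l \<in> L \<Longrightarrow> (\<And>b n. b \<in> S \<Longrightarrow> n \<in> lM l b \<Longrightarrow> (b, \<phi> (b, n)) \<in> terms) \<Longrightarrow>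
    phom (lM l) (lF l) Amb (\<lambda>b n. tval (\<phi> (b, n))) \<Longrightarrow>
    (\<forall>b\<in>S. \<forall>n\<in>lM l b. pval (\<phi> (b, n)) = lpsi l b n) \<Longrightarrow>
    (\<forall>p. p \<notin> Sigma S (lM l) \<longrightarrow> \<phi> p = Zero undefined) \<Longrightarrow>
    a \<in> S \<Longrightarrow> m \<in> car (lF l) a \<Longrightarrow> (a, Ext l \<phi> a m) \<in> terms"

definition valid :: "'l \<times> ('o \<times> 'i \<Rightarrow> ('l, 'o, 'i) cterm) \<Rightarrow> bool" where
  "valid c \<longleftrightarrow> (case c of (l, \<phi>) \<Rightarrow> l \<in> L \<and> (\<forall>b\<in>S. \<forall>n\<in>lM l b. (b, \<phi> (b, n)) \<in> terms) \<and>
     phom (lM l) (lF l) Amb (\<lambda>b n. tval (\<phi> (b, n))) \<and>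
     (\<forall>b\<in>S. \<forall>n\<in>lM l b. pval (\<phi> (b, n)) = lpsi l b n) \<and>
     (\<forall>p. p \<notin> Sigma S (lM l) \<longrightarrow> \<phi> p = Zero undefined))"

lemma psh_Amb: "psh Amb" by (rule psh_ambient[OF P])

lemma lM_car: "l \<in> L \<Longrightarrow> a \<in> S \<Longrightarrow> lM l a \<subseteq> car (lF l) a"
  using subfun_car[OF lM(1)] by blast

lemma terms_valid: "valid (l, \<phi>) \<Longrightarrow> a \<in> S \<Longrightarrow> m \<in> car (lF l) a \<Longrightarrow> (a, Ext l \<phi> a m) \<in> terms"
  by (rule terms_Ext) (auto simp: valid_def)

text \<open>Terms are well-founded: a cell nested inside its own attaching map would give an
  infinite descent.\<close>

lemma subcells_irrefl: "(l, \<phi>) \<in> subcells t \<Longrightarrow> (l, \<phi>) \<notin> subcells (\<phi> p)"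
proof (induction t arbitrary: l \<phi> p)
  case (Ext l' \<phi>' a m)
  show ?case
  proof (cases "(l, \<phi>) = (l', \<phi>')")
    case True
    then show ?thesis using Ext.IH[of "\<phi>' p" l \<phi> p] by blast
  next
    case False
    then obtain q where "(l, \<phi>) \<in> subcells (\<phi>' q)" using Ext.prems by auto
    then show ?thesis using Ext.IH by blast
  qed
qed auto

lemma subcells_irrefl': "(l, \<phi>) \<notin> subcells (\<phi> p)"
  using subcells_irrefl[of l \<phi> "Ext l \<phi> a m" for a m] by simp

text \<open>The coordinates named by elements of a cell are reserved for terms that contain this
  cell. This uses the constant character in \<open>cellchar\<close>: where all children have value
  1, an arbitrary extension could still be nontrivial.\<close>

lemma cval_support: "(l, \<phi>) \<notin> subcells t \<Longrightarrow> cval t (Ext l \<phi> a m, b, h) = 1"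
proof (induction t arbitrary: b h)
  case (Ext l' \<phi>' a' m')
  then have "(l, \<phi>) \<notin> subcells (\<phi>' p)" for p unfolding subcells.simps by blast
  then have "cval (\<phi>' p) (Ext l \<phi> a m, b, h) = 1" for p b h using Ext.IH by blast
  moreover have "\<not> (\<exists>a'' m''. Ext l \<phi> a m = Ext l' \<phi>' a'' m'')" using Ext.prems by auto
  ultimately show ?case by (auto simp: cellval_def cellchar_def)
qed auto

lemma topcells_finite: "finite (topcells t)"
  by (induction t) auto

lemma topcells_subcells: "topcells t \<subseteq> subcells t"
  by (induction t) auto

lemma terms_S: "(a, t) \<in> terms \<Longrightarrow> a \<in> S"
  by (induction rule: terms.induct) auto

text \<open>The choices in \<open>cellchar\<close> are realizable: at reserved coordinates by
  separating a point from \<open>lM l\<close>, elsewhere by extending the character that the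
  attaching map induces on \<open>lM l\<close>.\<close>

lemma cellchar:
  assumes c: "valid (l, \<phi>)" and b: "b \<in> S"
  shows "character (fob (lF l) b) (car (lF l) b) (cellchar l \<phi> (\<lambda>p. cval (\<phi> p)) t b)" (is "character _ _ ?\<chi>")
    and "m \<in> lM l b \<Longrightarrow> cellchar l \<phi> (\<lambda>p. cval (\<phi> p)) t b m = cval (\<phi> (b, m)) (t, b, idt B b)"
    and "t = Ext l \<phi> a n \<Longrightarrow> n \<in> car (lF l) b \<Longrightarrow> n \<notin> lM l b \<Longrightarrow>
      cellchar l \<phi> (\<lambda>p. cval (\<phi> p)) t b n \<noteq> 1"
proof -
  have l: "l \<in> L" and ph: "phom (lM l) (lF l) Amb (\<lambda>b n. tval (\<phi> (b, n)))" using c by (auto simp: valid_def)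
  interpret F: comm_group "fob (lF l) b" using psh_grp[OF lF(1)[OF l] b] .
  note sg = subfun_subgroup[OF lF(1)[OF l] lM(1)[OF l] b]
  let ?w = "\<lambda>m. cval (\<phi> (b, m)) (t, b, idt B b)"
  have "character (fob (lF l) b) (car (lF l) b) ?\<chi> \<and> (\<forall>m\<in>lM l b. ?\<chi> m = ?w m) \<and>
    (\<forall>a n. t = Ext l \<phi> a n \<and> n \<in> car (lF l) b \<and> n \<notin> lM l b \<longrightarrow> ?\<chi> n \<noteq> 1)"
  proof (cases "\<exists>a n. t = Ext l \<phi> a n")
    case True
    then obtain a n where t: "t = Ext l \<phi> a n" by blast
    have "\<exists>\<chi>. character (fob (lF l) b) (car (lF l) b) \<chi> \<and> (\<forall>m\<in>lM l b. \<chi> m = 1) \<and>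
        (elt t \<in> car (lF l) b - lM l b \<longrightarrow> \<chi> (elt t) \<noteq> 1)"
    proof (cases "elt t \<in> car (lF l) b - lM l b")
      case True
      then obtain \<chi> where "character (fob (lF l) b) (car (lF l) b) \<chi>" "\<And>m. m \<in> lM l b \<Longrightarrow> \<chi> m = 1" "\<chi> (elt t) \<noteq> 1"
        using F.character_separates[OF sg, of "elt t"] by blast
      then show ?thesis by blast
    next
      case False
      then show ?thesis by (intro exI[of _ "\<lambda>_. 1"]) (simp add: character_def)
    qed
    from someI_ex[OF this] True have 1: "character (fob (lF l) b) (car (lF l) b) ?\<chi>" "\<forall>m\<in>lM l b. ?\<chi> m = 1"
      "n \<in> car (lF l) b - lM l b \<longrightarrow> ?\<chi> n \<noteq> 1" by (simp_all add: cellchar_def t)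
    \<comment> \<open>No conflict arises between detecting points and extending the given values:
      the cell does not occur in its own children, so these have value 1 at its reserved
      coordinates.\<close>
    moreover have "?w m = 1" for m
      using cval_support[OF subcells_irrefl'] by (simp add: t)
    ultimately show ?thesis by (simp add: t)
  next
    case False
    note F = this
    show ?thesis
    proof (cases "\<forall>m\<in>lM l b. ?w m = 1")
      case True
      then have "?\<chi> = (\<lambda>_. 1)" using F by (simp add: cellchar_def)
      then show ?thesis using True F by (simp add: character_def)
    next
      case False
      have "character (fob (lF l) b) (lM l b) ?w"
        unfolding character_def
      proof (intro ballI conjI)
        fix x assume x: "x \<in> lM l b"
        show "cmod (?w x) = 1"
          using phom_car[OF ph b x] by (auto simp: tval_def dest: coordsD)
        show "?w (x \<otimes>\<^bsub>fob (lF l) b\<^esub> y) = ?w x * ?w y" if "y \<in> lM l b" for y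
          using phom_mult[OF ph b x that] by (simp add: tval_def fun_eq_iff)
      qed
      then obtain \<chi> where "character (fob (lF l) b) (car (lF l) b) \<chi>" "\<And>m. m \<in> lM l b \<Longrightarrow> \<chi> m = ?w m"
        using F.character_extend[OF sg] by metis
      define \<Phi> where "\<Phi> \<chi> \<longleftrightarrow> character (fob (lF l) b) (car (lF l) b) \<chi> \<and> (\<forall>m\<in>lM l b. \<chi> m = ?w m)" for \<chi>
      have ex: "\<exists>\<chi>. \<Phi> \<chi>"
        unfolding \<Phi>_def using \<open>character (fob (lF l) b) (car (lF l) b) \<chi>\<close> \<open>\<And>m. m \<in> lM l b \<Longrightarrow> \<chi> m = ?w m\<close> by blast
      have "?\<chi> = (SOME \<chi>. \<Phi> \<chi>)"
        unfolding cellchar_def if_not_P[OF F] if_not_P[OF False] \<Phi>_def ..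
      then have "\<Phi> ?\<chi>" by (rule ssubst) (rule someI_ex[OF ex])
      then show ?thesis using F unfolding \<Phi>_def by blast
    qed
  qed
  then show "character (fob (lF l) b) (car (lF l) b) ?\<chi>"
    "m \<in> lM l b \<Longrightarrow> ?\<chi> m = ?w m"
    "t = Ext l \<phi> a n \<Longrightarrow> n \<in> car (lF l) b \<Longrightarrow> n \<notin> lM l b \<Longrightarrow> ?\<chi> n \<noteq> 1" by blast+
qed

text \<open>Each coordinate has the form \<chi> (h m) for a character \<chi>, so additivity and
  naturality hold for any choice of the characters.\<close>

lemma cell_phom:
  assumes c: "valid (l, \<phi>)"
  shows "phom (car (lF l)) (lF l) Amb (\<lambda>a m. tval (Ext l \<phi> a m))"
proof -
  have l: "l \<in> L" using c by (auto simp: valid_def)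
  let ?c = "cellchar l \<phi> (\<lambda>p. cval (\<phi> p))"
  note F = lF(1)[OF l] and ch = cellchar(1)[OF c, unfolded character_def]
  show ?thesis
    unfolding phom_def
  proof (intro ballI conjI)
    fix a m assume a: "a \<in> S" and m: "m \<in> car (lF l) a"
    have "cellval l \<phi> (\<lambda>p. cval (\<phi> p)) a m \<in> coords a"
    proof (rule coordsI)
      show "cmod (cellval l \<phi> (\<lambda>p. cval (\<phi> p)) a m j) = 1" for j
        using ch psh_map[OF F a _ _ m] by (cases j) (simp add: cellval_def)
      fix t b h h' assume b: "b \<in> S" and h: "h \<in> arr B a b" and h': "h' \<in> arr B a b"
      show "cellval l \<phi> (\<lambda>p. cval (\<phi> p)) a m (t, b, h \<otimes>\<^bsub>Hom B a b\<^esub> h') =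
        cellval l \<phi> (\<lambda>p. cval (\<phi> p)) a m (t, b, h) * cellval l \<phi> (\<lambda>p. cval (\<phi> p)) a m (t, b, h')"
        using ch[OF b] psh_map[OF F a b h m] psh_map[OF F a b h' m] psh_add[OF F a b h h' m] b h h' S_add[OF a b h h']
        by (simp add: cellval_def)
    qed (auto simp: cellval_def)
    then show "tval (Ext l \<phi> a m) \<in> car Amb a"
      using phom_car[OF lpsi(1)[OF l] a m] by (simp add: tval_def)
    show "tval (Ext l \<phi> a (m \<otimes>\<^bsub>fob (lF l) a\<^esub> n)) = tval (Ext l \<phi> a m) \<otimes>\<^bsub>fob Amb a\<^esub> tval (Ext l \<phi> a n)"
      if n: "n \<in> car (lF l) a" for n
    proof -
      have "cellval l \<phi> (\<lambda>p. cval (\<phi> p)) a (m \<otimes>\<^bsub>fob (lF l) a\<^esub> n) j =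
          cellval l \<phi> (\<lambda>p. cval (\<phi> p)) a m j * cellval l \<phi> (\<lambda>p. cval (\<phi> p)) a n j" for j
        using ch psh_map[OF F a _ _ m] psh_map[OF F a _ _ n] psh_mult[OF F a _ _ m n]
        by (cases j) (simp add: cellval_def)
      then show ?thesis using phom_mult[OF lpsi(1)[OF l] a m n] by (simp add: tval_def fun_eq_iff)
    qed
    fix b f assume b: "b \<in> S" and f: "f \<in> arr B a b"
    have "cellval l \<phi> (\<lambda>p. cval (\<phi> p)) b (fmap (lF l) a b f m) = twist a b f (cellval l \<phi> (\<lambda>p. cval (\<phi> p)) a m)"
    proof (rule ext, unfold split_paired_all)
      fix t c k
      show "cellval l \<phi> (\<lambda>p. cval (\<phi> p)) b (fmap (lF l) a b f m) (t, c, k) =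
          twist a b f (cellval l \<phi> (\<lambda>p. cval (\<phi> p)) a m) (t, c, k)"
        using psh_cmp[OF F a b _ f _ m, of c k] S_cmp[OF a b _ f, of c k]
        by (auto simp: cellval_def twist_def)
    qed
    then show "tval (Ext l \<phi> b (fmap (lF l) a b f m)) = fmap Amb a b f (tval (Ext l \<phi> a m))"
      using phom_nat[OF lpsi(1)[OF l] a b f m] by (simp add: tval_def)
  qed
qed

text \<open>The pushout relation. By naturality of the attaching map, the coordinate of \<phi> (a,
  m) at h is the coordinate of \<phi> (b, h m) at the identity, and there \<open>cellchar\<close>
  extends the given character.\<close>

lemma cell_extends:
  assumes c: "valid (l, \<phi>)" and a: "a \<in> S" and m: "m \<in> lM l a"
  shows "tval (Ext l \<phi> a m) = tval (\<phi> (a, m))"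
proof -
  have l: "l \<in> L" and ph: "phom (lM l) (lF l) Amb (\<lambda>b n. tval (\<phi> (b, n)))"
    and p: "pval (\<phi> (a, m)) = lpsi l a m" using c a m by (auto simp: valid_def)
  have co: "cval (\<phi> (a, m)) \<in> coords a" using phom_car[OF ph a m] by (simp add: tval_def)
  have "cellval l \<phi> (\<lambda>p. cval (\<phi> p)) a m j = cval (\<phi> (a, m)) j" for j
  proof -
    obtain t b h where j: "j = (t, b, h)" by (cases j)
    show ?thesis
    proof (cases "b \<in> S \<and> h \<in> arr B a b")
      case True
      then have b: "b \<in> S" and h: "h \<in> arr B a b" by auto
      have "cval (\<phi> (b, fmap (lF l) a b h m)) = twist a b h (cval (\<phi> (a, m)))"
        using phom_nat[OF ph a b h m] by (simp add: tval_def)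
      then have "cval (\<phi> (b, fmap (lF l) a b h m)) (t, b, idt B b) = cval (\<phi> (a, m)) (t, b, h)"
        using b h S_idt[OF b] cmp_idt_left[OF subsetD[OF S_obj a] subsetD[OF S_obj b] h]
        by (simp add: twist_def)
      then show ?thesis
        using cellchar(2)[OF c b subfun_map[OF lM(1)[OF l] a b h m]] b h by (simp add: j cellval_def)
    next
      case False
      then show ?thesis using coordsD(2)[OF co False] by (auto simp: j cellval_def)
    qed
  qed
  then show ?thesis using p by (simp add: tval_def fun_eq_iff)
qed

lemma terms_tval: "(a, t) \<in> terms \<Longrightarrow> tval t \<in> car Amb a"
proof (induction rule: terms.induct)
  case (terms_Zero a)
  then show ?case using subfun_one[OF subfun_carrier[OF psh_Amb] terms_Zero]
    by (simp add: tval_def)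
next
  case (terms_Add a s t)
  then show ?case using subfun_mult[OF subfun_carrier[OF psh_Amb] terms_S[OF terms_Add(1)], of "tval s" "tval t"]
    by (simp add: tval_def)
next
  case (terms_Ext l \<phi> a m)
  have "valid (l, \<phi>)" using terms_Ext by (auto simp: valid_def)
  from phom_car[OF cell_phom[OF this]] terms_Ext show ?case by blast
qed

lemma terms_pval: "(a, t) \<in> terms \<Longrightarrow> pval t \<in> K a"
proof (induction rule: terms.induct)
  case (terms_Add a s t)
  then show ?case using subfun_mult[OF K terms_S[OF terms_Add(1)]] by simp
qed (use subfun_one[OF K] lpsi(2) in auto)

text \<open>Arrows act on terms only up to evaluation. That the top cells stay the same is what
  makes every \<open>span D\<close> a subfunctor.\<close>

lemma terms_map:
  "(a, t) \<in> terms \<Longrightarrow> b \<in> S \<Longrightarrow> f \<in> arr B a b \<Longrightarrow>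
    \<exists>t'. (b, t') \<in> terms \<and> topcells t' = topcells t \<and> tval t' = fmap Amb a b f (tval t)"
proof (induction rule: terms.induct)
  case (terms_Zero a)
  then show ?case using terms.terms_Zero[of b] psh_one[OF psh_Amb, of a b f]
    by (intro exI[of _ "Zero b"]) (auto simp: tval_def)
next
  case (terms_Add a s t)
  then obtain s' t' where *: "(b, s') \<in> terms" "topcells s' = topcells s" "tval s' = fmap Amb a b f (tval s)"
    "(b, t') \<in> terms" "topcells t' = topcells t" "tval t' = fmap Amb a b f (tval t)" by blast
  have "tval (Add b s' t') = tval s' \<otimes>\<^bsub>fob Amb b\<^esub> tval t'" "tval (Add a s t) = tval s \<otimes>\<^bsub>fob Amb a\<^esub> tval t"
    by (simp_all add: tval_def)
  then have "tval (Add b s' t') = fmap Amb a b f (tval (Add a s t))"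
    using psh_mult[OF psh_Amb terms_S[OF terms_Add(1)] terms_Add(5,6) terms_tval[OF terms_Add(1)]
        terms_tval[OF terms_Add(2)]] * by simp
  then show ?case using * terms.terms_Add by (intro exI[of _ "Add b s' t'"]) simp
next
  case (terms_Ext l \<phi> a m)
  have v: "valid (l, \<phi>)" using terms_Ext by (auto simp: valid_def)
  have "m \<in> car (lF l) a" "a \<in> S" "l \<in> L" using terms_Ext by auto
  then have "fmap (lF l) a b f m \<in> car (lF l) b" using psh_map[OF lF(1)] terms_Ext.prems by blast
  then show ?case
    using terms_valid[OF v \<open>b \<in> S\<close>] phom_nat[OF cell_phom[OF v] \<open>a \<in> S\<close> terms_Ext.prems \<open>m \<in> car (lF l) a\<close>]
    by (intro exI[of _ "Ext l \<phi> b (fmap (lF l) a b f m)"]) simp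
qed

definition span :: "('l \<times> ('o \<times> 'i \<Rightarrow> ('l, 'o, 'i) cterm)) set \<Rightarrow> 'o \<Rightarrow>
    ((('l, 'o, 'i) cterm \<times> 'o \<times> 'm \<Rightarrow> complex) \<times> 'u) set" where
  "span D a = {tval t |t. (a, t) \<in> terms \<and> topcells t \<subseteq> D}"

lemma subfun_span: "subfun Amb (span D)"
  unfolding subfun_def
proof (intro ballI conjI)
  fix a assume a: "a \<in> S"
  show "span D a \<subseteq> car Amb a" using terms_tval unfolding span_def by blast
  show "\<one>\<^bsub>fob Amb a\<^esub> \<in> span D a"
    using terms_Zero[OF a] unfolding span_def by (intro CollectI exI[of _ "Zero a"]) (simp add: tval_def)
  show "x \<otimes>\<^bsub>fob Amb a\<^esub> y \<in> span D a" if xy: "x \<in> span D a" "y \<in> span D a" for x y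
  proof -
    obtain s t where *: "x = tval s" "(a, s) \<in> terms" "topcells s \<subseteq> D" "y = tval t" "(a, t) \<in> terms" "topcells t \<subseteq> D"
      using xy by (auto simp: span_def)
    then show ?thesis using terms_Add[OF *(2,5)] unfolding span_def
      by (intro CollectI exI[of _ "Add a s t"]) (simp add: tval_def)
  qed
  fix b f x assume bf: "b \<in> S" "f \<in> arr B a b" and "x \<in> span D a"
  then obtain t where "x = tval t" "(a, t) \<in> terms" "topcells t \<subseteq> D" by (auto simp: span_def)
  then obtain t' where "(b, t') \<in> terms" "topcells t' = topcells t" "tval t' = fmap Amb a b f x"
    using terms_map[OF _ bf, of t] by blast
  then show "fmap Amb a b f x \<in> span D b"
    using \<open>topcells t \<subseteq> D\<close> unfolding span_def by (intro CollectI exI[of _ t']) simp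
qed

text \<open>The attaching maps of the members use members only, so such a set is a stage of the
  iterated construction.\<close>

definition closed :: "('l \<times> ('o \<times> 'i \<Rightarrow> ('l, 'o, 'i) cterm)) set \<Rightarrow> bool" where
  "closed D \<longleftrightarrow> (\<forall>(l, \<phi>)\<in>D. \<forall>p. subcells (\<phi> p) \<subseteq> D)"

lemma closed_subcells: "closed D \<Longrightarrow> topcells t \<subseteq> D \<Longrightarrow> subcells t \<subseteq> D"
proof (induction t)
  case (Ext l \<phi> a m)
  then have "(l, \<phi>) \<in> D" by simp
  moreover from this have "subcells (\<phi> p) \<subseteq> D" for p using Ext.prems(1) unfolding closed_def by blast
  ultimately show ?case unfolding subcells.simps by blast
qed auto

lemma subcells_valid: "(a, t) \<in> terms \<Longrightarrow> c \<in> subcells t \<Longrightarrow> valid c"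
proof (induction arbitrary: c rule: terms.induct)
  case (terms_Ext l \<phi> a m)
  have "valid (l, \<phi>)" using terms_Ext by (auto simp: valid_def)
  moreover have "valid c" if "c \<in> subcells (\<phi> p)" for p
  proof (cases "p \<in> Sigma S (lM l)")
    case True
    then obtain b n where "p = (b, n)" "b \<in> S" "n \<in> lM l b" by blast
    then show ?thesis using terms_Ext.IH that by blast
  next
    case False
    then have "\<phi> p = Zero undefined" using terms_Ext by blast
    then show ?thesis using that by simp
  qed
  ultimately show ?case using terms_Ext.prems by auto
qed auto

text \<open>Descent through the term reaches an innermost cell of \<open>N\<close>. For
  \<open>N\<close> the set of missing cells, this is one that can be attached next.\<close>

lemma minimal_cell: "subcells t \<inter> N \<noteq> {} \<Longrightarrow> \<exists>l \<phi>. (l, \<phi>) \<in> N \<and> (\<forall>p. subcells (\<phi> p) \<inter> N = {})"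
proof (induction t)
  case (Ext l \<phi> a m)
  show ?case
  proof (cases "\<exists>p. subcells (\<phi> p) \<inter> N \<noteq> {}")
    case True
    then show ?thesis using Ext.IH by blast
  next
    case False
    then show ?thesis using Ext.prems by auto
  qed
qed auto

text \<open>All contributions of the new cell to a sum can be collected by commutativity into a
  single element of it. This puts the enlarged span into the shape required by
  \<open>exfun_sum\<close>.\<close>

lemma span_insert:
  assumes v: "valid (l, \<phi>)" and a: "a \<in> S"
  shows "span (insert (l, \<phi>) D) a =
    {x \<otimes>\<^bsub>fob Amb a\<^esub> tval (Ext l \<phi> a m) |x m. x \<in> span D a \<and> m \<in> car (lF l) a}" (is "_ = ?R a")
proof
  have l: "l \<in> L" using v by (auto simp: valid_def)
  show "?R a \<subseteq> span (insert (l, \<phi>) D) a"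
  proof (rule subsetI)
    fix y assume "y \<in> ?R a"
    then obtain x m where y: "y = x \<otimes>\<^bsub>fob Amb a\<^esub> tval (Ext l \<phi> a m)" and x: "x \<in> span D a"
      and m: "m \<in> car (lF l) a" by blast
    have "tval (Ext l \<phi> a m) \<in> span (insert (l, \<phi>) D) a"
      using terms_valid[OF v a m] unfolding span_def by (intro CollectI exI[of _ "Ext l \<phi> a m"]) simp
    moreover have "x \<in> span (insert (l, \<phi>) D) a" using x unfolding span_def by blast
    ultimately show "y \<in> span (insert (l, \<phi>) D) a"
      unfolding y using subfun_mult[OF subfun_span a] by blast
  qed
  note pA = psh_Amb
  note h = cell_phom[OF v] and F = lF(1)[OF l]
  have "topcells t \<subseteq> insert (l, \<phi>) D \<longrightarrow> tval t \<in> ?R b" if "(b, t) \<in> terms" for b t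
    using that
  proof (induction rule: terms.induct)
    case (terms_Zero b)
    have o: "\<one>\<^bsub>fob (lF l) b\<^esub> \<in> car (lF l) b" using subfun_one[OF subfun_carrier[OF F] terms_Zero] .
    have "tval (Zero b) = \<one>\<^bsub>fob Amb b\<^esub> \<otimes>\<^bsub>fob Amb b\<^esub> tval (Ext l \<phi> b \<one>\<^bsub>fob (lF l) b\<^esub>)"
      using phom_one[OF F pA subfun_carrier[OF F] h terms_Zero] psh_grp[OF P terms_Zero]
      by (simp add: tval_def comm_group_def monoid.l_one monoid.one_closed group.is_monoid)
    then show ?case using subfun_one[OF subfun_span terms_Zero] o by blast
  next
    case (terms_Add b s t)
    note b = terms_S[OF terms_Add(1)]
    interpret A: comm_group "fob Amb b" using psh_grp[OF pA b] .
    show ?case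
    proof
      assume "topcells (Add b s t) \<subseteq> insert (l, \<phi>) D"
      then obtain x m y n where *: "tval s = x \<otimes>\<^bsub>fob Amb b\<^esub> tval (Ext l \<phi> b m)" "x \<in> span D b" "m \<in> car (lF l) b"
        "tval t = y \<otimes>\<^bsub>fob Amb b\<^esub> tval (Ext l \<phi> b n)" "y \<in> span D b" "n \<in> car (lF l) b"
        using terms_Add by auto
      have c: "x \<in> car Amb b" "y \<in> car Amb b" "tval (Ext l \<phi> b m) \<in> car Amb b" "tval (Ext l \<phi> b n) \<in> car Amb b"
        using subfun_car[OF subfun_span b] phom_car[OF h b] * by blast+
      have "tval (Add b s t) = tval s \<otimes>\<^bsub>fob Amb b\<^esub> tval t" by (simp add: tval_def)
      also have "\<dots> = (x \<otimes>\<^bsub>fob Amb b\<^esub> y) \<otimes>\<^bsub>fob Amb b\<^esub> tval (Ext l \<phi> b (m \<otimes>\<^bsub>fob (lF l) b\<^esub> n))"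
        unfolding phom_mult[OF h b *(3,6)] *(1,4) using c by (simp add: A.m_ac del: ambient_simps)
      finally show "tval (Add b s t) \<in> ?R b"
        using subfun_mult[OF subfun_span b *(2,5)] subfun_mult[OF subfun_carrier[OF F] b *(3,6)] by blast
    qed
  next
    case (terms_Ext l' \<phi>' b m)
    then have b: "b \<in> S" by blast
    interpret A: comm_group "fob Amb b" using psh_grp[OF pA b] .
    show ?case
    proof
      assume *: "topcells (Ext l' \<phi>' b m) \<subseteq> insert (l, \<phi>) D"
      have t: "(b, Ext l' \<phi>' b m) \<in> terms" using terms_Ext by (intro terms.terms_Ext) auto
      note tc = terms_tval[OF t]
      show "tval (Ext l' \<phi>' b m) \<in> ?R b"
      proof (cases "(l', \<phi>') = (l, \<phi>)")
        case True
        then have "tval (Ext l' \<phi>' b m) = \<one>\<^bsub>fob Amb b\<^esub> \<otimes>\<^bsub>fob Amb b\<^esub> tval (Ext l \<phi> b m)" "m \<in> car (lF l) b"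
          using A.l_one[OF tc] terms_Ext by auto
        then show ?thesis using subfun_one[OF subfun_span b] by blast
      next
        case False
        then have "tval (Ext l' \<phi>' b m) \<in> span D b" using t * unfolding span_def by auto
        moreover have "tval (Ext l' \<phi>' b m) =
            tval (Ext l' \<phi>' b m) \<otimes>\<^bsub>fob Amb b\<^esub> tval (Ext l \<phi> b \<one>\<^bsub>fob (lF l) b\<^esub>)"
          using A.r_one[OF tc] phom_one[OF F pA subfun_carrier[OF F] h b] by simp
        ultimately show ?thesis using subfun_one[OF subfun_carrier[OF F] b] by blast
      qed
    qed
  qed
  then show "span (insert (l, \<phi>) D) a \<subseteq> ?R a" unfolding span_def[of "insert (l, \<phi>) D"] by blast
qed

text \<open>A point m outside \<open>lM l\<close> has a value other than 1 at its reserved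
  coordinate, whereas every term without the new cell has value 1 there. So the cell meets the old
  span exactly in \<open>lM l\<close>, and \<open>exfun_sum\<close> applies.\<close>

lemma exfun_span_insert:
  assumes v: "valid (l, \<phi>)" and D: "closed D" "exfun Amb (span D)"
    and sub: "\<And>p. subcells (\<phi> p) \<subseteq> D" and new: "(l, \<phi>) \<notin> D"
  shows "exfun Amb (span (insert (l, \<phi>) D))"
proof -
  have l: "l \<in> L" using v by (auto simp: valid_def)
  note F = lF(1)[OF l]
  have meet: "tval (Ext l \<phi> a m) \<in> span D a \<longleftrightarrow> m \<in> lM l a" if a: "a \<in> S" and m: "m \<in> car (lF l) a" for a m
  proof
    assume "m \<in> lM l a"
    moreover then have "(a, \<phi> (a, m)) \<in> terms" using v a by (auto simp: valid_def)
    ultimately show "tval (Ext l \<phi> a m) \<in> span D a"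
      using cell_extends[OF v a] topcells_subcells[of "\<phi> (a, m)"] sub[of "(a, m)"] unfolding span_def by blast
  next
    assume "tval (Ext l \<phi> a m) \<in> span D a"
    then obtain t where t: "tval (Ext l \<phi> a m) = tval t" "topcells t \<subseteq> D" by (auto simp: span_def)
    \<comment> \<open>\<open>D\<close> is closed and lacks the new cell, so the cell occurs in
      \<open>t\<close> at no depth, not just not on top.\<close>
    have "(l, \<phi>) \<notin> subcells t" using closed_subcells[OF D(1) t(2)] new by blast
    then have "cval t (Ext l \<phi> a m, a, idt B a) = 1" by (rule cval_support)
    moreover have "cval (Ext l \<phi> a m) = cval t" using t(1) unfolding tval_def by (rule prod.inject[THEN iffD1, THEN conjunct1])
    ultimately have "cellval l \<phi> (\<lambda>p. cval (\<phi> p)) a m (Ext l \<phi> a m, a, idt B a) = 1" by (metis cval.simps(3))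
    then have "cellchar l \<phi> (\<lambda>p. cval (\<phi> p)) (Ext l \<phi> a m) a m = 1"
      using a m S_idt[OF a] psh_id[OF F a m] by (simp add: cellval_def)
    then show "m \<in> lM l a" using cellchar(3)[OF v a refl m] by blast
  qed
  have "exfun Amb (\<lambda>a. {x \<otimes>\<^bsub>fob Amb a\<^esub> tval (Ext l \<phi> a m) |x m. x \<in> span D a \<and> m \<in> car (lF l) a})"
    by (rule exfun_sum(2)[OF psh_Amb F subfun_carrier[OF F] lF(2)[OF l] lM[OF l]
          subfun_span D(2) cell_phom[OF v] lM_car[OF l] meet])
  then show ?thesis
    by (rule exfun_cong) (simp add: span_insert[OF v])
qed

end

section \<open>Exactness and size of the saturated functor\<close>

context site
begin

text \<open>Each clause of exactness concerns one element, and its preimage is found in the same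
  member; the family need not be directed.\<close>

lemma exfun_UN: "(\<And>i. i \<in> C \<Longrightarrow> exfun F (Y i)) \<Longrightarrow> exfun F (\<lambda>a. \<Union>i\<in>C. Y i a)"
proof (rule exfunI, intro conjI ballI impI)
  fix a b c f g assume Y: "\<And>i. i \<in> C \<Longrightarrow> exfun F (Y i)" and q: "(a, b, c, f, g) \<in> Q"
  show "x = \<one>\<^bsub>fob F a\<^esub>" if "x \<in> (\<Union>i\<in>C. Y i a)" "fmap F a b f x = \<one>\<^bsub>fob F b\<^esub>" for x
    using exfunD(1)[OF Y q] that by blast
  show "\<exists>x\<in>\<Union>i\<in>C. Y i a. fmap F a b f x = y" if "y \<in> (\<Union>i\<in>C. Y i b)" "fmap F b c g y = \<one>\<^bsub>fob F c\<^esub>" for y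
    using exfunD(2)[OF Y q] that by blast
  show "\<exists>y\<in>\<Union>i\<in>C. Y i b. fmap F b c g y = z" if "z \<in> (\<Union>i\<in>C. Y i c)" for z
    using exfunD(3)[OF Y q] that by blast
qed

lemma exfun_trivial:
  assumes F: "psh F"
  shows "exfun F (\<lambda>a. {\<one>\<^bsub>fob F a\<^esub>})"
proof (rule exfunI)
  fix a b c f g assume "(a, b, c, f, g) \<in> Q"
  from Q_null[OF this]
  show "(\<forall>x\<in>{\<one>\<^bsub>fob F a\<^esub>}. fmap F a b f x = \<one>\<^bsub>fob F b\<^esub> \<longrightarrow> x = \<one>\<^bsub>fob F a\<^esub>) \<and>
    (\<forall>y\<in>{\<one>\<^bsub>fob F b\<^esub>}. fmap F b c g y = \<one>\<^bsub>fob F c\<^esub> \<longrightarrow> (\<exists>x\<in>{\<one>\<^bsub>fob F a\<^esub>}. fmap F a b f x = y)) \<and>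
    (\<forall>z\<in>{\<one>\<^bsub>fob F c\<^esub>}. \<exists>y\<in>{\<one>\<^bsub>fob F b\<^esub>}. fmap F b c g y = z)"
    using psh_one[OF F] by simp
qed

end

datatype ('l, 'o, 'i) term_op = Op_zero 'o | Op_add 'o | Op_ext 'l 'o 'i

context cells
begin

declare ambient_simps [simp del]

lemma span_empty: "a \<in> S \<Longrightarrow> span {} a = {\<one>\<^bsub>fob Amb a\<^esub>}"
proof -
  assume a: "a \<in> S"
  have "topcells t \<subseteq> {} \<longrightarrow> tval t = \<one>\<^bsub>fob Amb a\<^esub>" if "(a, t) \<in> terms" for a t
    using that
  proof (induction rule: terms.induct)
    case (terms_Add a s t)
    interpret A: comm_group "fob Amb a" using psh_grp[OF psh_Amb terms_S[OF terms_Add(1)]] .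
    have "tval (Add a s t) = tval s \<otimes>\<^bsub>fob Amb a\<^esub> tval t" by (simp add: tval_def ambient_simps)
    then show ?case using terms_Add by simp
  qed (simp_all add: tval_def ambient_simps)
  then show ?thesis using subfun_one[OF subfun_span a] unfolding span_def by blast
qed

text \<open>Zorn's lemma on closed sets of valid cells with exact span takes the place of a
  transfinite iteration. If a maximal set missed a valid cell, an innermost missing cell could be
  attached.\<close>

lemma exfun_span_valid: "exfun Amb (span {c. valid c})"
proof -
  define \<A> where "\<A> = {D. D \<subseteq> {c. valid c} \<and> closed D \<and> exfun Amb (span D)}"
  have "exfun Amb (span {})"
    by (rule exfun_cong[OF exfun_trivial[OF psh_Amb]]) (simp add: span_empty)
  then have "{} \<in> \<A>" by (simp add: \<A>_def closed_def)
  then have ne: "\<A> \<noteq> {}" by blast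
  have "\<Union>C \<in> \<A>" if C: "C \<noteq> {}" "subset.chain \<A> C" for C
  proof -
    have CA: "D \<in> \<A>" if "D \<in> C" for D using C(2) that by (auto simp: subset.chain_def)
    have "exfun Amb (\<lambda>a. \<Union>D\<in>C. span D a)"
      by (rule exfun_UN) (use CA in \<open>auto simp: \<A>_def\<close>)
    moreover have "span (\<Union>C) a = (\<Union>D\<in>C. span D a)" for a
    proof
      show "span (\<Union>C) a \<subseteq> (\<Union>D\<in>C. span D a)"
      proof
        fix x assume "x \<in> span (\<Union>C) a"
        then obtain t where t: "x = tval t" "(a, t) \<in> terms" "topcells t \<subseteq> \<Union>C" by (auto simp: span_def)
        \<comment> \<open>A term has finitely many top cells, so one member of the chain contains
          them all.\<close>
        obtain D where "D \<in> C" "topcells t \<subseteq> D"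
          using finite_subset_Union_chain[OF topcells_finite t(3) C] by blast
        then show "x \<in> (\<Union>D\<in>C. span D a)" using t unfolding span_def by blast
      qed
    qed (auto simp: span_def)
    ultimately have "exfun Amb (span (\<Union>C))" by (simp add: exfun_cong)
    moreover have "closed (\<Union>C)" using CA unfolding \<A>_def closed_def by fast
    ultimately show ?thesis using CA unfolding \<A>_def by blast
  qed
  from subset_Zorn_nonempty[OF ne this] obtain D where D: "D \<in> \<A>" "\<And>D'. D' \<in> \<A> \<Longrightarrow> D \<subseteq> D' \<Longrightarrow> D' = D"
    by blast
  have "{c. valid c} \<subseteq> D"
  proof (rule ccontr)
    let ?N = "{c. valid c} - D"
    assume "\<not> {c. valid c} \<subseteq> D"
    then obtain l0 \<phi>0 where "(l0, \<phi>0) \<in> ?N" by auto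
    then have "subcells (Ext l0 \<phi>0 undefined undefined) \<inter> ?N \<noteq> {}" by auto
    from minimal_cell[OF this] obtain l \<phi> where c: "(l, \<phi>) \<in> ?N" "\<And>p. subcells (\<phi> p) \<inter> ?N = {}" by blast
    then have v: "valid (l, \<phi>)" by blast
    have sub: "subcells (\<phi> p) \<subseteq> D" for p
    proof
      fix d assume d: "d \<in> subcells (\<phi> p)"
      have "valid d"
      proof (cases "p \<in> Sigma S (lM l)")
        case True
        then have "(fst p, \<phi> p) \<in> terms" using v by (auto simp: valid_def)
        then show ?thesis using subcells_valid d by blast
      next
        case False
        then have "\<phi> p = Zero undefined" using v unfolding valid_def by blast
        then show ?thesis using d by simp
      qed
      then show "d \<in> D" using c(2)[of p] d by blast
    qed
    have cD: "closed D" "exfun Amb (span D)" using D(1) by (auto simp: \<A>_def)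
    have "exfun Amb (span (insert (l, \<phi>) D))"
      by (rule exfun_span_insert[OF v cD sub]) (use c(1) in blast)
    moreover have "closed (insert (l, \<phi>) D)" using cD(1) sub unfolding closed_def by blast
    ultimately have "insert (l, \<phi>) D \<in> \<A>" using D(1) v by (auto simp: \<A>_def)
    then have "insert (l, \<phi>) D = D" using D(2) by blast
    then show False using c(1) by blast
  qed
  then have "D = {c. valid c}" using D(1) by (auto simp: \<A>_def)
  then show ?thesis using D(1) by (simp add: \<A>_def)
qed

lemma span_K: "w \<in> span D a \<Longrightarrow> snd w \<in> K a"
  using terms_pval by (auto simp: span_def tval_def)

text \<open>Terms are generated by operations whose arities are bounded by \<open>I\<close>: none,
  two, or the elements of \<open>lM l\<close> over all objects. An attaching map is recovered from
  its restriction to the arity because it is constant off its domain.\<close>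

lemma terms_lepoll:
  assumes Z: "absorbing I Z" and I: "infinite I" "S \<lesssim> I" and L: "L \<lesssim> Z"
    and lI: "\<And>l a. l \<in> L \<Longrightarrow> a \<in> S \<Longrightarrow> car (lF l) a \<subseteq> I"
  shows "terms \<lesssim> Z"
proof -
  have inf: "infinite Z" using Z by (simp add: absorbing_def)
  have IZ: "I \<lesssim> Z" using absorbing_self_lepoll[OF Z] .
  have SZ: "S \<lesssim> Z" using lepoll_trans[OF I(2) IZ] .
  define ar :: "('l, 'o, 'i) term_op \<Rightarrow> ('o \<times> 'i + bool) set" where
    "ar l = (case l of Op_zero a \<Rightarrow> {} | Op_add a \<Rightarrow> {Inr True, Inr False} | Op_ext l a m \<Rightarrow> Inl ` Sigma S (lM l))" for l
  define opn :: "('l, 'o, 'i) term_op \<Rightarrow> ('o \<times> 'i + bool \<Rightarrow> ('l, 'o, 'i) cterm) \<Rightarrow> ('l, 'o, 'i) cterm" where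
    "opn l k = (case l of Op_zero a \<Rightarrow> Zero a | Op_add a \<Rightarrow> Add a (k (Inr True)) (k (Inr False))
      | Op_ext l a m \<Rightarrow> Ext l (\<lambda>p. if p \<in> Sigma S (lM l) then k (Inl p) else Zero undefined) a m)" for l k
  have ars: "ar (Op_zero a) = {}" "ar (Op_add a) = {Inr True, Inr False}" "ar (Op_ext l a m) = Inl ` Sigma S (lM l)"
    and ops: "opn (Op_zero a) k = Zero a" "opn (Op_add a) k = Add a (k (Inr True)) (k (Inr False))"
      "opn (Op_ext l a m) k = Ext l (\<lambda>p. if p \<in> Sigma S (lM l) then k (Inl p) else Zero undefined) a m"
    for a l m k by (simp_all add: ar_def opn_def)
  define C where "C = Op_zero ` S \<union> Op_add ` S \<union> (\<lambda>(l, a, m). Op_ext l a m) ` (L \<times> S \<times> I)"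
  have C: "C \<lesssim> Z"
    unfolding C_def by (intro lepoll_Un[OF inf] lepoll_image lepoll_Times[OF inf] SZ IZ L)
  define N :: "('o \<times> 'i + bool) set" where "N = Inl ` (S \<times> I) \<union> range Inr"
  have "(UNIV :: bool set) \<lesssim> I"
    by (rule finite_lepoll_infinite[OF I(1)]) simp
  then have "N \<lesssim> I"
    unfolding N_def
    by (rule lepoll_Un[OF I(1) lepoll_image[OF lepoll_Times[OF I(1,2) lepoll_refl]] lepoll_image])
  then have N: "absorbing N Z" using absorbing_index_lepoll[OF Z] by blast
  have arN: "ar l \<subseteq> N" if "l \<in> C" for l
  proof -
    have sub: "Sigma S (lM l) \<subseteq> S \<times> I" if "l \<in> L" for l using lM_car[OF that] lI[OF that] by blast
    show ?thesis
    proof (cases l)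
      case (Op_ext l' a m)
      then have "l' \<in> L" using that by (auto simp: C_def)
      then show ?thesis using image_mono[OF sub, of l' Inl] unfolding Op_ext ars N_def by blast
    qed (auto simp: ars N_def)
  qed
  have "t \<in> closure_under C ar opn" if "(a, t) \<in> terms" for a t
    using that
  proof (induction rule: terms.induct)
    case (terms_Zero a)
    then have "Op_zero a \<in> C" by (simp add: C_def)
    then show ?case using closure_underI[of "Op_zero a" C ar undefined opn]
      by (simp add: ars ops)
  next
    case (terms_Add a s t)
    have "Op_add a \<in> C" using terms_S[OF terms_Add(1)] by (simp add: C_def)
    then show ?case
      using closure_underI[of "Op_add a" C ar "\<lambda>n. if n = Inr True then s else t" opn] terms_Add.IH
      by (simp add: ars ops)
  next
    case (terms_Ext l \<phi> a m)
    let ?k = "\<lambda>n. case n of Inl p \<Rightarrow> \<phi> p | Inr b \<Rightarrow> undefined"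
    have "m \<in> I" "a \<in> S" "l \<in> L" using terms_Ext lI by blast+
    then have "Op_ext l a m \<in> C" unfolding C_def by (intro UnI2 image_eqI[of _ _ "(l, a, m)"]) simp_all
    moreover have "?k n \<in> closure_under C ar opn" if "n \<in> ar (Op_ext l a m)" for n
      using that terms_Ext.IH by (auto simp: ars)
    ultimately have "opn (Op_ext l a m) (restrict ?k (ar (Op_ext l a m))) \<in> closure_under C ar opn"
      by (rule closure_underI)
    moreover have "(\<lambda>p. if p \<in> Sigma S (lM l) then restrict ?k (ar (Op_ext l a m)) (Inl p) else Zero undefined) = \<phi>"
    proof (rule ext)
      fix p show "(if p \<in> Sigma S (lM l) then restrict ?k (ar (Op_ext l a m)) (Inl p) else Zero undefined) = \<phi> p"
      proof (cases "p \<in> Sigma S (lM l)")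
        case True
        then show ?thesis by (simp add: ars)
      next
        case False
        then have "\<phi> p = Zero undefined" using terms_Ext.hyps(5) by blast
        then show ?thesis by (simp only: False if_False)
      qed
    qed
    ultimately show ?case by (simp add: ops)
  qed
  then have sub: "terms \<subseteq> S \<times> closure_under C ar opn" using terms_S by auto
  have "closure_under C ar opn \<lesssim> Z" by (rule closure_under_lepoll[OF N C arN])
  from lepoll_subset[OF lepoll_Times[OF inf SZ this] sub] show ?thesis .
qed

end

text \<open>\<open>rich\<close> asks that, up to isomorphism, every inclusion of exact functors of
  size at most \<open>I\<close> over \<open>K\<close> occurs as a cell. The lifting argument depends
  on this property alone, not on how cells are coded.\<close>

locale rich_cells = cells B S Q P K L lF lM lpsi
  for B :: "('o, 'm) category" and S Q and P :: "('o, 'm, 'u monoid, 'u \<Rightarrow> 'u) fctr" and K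
    and L :: "'l set" and lF :: "'l \<Rightarrow> ('o, 'm, 'i monoid, 'i \<Rightarrow> 'i) fctr"
    and lM :: "'l \<Rightarrow> 'o \<Rightarrow> 'i set" and lpsi :: "'l \<Rightarrow> 'o \<Rightarrow> 'i \<Rightarrow> 'u" +
  fixes I :: "'d set"
  assumes small_I: "small_site I"
    and rich: "\<lbrakk>psh (F :: ('o, 'm, 'u monoid, 'u \<Rightarrow> 'u) fctr); subfun F H; exfun F H; subfun F M; exfun F M; \<And>a. a \<in> S \<Longrightarrow> M a \<subseteq> H a;
      phom H F P \<theta>; \<And>a x. a \<in> S \<Longrightarrow> x \<in> H a \<Longrightarrow> \<theta> a x \<in> K a; Sigma S H \<lesssim> I\<rbrakk> \<Longrightarrow>
      \<exists>l\<in>L. \<exists>\<beta>. fiso F H \<beta> (lF l) \<and> (\<forall>a\<in>S. lM l a = \<beta> a ` M a) \<and> (\<forall>a\<in>S. \<forall>x\<in>H a. lpsi l a (\<beta> a x) = \<theta> a x)"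
begin

abbreviation Sat where "Sat \<equiv> span {c. valid c}"

text \<open>Since \<open>g'\<close> agrees with \<open>g\<close> on the intersection, the two glue to a lift on \<open>E + H\<close>.\<close>

lemma extend_lift:
  fixes F :: "('o, 'm, 'u monoid, 'u \<Rightarrow> 'u) fctr"
  assumes F: "psh F" and \<theta>: "phom (car F) F P \<theta>" "\<And>a x. a \<in> S \<Longrightarrow> x \<in> car F a \<Longrightarrow> \<theta> a x \<in> K a"
    and E: "subfun F E" and g: "phom E F Amb g" "\<And>a x. a \<in> S \<Longrightarrow> x \<in> E a \<Longrightarrow> g a x \<in> Sat a \<and> snd (g a x) = \<theta> a x"
    and H: "subfun F H" "exfun F H" "Sigma S H \<lesssim> I"
    and HE: "subfun F (\<lambda>a. H a \<inter> E a)" "exfun F (\<lambda>a. H a \<inter> E a)"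
  obtains g' where "phom H F Amb g'" "\<And>a x. a \<in> S \<Longrightarrow> x \<in> H a \<Longrightarrow> g' a x \<in> Sat a \<and> snd (g' a x) = \<theta> a x"
    "\<And>a x. a \<in> S \<Longrightarrow> x \<in> H a \<Longrightarrow> x \<in> E a \<Longrightarrow> g' a x = g a x"
proof -
  have Hc: "H a \<subseteq> car F a" if "a \<in> S" for a using subfun_car[OF H(1) that] by blast
  have \<theta>H: "phom H F P \<theta>" by (rule phom_subset[OF \<theta>(1) Hc])
  have "\<exists>l\<in>L. \<exists>\<beta>. fiso F H \<beta> (lF l) \<and> (\<forall>a\<in>S. lM l a = \<beta> a ` (H a \<inter> E a)) \<and>
      (\<forall>a\<in>S. \<forall>x\<in>H a. lpsi l a (\<beta> a x) = \<theta> a x)"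
    by (rule rich[OF F H(1,2) HE _ \<theta>H _ H(3)]) (use Hc \<theta>(2) in auto)
  then obtain l \<beta> where l: "l \<in> L" and iso: "fiso F H \<beta> (lF l)"
    and *: "\<forall>a\<in>S. lM l a = \<beta> a ` (H a \<inter> E a)" "\<forall>a\<in>S. \<forall>x\<in>H a. lpsi l a (\<beta> a x) = \<theta> a x"
    by (elim bexE exE conjE) (rule that)
  have lM': "lM l a = \<beta> a ` (H a \<inter> E a)" if "a \<in> S" for a using *(1) that by (rule bspec)
  have lp: "lpsi l a (\<beta> a x) = \<theta> a x" if "a \<in> S" "x \<in> H a" for a x using *(2) that by simp
  \<comment> \<open>The values of \<open>g\<close> on the intersection are named by chosen terms; a
    name exists because they lie in \<open>Sat\<close>.\<close>
  define \<phi> where "\<phi> p = (if p \<in> Sigma S (lM l)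
    then SOME t. (fst p, t) \<in> terms \<and> tval t = g (fst p) (inv_into (H (fst p)) (\<beta> (fst p)) (snd p))
    else Zero undefined)" for p
  have \<phi>: "(a, \<phi> (a, \<beta> a x)) \<in> terms \<and> tval (\<phi> (a, \<beta> a x)) = g a x"
    if a: "a \<in> S" and x: "x \<in> H a" "x \<in> E a" for a x
  proof -
    have ex: "\<exists>t. (a, t) \<in> terms \<and> tval t = g a x" using g(2)[OF a x(2)] unfolding span_def by fastforce
    have "(a, \<beta> a x) \<in> Sigma S (lM l)" using a x lM'[OF a] by blast
    then have "\<phi> (a, \<beta> a x) = (SOME t. (a, t) \<in> terms \<and> tval t = g a x)"
      using inv_into_f_f[OF fisoD(1)[OF iso a] x(1)] by (simp only: \<phi>_def if_True fst_conv snd_conv)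
    then show ?thesis using someI_ex[OF ex] by (simp only:)
  qed
  have v: "valid (l, \<phi>)"
    unfolding valid_def prod.case
  proof (intro conjI l)
    show "\<forall>b\<in>S. \<forall>n\<in>lM l b. (b, \<phi> (b, n)) \<in> terms" using \<phi> lM' by auto
    show "\<forall>b\<in>S. \<forall>n\<in>lM l b. pval (\<phi> (b, n)) = lpsi l b n"
    proof (intro ballI)
      fix b n assume b: "b \<in> S" and "n \<in> lM l b"
      then obtain x where x: "n = \<beta> b x" "x \<in> H b" "x \<in> E b" using lM' by auto
      have "snd (tval (\<phi> (b, n))) = \<theta> b x" using \<phi>[OF b x(2,3)] g(2)[OF b x(3)] x(1) by simp
      then show "pval (\<phi> (b, n)) = lpsi l b n" using lp[OF b x(2)] x(1) by (simp add: tval_def)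
    qed
    show "\<forall>p. p \<notin> Sigma S (lM l) \<longrightarrow> \<phi> p = Zero undefined" by (simp add: \<phi>_def)
    show "phom (lM l) (lF l) Amb (\<lambda>b n. tval (\<phi> (b, n)))"
      unfolding phom_def
    proof (intro ballI conjI)
      fix a n assume a: "a \<in> S" and "n \<in> lM l a"
      then obtain x where x: "n = \<beta> a x" "x \<in> H a" "x \<in> E a" using lM' by auto
      show "tval (\<phi> (a, n)) \<in> car Amb a" using \<phi>[OF a x(2,3)] phom_car[OF g(1) a x(3)] x(1) by simp
      show "tval (\<phi> (a, n \<otimes>\<^bsub>fob (lF l) a\<^esub> n')) = tval (\<phi> (a, n)) \<otimes>\<^bsub>fob Amb a\<^esub> tval (\<phi> (a, n'))"
        if n': "n' \<in> lM l a" for n'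
      proof -
        obtain y where y: "n' = \<beta> a y" "y \<in> H a" "y \<in> E a" using lM'[OF a] n' by auto
        show ?thesis
          using \<phi>[OF a subfun_mult[OF H(1) a x(2) y(2)] subfun_mult[OF E a x(3) y(3)]]
            \<phi>[OF a x(2,3)] \<phi>[OF a y(2,3)] phom_mult[OF g(1) a x(3) y(3)] fisoD(4)[OF iso a x(2) y(2)] x(1) y(1)
          by simp
      qed
      fix b f assume b: "b \<in> S" and f: "f \<in> arr B a b"
      show "tval (\<phi> (b, fmap (lF l) a b f n)) = fmap Amb a b f (tval (\<phi> (a, n)))"
        using \<phi>[OF b subfun_map[OF H(1) a b f x(2)] subfun_map[OF E a b f x(3)]] \<phi>[OF a x(2,3)]
          phom_nat[OF g(1) a b f x(3)] fisoD(5)[OF iso a b f x(2)] x(1) by simp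
    qed
  qed
  define g' where "g' a x = tval (Ext l \<phi> a (\<beta> a x))" for a x
  have \<beta>c: "\<beta> a x \<in> car (lF l) a" if "a \<in> S" "x \<in> H a" for a x using fisoD(2)[OF iso] that by simp
  have "phom H F Amb g'"
    unfolding phom_def g'_def
  proof (intro ballI conjI)
    fix a x assume a: "a \<in> S" and x: "x \<in> H a"
    show "tval (Ext l \<phi> a (\<beta> a x)) \<in> car Amb a" using phom_car[OF cell_phom[OF v] a \<beta>c[OF a x]] .
    show "tval (Ext l \<phi> a (\<beta> a (x \<otimes>\<^bsub>fob F a\<^esub> y))) =
        tval (Ext l \<phi> a (\<beta> a x)) \<otimes>\<^bsub>fob Amb a\<^esub> tval (Ext l \<phi> a (\<beta> a y))" if "y \<in> H a" for y
      using phom_mult[OF cell_phom[OF v] a \<beta>c[OF a x] \<beta>c[OF a that]] fisoD(4)[OF iso a x that] by simp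
    show "tval (Ext l \<phi> b (\<beta> b (fmap F a b f x))) = fmap Amb a b f (tval (Ext l \<phi> a (\<beta> a x)))"
      if "b \<in> S" "f \<in> arr B a b" for b f
      using phom_nat[OF cell_phom[OF v] a that \<beta>c[OF a x]] fisoD(5)[OF iso a that x] by simp
  qed
  moreover have "g' a x \<in> Sat a \<and> snd (g' a x) = \<theta> a x" if "a \<in> S" "x \<in> H a" for a x
  proof
    show "g' a x \<in> Sat a"
      using terms_valid[OF v that(1) \<beta>c[OF that]] v unfolding g'_def span_def
      by (intro CollectI exI[of _ "Ext l \<phi> a (\<beta> a x)"]) simp
    show "snd (g' a x) = \<theta> a x" using lp[OF that] by (simp add: g'_def tval_def)
  qed
  moreover have "g' a x = g a x" if "a \<in> S" "x \<in> H a" "x \<in> E a" for a x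
    using cell_extends[OF v that(1), of "\<beta> a x"] lM'[OF that(1)] that \<phi>[OF that] by (simp add: g'_def)
  ultimately show ?thesis using that by blast
qed

text \<open>A maximal partial lift with exact domain \<open>E\<close> is total: a missing element
  lies in a small exact \<open>H\<close> with exact intersection with \<open>E\<close>, the lift
  extends from the intersection to \<open>H\<close>, and the glued lift lives on E + H, which is
  exact again.\<close>

lemma lift_exists:
  fixes F :: "('o, 'm, 'u monoid, 'u \<Rightarrow> 'u) fctr"
  assumes F: "psh F" "exfun F (car F)" and \<theta>: "phom (car F) F P \<theta>" "\<And>a x. a \<in> S \<Longrightarrow> x \<in> car F a \<Longrightarrow> \<theta> a x \<in> K a"
  obtains g where "phom (car F) F Amb g" "\<And>a x. a \<in> S \<Longrightarrow> x \<in> car F a \<Longrightarrow> g a x \<in> Sat a \<and> snd (g a x) = \<theta> a x"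
proof -
  \<comment> \<open>Partial lifts are treated as graphs of triples (object, element, value), with
    their properties \<open>G1\<close> to \<open>G5\<close> as conditions on the graph, so that the
    upper bound of a chain is its union.\<close>
  define dm where "dm \<Gamma> a = {x. \<exists>w. (a, x, w) \<in> \<Gamma>}"
    for \<Gamma> :: "('o \<times> 'u \<times> (('l, 'o, 'i) cterm \<times> 'o \<times> 'm \<Rightarrow> complex) \<times> 'u) set" and a
  define G1 where "G1 \<Gamma> \<longleftrightarrow> (\<forall>a x w. (a, x, w) \<in> \<Gamma> \<longrightarrow> a \<in> S \<and> x \<in> car F a \<and> w \<in> Sat a \<and> snd w = \<theta> a x)"
    for \<Gamma> :: "('o \<times> 'u \<times> (('l, 'o, 'i) cterm \<times> 'o \<times> 'm \<Rightarrow> complex) \<times> 'u) set"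
  define G2 where "G2 \<Gamma> \<longleftrightarrow> (\<forall>a x w w'. (a, x, w) \<in> \<Gamma> \<longrightarrow> (a, x, w') \<in> \<Gamma> \<longrightarrow> w = w')"
    for \<Gamma> :: "('o \<times> 'u \<times> (('l, 'o, 'i) cterm \<times> 'o \<times> 'm \<Rightarrow> complex) \<times> 'u) set"
  define G3 where "G3 \<Gamma> \<longleftrightarrow> (\<forall>a x w y w'. (a, x, w) \<in> \<Gamma> \<longrightarrow> (a, y, w') \<in> \<Gamma> \<longrightarrow>
    (a, x \<otimes>\<^bsub>fob F a\<^esub> y, w \<otimes>\<^bsub>fob Amb a\<^esub> w') \<in> \<Gamma>)"
    for \<Gamma> :: "('o \<times> 'u \<times> (('l, 'o, 'i) cterm \<times> 'o \<times> 'm \<Rightarrow> complex) \<times> 'u) set"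
  define G4 where "G4 \<Gamma> \<longleftrightarrow> (\<forall>a x w b f. (a, x, w) \<in> \<Gamma> \<longrightarrow> b \<in> S \<longrightarrow> f \<in> arr B a b \<longrightarrow>
    (b, fmap F a b f x, fmap Amb a b f w) \<in> \<Gamma>)"
    for \<Gamma> :: "('o \<times> 'u \<times> (('l, 'o, 'i) cterm \<times> 'o \<times> 'm \<Rightarrow> complex) \<times> 'u) set"
  define G5 where "G5 \<Gamma> \<longleftrightarrow> (\<forall>a\<in>S. (a, \<one>\<^bsub>fob F a\<^esub>, \<one>\<^bsub>fob Amb a\<^esub>) \<in> \<Gamma>)"
    for \<Gamma> :: "('o \<times> 'u \<times> (('l, 'o, 'i) cterm \<times> 'o \<times> 'm \<Rightarrow> complex) \<times> 'u) set"
  note Gdefs = G1_def G2_def G3_def G4_def G5_def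
  define \<A> where "\<A> = {\<Gamma>. G1 \<Gamma> \<and> G2 \<Gamma> \<and> G3 \<Gamma> \<and> G4 \<Gamma> \<and> G5 \<Gamma> \<and> exfun F (dm \<Gamma>)}"
  note cF = subfun_carrier[OF F(1)]
  have ne: "\<A> \<noteq> {}"
  proof -
    define \<Gamma> where "\<Gamma> = (\<lambda>a. (a, \<one>\<^bsub>fob F a\<^esub>, \<one>\<^bsub>fob Amb a\<^esub>)) ` S"
    have mem: "(a, x, w) \<in> \<Gamma> \<longleftrightarrow> a \<in> S \<and> x = \<one>\<^bsub>fob F a\<^esub> \<and> w = \<one>\<^bsub>fob Amb a\<^esub>" for a x w
      unfolding \<Gamma>_def by blast
    have 1: "snd \<one>\<^bsub>fob Amb a\<^esub> = \<theta> a \<one>\<^bsub>fob F a\<^esub>" if "a \<in> S" for a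
      using phom_one[OF F(1) P cF \<theta>(1) that] by (simp add: ambient_simps)
    have m: "\<one>\<^bsub>fob F a\<^esub> \<otimes>\<^bsub>fob F a\<^esub> \<one>\<^bsub>fob F a\<^esub> = \<one>\<^bsub>fob F a\<^esub>"
      "\<one>\<^bsub>fob Amb a\<^esub> \<otimes>\<^bsub>fob Amb a\<^esub> \<one>\<^bsub>fob Amb a\<^esub> = \<one>\<^bsub>fob Amb a\<^esub>" if "a \<in> S" for a
      using psh_grp[OF F(1) that] psh_grp[OF psh_Amb that]
      by (simp_all add: comm_group_def monoid.l_one monoid.one_closed group.is_monoid)
    have "exfun F (dm \<Gamma>)"
      by (rule exfun_cong[OF exfun_trivial[OF F(1)]]) (unfold dm_def \<Gamma>_def image_iff, blast)
    moreover have "G1 \<Gamma>"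
      unfolding G1_def mem using 1 subfun_one[OF cF] subfun_one[OF subfun_span[of "{c. valid c}"]] by blast
    moreover have "G2 \<Gamma>" "G5 \<Gamma>" unfolding G2_def G5_def mem by blast+
    moreover have "G3 \<Gamma>" unfolding G3_def mem using m by blast
    moreover have "G4 \<Gamma>" unfolding G4_def mem using psh_one[OF F(1)] psh_one[OF psh_Amb] by blast
    ultimately have "\<Gamma> \<in> \<A>" by (simp add: \<A>_def)
    then show ?thesis by blast
  qed
  have "\<Union>C \<in> \<A>" if C: "C \<noteq> {}" "subset.chain \<A> C" for C
  proof -
    have CA: "G1 \<Gamma>" "G2 \<Gamma>" "G3 \<Gamma>" "G4 \<Gamma>" "G5 \<Gamma>" "exfun F (dm \<Gamma>)" if "\<Gamma> \<in> C" for \<Gamma>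
      using C(2) that by (auto simp: subset.chain_def \<A>_def)
    have two: "\<exists>\<Gamma>\<in>C. p \<in> \<Gamma> \<and> q \<in> \<Gamma>" if pq: "p \<in> \<Union>C" "q \<in> \<Union>C" for p q
    proof -
      obtain \<Gamma> \<Delta> where "\<Gamma> \<in> C" "p \<in> \<Gamma>" "\<Delta> \<in> C" "q \<in> \<Delta>" using pq by blast
      then show ?thesis using C(2) unfolding subset.chain_def by blast
    qed
    have "exfun F (\<lambda>a. \<Union>\<Gamma>\<in>C. dm \<Gamma> a)" by (rule exfun_UN) (rule CA(6))
    then have "exfun F (dm (\<Union>C))"
      by (rule exfun_cong) (auto simp: dm_def)
    moreover have "G1 (\<Union>C)" using CA(1) unfolding G1_def by blast
    moreover have "G2 (\<Union>C)" using CA(2) two unfolding G2_def by meson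
    moreover have "G3 (\<Union>C)" using CA(3) two unfolding G3_def by (meson UnionI)
    moreover have "G4 (\<Union>C)" using CA(4) unfolding G4_def by blast
    moreover have "G5 (\<Union>C)" using CA(5) C(1) unfolding G5_def by blast
    ultimately show ?thesis by (simp add: \<A>_def)
  qed
  from subset_Zorn_nonempty[OF ne this] obtain \<Gamma> where \<Gamma>: "\<Gamma> \<in> \<A>" "\<And>\<Delta>. \<Delta> \<in> \<A> \<Longrightarrow> \<Gamma> \<subseteq> \<Delta> \<Longrightarrow> \<Delta> = \<Gamma>"
    by blast
  then have G: "G1 \<Gamma>" "G2 \<Gamma>" "G3 \<Gamma>" "G4 \<Gamma>" "G5 \<Gamma>" and eE: "exfun F (dm \<Gamma>)" by (auto simp: \<A>_def)
  define E where "E = dm \<Gamma>"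
  define g where "g a x = (SOME w. (a, x, w) \<in> \<Gamma>)" for a x
  have gE: "(a, x, g a x) \<in> \<Gamma>" if "x \<in> E a" for a x
    using that someI_ex[of "\<lambda>w. (a, x, w) \<in> \<Gamma>"] by (auto simp: E_def dm_def g_def)
  have gw: "x \<in> E a" "g a x = w" if "(a, x, w) \<in> \<Gamma>" for a x w
  proof -
    show x: "x \<in> E a" using that unfolding E_def dm_def by blast
    show "g a x = w" using gE[OF x] that G(2) unfolding G2_def by blast
  qed
  have sE: "subfun F E"
    unfolding subfun_def
  proof (intro ballI conjI)
    fix a assume a: "a \<in> S"
    show "E a \<subseteq> car F a" using gE G(1) unfolding G1_def by blast
    show "\<one>\<^bsub>fob F a\<^esub> \<in> E a" using G(5) gw(1) a unfolding G5_def by blast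
    show "x \<otimes>\<^bsub>fob F a\<^esub> y \<in> E a" if "x \<in> E a" "y \<in> E a" for x y
      using gw(1) gE[OF that(1)] gE[OF that(2)] G(3) unfolding G3_def by blast
    show "fmap F a b f x \<in> E b" if "b \<in> S" "f \<in> arr B a b" "x \<in> E a" for b f x
      using gw(1) gE[OF that(3)] that(1,2) G(4) unfolding G4_def by blast
  qed
  have gs: "g a x \<in> Sat a \<and> snd (g a x) = \<theta> a x" if "x \<in> E a" for a x
    using gE[OF that] G(1) unfolding G1_def by blast
  have gh: "phom E F Amb g"
    unfolding phom_def
  proof (intro ballI conjI)
    fix a x assume a: "a \<in> S" and x: "x \<in> E a"
    show "g a x \<in> car Amb a" using gs[OF x] subfun_car[OF subfun_span a] by blast
    show "g a (x \<otimes>\<^bsub>fob F a\<^esub> y) = g a x \<otimes>\<^bsub>fob Amb a\<^esub> g a y" if "y \<in> E a" for y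
      using gw(2) gE[OF x] gE[OF that] G(3) unfolding G3_def by blast
    show "g b (fmap F a b f x) = fmap Amb a b f (g a x)" if "b \<in> S" "f \<in> arr B a b" for b f
      using gw(2) gE[OF x] that G(4) unfolding G4_def by blast
  qed
  have all: "x0 \<in> E a0" if a0: "a0 \<in> S" and x0: "x0 \<in> car F a0" for a0 x0
  proof (rule ccontr)
    assume x0E: "x0 \<notin> E a0"
    have gens: "{(a0, x0)} \<subseteq> Sigma S (car F)" "{(a0, x0)} \<lesssim> I"
      using a0 x0 small_I by (auto simp: small_site_def intro: finite_lepoll_infinite)
    \<comment> \<open>The hull is taken relative to \<open>E\<close>, so that its intersection with
      \<open>E\<close> is exact too; only then is the inclusion of the intersection into
      \<open>H\<close> a cell.\<close>
    obtain H where H: "x0 \<in> H a0" "subfun F H" "exfun F H" "subfun F (\<lambda>a. H a \<inter> E a)"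
      "exfun F (\<lambda>a. H a \<inter> E a)" "Sigma S H \<lesssim> I"
      by (rule exfun_hull[OF F sE eE[folded E_def] small_I gens]) blast
    obtain g' where g': "phom H F Amb g'" "\<And>a x. a \<in> S \<Longrightarrow> x \<in> H a \<Longrightarrow> g' a x \<in> Sat a \<and> snd (g' a x) = \<theta> a x"
      "\<And>a x. a \<in> S \<Longrightarrow> x \<in> H a \<Longrightarrow> x \<in> E a \<Longrightarrow> g' a x = g a x"
      using extend_lift[OF F(1) \<theta> sE gh gs H(2,3,6,4,5)] by blast
    define \<Delta> where "\<Delta> = {(a, x \<otimes>\<^bsub>fob F a\<^esub> y, g a x \<otimes>\<^bsub>fob Amb a\<^esub> g' a y) |a x y. a \<in> S \<and> x \<in> E a \<and> y \<in> H a}"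
    have Ec: "x \<in> car F a" if "a \<in> S" "x \<in> E a" for a x using subfun_car[OF sE that] .
    have Hc: "x \<in> car F a" if "a \<in> S" "x \<in> H a" for a x using subfun_car[OF H(2) that] .
    have gc: "g a x \<in> car Amb a" if "a \<in> S" "x \<in> E a" for a x using phom_car[OF gh that] .
    have g'c: "g' a x \<in> car Amb a" if "a \<in> S" "x \<in> H a" for a x using phom_car[OF g'(1) that] .
    \<comment> \<open>An instance of \<open>exfun_sum\<close> inside \<open>F\<close> itself, with
      the inclusion of \<open>H\<close> as the morphism.\<close>
    have "exfun F (\<lambda>a. {x \<otimes>\<^bsub>fob F a\<^esub> y |x y. x \<in> E a \<and> y \<in> H a})"
      by (rule exfun_sum(2)[OF F(1) F(1) H(2,3) H(4,5) sE eE[folded E_def]]) (use Hc in \<open>auto simp: phom_def\<close>)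
    then have e\<Delta>: "exfun F (dm \<Delta>)" by (rule exfun_cong) (unfold dm_def \<Delta>_def, blast)
    have "G1 \<Delta>"
      unfolding G1_def
    proof (intro allI impI)
      fix a z w assume "(a, z, w) \<in> \<Delta>"
      then obtain x y where *: "a \<in> S" "z = x \<otimes>\<^bsub>fob F a\<^esub> y" "w = g a x \<otimes>\<^bsub>fob Amb a\<^esub> g' a y" "x \<in> E a" "y \<in> H a"
        unfolding \<Delta>_def by blast
      have "snd w = \<theta> a z"
        using gs[OF *(4)] g'(2)[OF *(1,5)] phom_mult[OF \<theta>(1) *(1) Ec[OF *(1,4)] Hc[OF *(1,5)]]
        by (simp add: * ambient_simps)
      moreover have "w \<in> Sat a"
        using gs[OF *(4)] g'(2)[OF *(1,5)] subfun_mult[OF subfun_span *(1)] *(3) by blast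
      moreover have "z \<in> car F a" using subfun_mult[OF cF *(1) Ec[OF *(1,4)] Hc[OF *(1,5)]] *(2) by blast
      ultimately show "a \<in> S \<and> z \<in> car F a \<and> w \<in> Sat a \<and> snd w = \<theta> a z" using * by blast
    qed
    moreover have "G2 \<Delta>"
      unfolding G2_def
    proof (intro allI impI)
      fix a z w w' assume "(a, z, w) \<in> \<Delta>" "(a, z, w') \<in> \<Delta>"
      then obtain x y x' y' where *: "z = x \<otimes>\<^bsub>fob F a\<^esub> y" "w = g a x \<otimes>\<^bsub>fob Amb a\<^esub> g' a y" "x \<in> E a" "y \<in> H a"
        "z = x' \<otimes>\<^bsub>fob F a\<^esub> y'" "w' = g a x' \<otimes>\<^bsub>fob Amb a\<^esub> g' a y'" "x' \<in> E a" "y' \<in> H a" and a: "a \<in> S"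
        unfolding \<Delta>_def by blast
      interpret F: comm_group "fob F a" using psh_grp[OF F(1) a] .
      interpret A: comm_group "fob Amb a" using psh_grp[OF psh_Amb a] .
      note c = Ec[OF a *(3)] Hc[OF a *(4)] Ec[OF a *(7)] Hc[OF a *(8)]
      \<comment> \<open>Two decompositions of the same element differ by \<open>d\<close>, which
        lies in both \<open>H\<close> and \<open>E\<close>, where \<open>g\<close> and
        \<open>g'\<close> agree; hence the glued lift is single-valued.\<close>
      define d where "d = y' \<otimes>\<^bsub>fob F a\<^esub> inv\<^bsub>fob F a\<^esub> y"
      have dc: "d \<in> car F a" using c by (simp add: d_def)
      have dH: "d \<in> H a" unfolding d_def using subfun_mult[OF H(2) a *(8) subfun_inv[OF F(1) H(2) a *(4)]] .
      have y': "y' = d \<otimes>\<^bsub>fob F a\<^esub> y" using c by (simp add: d_def F.m_assoc)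
      have "x \<otimes>\<^bsub>fob F a\<^esub> y = (x' \<otimes>\<^bsub>fob F a\<^esub> d) \<otimes>\<^bsub>fob F a\<^esub> y"
        using *(1,5) y' c dc by (simp add: F.m_assoc)
      then have x: "x = x' \<otimes>\<^bsub>fob F a\<^esub> d" using c dc by simp
      then have "d = inv\<^bsub>fob F a\<^esub> x' \<otimes>\<^bsub>fob F a\<^esub> x" using c dc by (simp add: F.m_assoc[symmetric])
      then have dE: "d \<in> E a" using subfun_mult[OF sE a subfun_inv[OF F(1) sE a *(7)] *(3)] by simp
      have "w = (g a x' \<otimes>\<^bsub>fob Amb a\<^esub> g a d) \<otimes>\<^bsub>fob Amb a\<^esub> g' a y"
        using phom_mult[OF gh a *(7) dE] *(2) x by simp
      also have "\<dots> = g a x' \<otimes>\<^bsub>fob Amb a\<^esub> (g' a d \<otimes>\<^bsub>fob Amb a\<^esub> g' a y)"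
        using g'(3)[OF a dH dE] A.m_assoc[OF gc[OF a *(7)] gc[OF a dE] g'c[OF a *(4)]] by simp
      also have "\<dots> = w'" using phom_mult[OF g'(1) a dH *(4)] *(6) y' by simp
      finally show "w = w'" .
    qed
    moreover have "G3 \<Delta>"
      unfolding G3_def
    proof (intro allI impI)
      fix a z w z' w' assume "(a, z, w) \<in> \<Delta>" "(a, z', w') \<in> \<Delta>"
      then obtain x y x' y' where *: "z = x \<otimes>\<^bsub>fob F a\<^esub> y" "w = g a x \<otimes>\<^bsub>fob Amb a\<^esub> g' a y" "x \<in> E a" "y \<in> H a"
        "z' = x' \<otimes>\<^bsub>fob F a\<^esub> y'" "w' = g a x' \<otimes>\<^bsub>fob Amb a\<^esub> g' a y'" "x' \<in> E a" "y' \<in> H a" and a: "a \<in> S"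
        unfolding \<Delta>_def by blast
      interpret F: comm_group "fob F a" using psh_grp[OF F(1) a] .
      interpret A: comm_group "fob Amb a" using psh_grp[OF psh_Amb a] .
      have "z \<otimes>\<^bsub>fob F a\<^esub> z' = (x \<otimes>\<^bsub>fob F a\<^esub> x') \<otimes>\<^bsub>fob F a\<^esub> (y \<otimes>\<^bsub>fob F a\<^esub> y')"
        using * Ec[OF a] Hc[OF a] by (simp add: F.m_ac)
      moreover have "w \<otimes>\<^bsub>fob Amb a\<^esub> w' = g a (x \<otimes>\<^bsub>fob F a\<^esub> x') \<otimes>\<^bsub>fob Amb a\<^esub> g' a (y \<otimes>\<^bsub>fob F a\<^esub> y')"
        using * gc[OF a] g'c[OF a] phom_mult[OF gh a *(3,7)] phom_mult[OF g'(1) a *(4,8)] by (simp add: A.m_ac)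
      ultimately show "(a, z \<otimes>\<^bsub>fob F a\<^esub> z', w \<otimes>\<^bsub>fob Amb a\<^esub> w') \<in> \<Delta>"
        using subfun_mult[OF sE a *(3,7)] subfun_mult[OF H(2) a *(4,8)] a unfolding \<Delta>_def by blast
    qed
    moreover have "G4 \<Delta>"
      unfolding G4_def
    proof (intro allI impI)
      fix a z w b f assume "(a, z, w) \<in> \<Delta>" and b: "b \<in> S" and f: "f \<in> arr B a b"
      then obtain x y where *: "z = x \<otimes>\<^bsub>fob F a\<^esub> y" "w = g a x \<otimes>\<^bsub>fob Amb a\<^esub> g' a y" "x \<in> E a" "y \<in> H a" and a: "a \<in> S"
        unfolding \<Delta>_def by blast
      have "fmap F a b f z = fmap F a b f x \<otimes>\<^bsub>fob F b\<^esub> fmap F a b f y"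
        using psh_mult[OF F(1) a b f Ec[OF a *(3)] Hc[OF a *(4)]] *(1) by simp
      moreover have "fmap Amb a b f w = g b (fmap F a b f x) \<otimes>\<^bsub>fob Amb b\<^esub> g' b (fmap F a b f y)"
        using psh_mult[OF psh_Amb a b f gc[OF a *(3)] g'c[OF a *(4)]] *(2)
          phom_nat[OF gh a b f *(3)] phom_nat[OF g'(1) a b f *(4)] by simp
      ultimately show "(b, fmap F a b f z, fmap Amb a b f w) \<in> \<Delta>"
        using subfun_map[OF sE a b f *(3)] subfun_map[OF H(2) a b f *(4)] b unfolding \<Delta>_def by blast
    qed
    moreover have sub: "(a, x, w) \<in> \<Delta>" if xw: "(a, x, w) \<in> \<Gamma>" for a x w
    proof -
      have a: "a \<in> S" using xw G(1) unfolding G1_def by blast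
      interpret F: comm_group "fob F a" using psh_grp[OF F(1) a] .
      interpret A: comm_group "fob Amb a" using psh_grp[OF psh_Amb a] .
      note * = gw[OF xw]
      have "x = x \<otimes>\<^bsub>fob F a\<^esub> \<one>\<^bsub>fob F a\<^esub>" "w = g a x \<otimes>\<^bsub>fob Amb a\<^esub> g' a \<one>\<^bsub>fob F a\<^esub>"
        using Ec[OF a *(1)] gc[OF a *(1)] *(2) phom_one[OF F(1) psh_Amb H(2) g'(1) a] by simp_all
      then show ?thesis using *(1) subfun_one[OF H(2) a] a unfolding \<Delta>_def by blast
    qed
    moreover have "G5 \<Delta>" using G(5) sub unfolding G5_def by blast
    ultimately have "\<Delta> \<in> \<A>" using e\<Delta> by (simp add: \<A>_def)
    then have "\<Delta> = \<Gamma>" using \<Gamma>(2) sub by (metis subrelI prod_cases3 subsetI)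
    moreover have "(a0, x0, g a0 \<one>\<^bsub>fob F a0\<^esub> \<otimes>\<^bsub>fob Amb a0\<^esub> g' a0 x0) \<in> \<Delta>"
    proof -
      interpret F: comm_group "fob F a0" using psh_grp[OF F(1) a0] .
      have "x0 = \<one>\<^bsub>fob F a0\<^esub> \<otimes>\<^bsub>fob F a0\<^esub> x0" using x0 by simp
      then show ?thesis using subfun_one[OF sE a0] H(1) a0 unfolding \<Delta>_def by blast
    qed
    ultimately show False using gw(1) x0E by blast
  qed
  have "phom (car F) F Amb g" by (rule phom_subset[OF gh]) (use all in blast)
  then show ?thesis using that gs all by blast
qed

end

section \<open>Pseudokernels\<close>

datatype ('o, 'm, 'i) fact = Car_fact 'o 'i | Mult_fact 'o 'i 'i 'i | One_fact 'o 'i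
  | Map_fact 'o 'o 'm 'i 'i | Sub_fact 'o 'i

text \<open>A small cell is coded by the set of atomic facts that hold in it, together with its morphism to
  \<open>P\<close>, so that the number of cells is bounded by construction.\<close>

definition code_fctr :: "('o, 'm, 'i) fact set \<times> ('o \<times> 'i \<Rightarrow> 'u) \<Rightarrow> ('o, 'm, 'i monoid, 'i \<Rightarrow> 'i) fctr" where
  "code_fctr l = \<lparr>fob = (\<lambda>a. \<lparr>carrier = {x. Car_fact a x \<in> fst l}, mult = (\<lambda>x y. THE z. Mult_fact a x y z \<in> fst l),
     one = (THE x. One_fact a x \<in> fst l)\<rparr>), fmap = (\<lambda>a b f x. THE y. Map_fact a b f x y \<in> fst l)\<rparr>"

definition code_sub :: "('o, 'm, 'i) fact set \<times> ('o \<times> 'i \<Rightarrow> 'u) \<Rightarrow> 'o \<Rightarrow> 'i set" where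
  "code_sub l a = {x. Sub_fact a x \<in> fst l}"

definition code_psi :: "('o, 'm, 'i) fact set \<times> ('o \<times> 'i \<Rightarrow> 'u) \<Rightarrow> 'o \<Rightarrow> 'i \<Rightarrow> 'u" where
  "code_psi l a x = snd l (a, x)"

context site
begin

definition small_facts :: "'i set \<Rightarrow> ('o, 'm, 'i) fact set" where
  "small_facts I = (\<lambda>(a, x). Car_fact a x) ` (S \<times> I) \<union> (\<lambda>(a, x, y, z). Mult_fact a x y z) ` (S \<times> I \<times> I \<times> I) \<union>
     (\<lambda>(a, x). One_fact a x) ` (S \<times> I) \<union>
     (\<lambda>((a, b, f), x, y). Map_fact a b f x y) ` ((SIGMA a:S. SIGMA b:S. arr B a b) \<times> I \<times> I) \<union>
     (\<lambda>(a, x). Sub_fact a x) ` (S \<times> I)"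

lemma small_facts_lepoll:
  assumes "small_site I"
  shows "small_facts I \<lesssim> I"
proof -
  have "infinite I" "S \<lesssim> I" using assms by (auto simp: small_site_def)
  then show ?thesis
    unfolding small_facts_def
    by (intro lepoll_Un lepoll_image lepoll_Times small_site_arrows[OF assms] lepoll_refl)
qed

definition codes :: "'i set \<Rightarrow> ('o, 'm, 'u monoid, 'u \<Rightarrow> 'u) fctr \<Rightarrow> ('o \<Rightarrow> 'u set) \<Rightarrow>
    (('o, 'm, 'i) fact set \<times> ('o \<times> 'i \<Rightarrow> 'u)) set" where
  "codes I P K = {l \<in> Pow (small_facts I) \<times> (\<Pi>\<^sub>E p\<in>S \<times> I. insert undefined (car P (fst p))).
     psh (code_fctr l) \<and> exfun (code_fctr l) (car (code_fctr l)) \<and>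
     subfun (code_fctr l) (code_sub l) \<and> exfun (code_fctr l) (code_sub l) \<and>
     phom (car (code_fctr l)) (code_fctr l) P (code_psi l) \<and>
     (\<forall>a\<in>S. \<forall>x\<in>car (code_fctr l) a. code_psi l a x \<in> K a)}"

text \<open>Both components are exponentials with exponent at most \<open>I\<close>: sets of facts,
  of which there are at most \<open>I\<close> many, and families over S x I with values bounded by
  \<open>Z\<close>.\<close>

lemma codes_lepoll:
  assumes I: "small_site I" and Z: "absorbing I Z" and PZ: "\<And>a. a \<in> S \<Longrightarrow> car P a \<lesssim> Z"
  shows "codes I P K \<lesssim> Z"
proof -
  have inf: "infinite Z" "infinite I" "S \<lesssim> I" using Z I by (auto simp: absorbing_def small_site_def)
  have 1: "Pow (small_facts I) \<lesssim> Z"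
    by (rule absorbing_Pow_lepoll[OF absorbing_index_lepoll[OF Z small_facts_lepoll[OF I]]])
  have "insert undefined (car P (fst p)) \<lesssim> Z" if "p \<in> S \<times> I" for p
  proof -
    have "{undefined} \<union> car P (fst p) \<lesssim> Z"
      by (rule lepoll_Un[OF inf(1) finite_lepoll_infinite[OF inf(1)] PZ]) (use that in auto)
    then show ?thesis by simp
  qed
  then have 2: "(\<Pi>\<^sub>E p\<in>S \<times> I. insert undefined (car P (fst p))) \<lesssim> Z"
    by (rule absorbing_PiE_lepoll[OF absorbing_index_lepoll[OF Z lepoll_Times[OF inf(2,3) lepoll_refl]]])
  show ?thesis
    by (rule lepoll_subset[OF lepoll_Times[OF inf(1) 1 2]]) (auto simp: codes_def)
qed

text \<open>An injection of the disjoint union of the values of \<open>H\<close> into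
  \<open>I\<close> renames the elements. The operations are read back from the facts as the unique
  recorded results.\<close>

lemma codes_rich:
  fixes F :: "('o, 'm, 'x monoid, 'x \<Rightarrow> 'x) fctr" and I :: "'i set"
  assumes F: "psh F" and H: "subfun F H" "exfun F H" and M: "subfun F M" "exfun F M"
    and MH: "\<And>a. a \<in> S \<Longrightarrow> M a \<subseteq> H a" and \<theta>: "phom H F P \<theta>" "\<And>a x. a \<in> S \<Longrightarrow> x \<in> H a \<Longrightarrow> \<theta> a x \<in> K a"
    and small: "Sigma S H \<lesssim> I"
  shows "\<exists>l\<in>codes I P K. \<exists>\<beta>. fiso F H \<beta> (code_fctr l) \<and> (\<forall>a\<in>S. code_sub l a = \<beta> a ` M a) \<and>
    (\<forall>a\<in>S. \<forall>x\<in>H a. code_psi l a (\<beta> a x) = \<theta> a x)"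
proof -
  obtain h where h: "inj_on h (Sigma S H)" "h ` Sigma S H \<subseteq> I" using small unfolding lepoll_def by blast
  define \<beta> where "\<beta> a x = h (a, x)" for a x
  have \<beta>I: "\<beta> a x \<in> I" if "a \<in> S" "x \<in> H a" for a x using h(2) that by (auto simp: \<beta>_def)
  have \<beta>: "\<beta> a x = \<beta> a y \<longleftrightarrow> x = y" if "a \<in> S" "x \<in> H a" "y \<in> H a" for a x y
    using inj_on_eq_iff[OF h(1), of "(a, x)" "(a, y)"] that by (simp add: \<beta>_def)
  define A where "A = {Car_fact a (\<beta> a x) |a x. a \<in> S \<and> x \<in> H a} \<union>
    {Mult_fact a (\<beta> a x) (\<beta> a y) (\<beta> a (x \<otimes>\<^bsub>fob F a\<^esub> y)) |a x y. a \<in> S \<and> x \<in> H a \<and> y \<in> H a} \<union>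
    {One_fact a (\<beta> a \<one>\<^bsub>fob F a\<^esub>) |a. a \<in> S} \<union>
    {Map_fact a b f (\<beta> a x) (\<beta> b (fmap F a b f x)) |a b f x. a \<in> S \<and> b \<in> S \<and> f \<in> arr B a b \<and> x \<in> H a} \<union>
    {Sub_fact a (\<beta> a x) |a x. a \<in> S \<and> x \<in> M a}"
  define p where "p = (\<lambda>q\<in>S \<times> I. if snd q \<in> \<beta> (fst q) ` H (fst q)
    then \<theta> (fst q) (inv_into (H (fst q)) (\<beta> (fst q)) (snd q)) else undefined)"
  define l where "l = (A, p)"
  have mult: "(THE z. Mult_fact a (\<beta> a x) (\<beta> a y) z \<in> A) = \<beta> a (x \<otimes>\<^bsub>fob F a\<^esub> y)"
    if "a \<in> S" "x \<in> H a" "y \<in> H a" for a x y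
    using that \<beta> by (intro the_equality) (auto simp: A_def)
  have one: "(THE x. One_fact a x \<in> A) = \<beta> a \<one>\<^bsub>fob F a\<^esub>" if "a \<in> S" for a
    using that by (intro the_equality) (auto simp: A_def)
  have map: "(THE y. Map_fact a b f (\<beta> a x) y \<in> A) = \<beta> b (fmap F a b f x)"
    if "a \<in> S" "b \<in> S" "f \<in> arr B a b" "x \<in> H a" for a b f x
    using that \<beta> by (intro the_equality) (auto simp: A_def)
  have carA: "{x. Car_fact a x \<in> A} = \<beta> a ` H a" if "a \<in> S" for a
    using that by (auto simp: A_def)
  have iso: "fiso F H \<beta> (code_fctr l)"
    unfolding fiso_def using \<beta> mult one map carA by (simp add: code_fctr_def l_def inj_on_def)
  have sub: "code_sub l a = \<beta> a ` M a" if "a \<in> S" for a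
    using that by (auto simp: code_sub_def l_def A_def)
  have psi: "code_psi l a (\<beta> a x) = \<theta> a x" if "a \<in> S" "x \<in> H a" for a x
    using that \<beta>I \<beta> by (simp add: code_psi_def l_def p_def inv_into_f_f inj_on_def)
  note car = fisoD(2)[OF iso]
  have "A \<subseteq> small_facts I"
  proof
    fix t assume "t \<in> A"
    then consider a x where "t = Car_fact a (\<beta> a x)" "a \<in> S" "x \<in> H a"
      | a x y where "t = Mult_fact a (\<beta> a x) (\<beta> a y) (\<beta> a (x \<otimes>\<^bsub>fob F a\<^esub> y))" "a \<in> S" "x \<in> H a" "y \<in> H a"
      | a where "t = One_fact a (\<beta> a \<one>\<^bsub>fob F a\<^esub>)" "a \<in> S"
      | a b f x where "t = Map_fact a b f (\<beta> a x) (\<beta> b (fmap F a b f x))" "a \<in> S" "b \<in> S" "f \<in> arr B a b" "x \<in> H a"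
      | a x where "t = Sub_fact a (\<beta> a x)" "a \<in> S" "x \<in> M a"
      unfolding A_def by blast
    then show "t \<in> small_facts I"
    proof cases
      case (1 a x)
      then show ?thesis using \<beta>I unfolding small_facts_def
        by (intro UnI1 image_eqI[of _ _ "(a, \<beta> a x)"]) simp_all
    next
      case (2 a x y)
      then show ?thesis using \<beta>I subfun_mult[OF H(1)] unfolding small_facts_def
        by (intro UnI1[of _ _ "_ ` (S \<times> I)"] UnI1[of _ _ "_ ` (_ \<times> I \<times> I)"] UnI2
            image_eqI[of _ _ "(a, \<beta> a x, \<beta> a y, \<beta> a (x \<otimes>\<^bsub>fob F a\<^esub> y))"]) simp_all
    next
      case (3 a)
      then show ?thesis using \<beta>I subfun_one[OF H(1)] unfolding small_facts_def by blast
    next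
      case (4 a b f x)
      then have "((a, b, f), \<beta> a x, \<beta> b (fmap F a b f x)) \<in> (SIGMA a:S. SIGMA b:S. arr B a b) \<times> I \<times> I"
        using \<beta>I subfun_map[OF H(1)] by simp
      then show ?thesis unfolding 4(1) small_facts_def by (intro UnI1 UnI2) (rule image_eqI[rotated], assumption, simp)
    next
      case (5 a x)
      then show ?thesis using \<beta>I MH unfolding small_facts_def by blast
    qed
  qed
  moreover have "p \<in> (\<Pi>\<^sub>E q\<in>S \<times> I. insert undefined (car P (fst q)))"
    unfolding p_def
  proof (rule restrict_PiE[THEN iffD2], rule Pi_I)
    fix q assume q: "q \<in> S \<times> I"
    show "(if snd q \<in> \<beta> (fst q) ` H (fst q) then \<theta> (fst q) (inv_into (H (fst q)) (\<beta> (fst q)) (snd q))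
        else undefined) \<in> insert undefined (car P (fst q))"
      using phom_car[OF \<theta>(1), of "fst q"] inv_into_into[of "snd q" "\<beta> (fst q)" "H (fst q)"] q by auto
  qed
  moreover have "exfun (code_fctr l) (car (code_fctr l))"
    by (rule exfun_cong[OF exfun_fiso[OF H(1) iso H(2)]]) (use car in auto)
  moreover have "subfun (code_fctr l) (code_sub l)"
    using subfun_fiso[OF H(1) iso M(1) MH] sub unfolding subfun_def by simp
  moreover have "exfun (code_fctr l) (code_sub l)"
    by (rule exfun_cong[OF exfun_fiso[OF H(1) iso M(2) MH]]) (use sub in auto)
  moreover have "phom (car (code_fctr l)) (code_fctr l) P (code_psi l)"
    unfolding phom_def
  proof (intro ballI conjI)
    fix a z assume a: "a \<in> S" and "z \<in> car (code_fctr l) a"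
    then obtain x where x: "z = \<beta> a x" "x \<in> H a" using car by auto
    show "code_psi l a z \<in> car P a" using psi[OF a x(2)] phom_car[OF \<theta>(1) a x(2)] x(1) by simp
    show "code_psi l a (z \<otimes>\<^bsub>fob (code_fctr l) a\<^esub> z') = code_psi l a z \<otimes>\<^bsub>fob P a\<^esub> code_psi l a z'"
      if z': "z' \<in> car (code_fctr l) a" for z'
    proof -
      obtain y where y: "z' = \<beta> a y" "y \<in> H a" using z' a car by auto
      show ?thesis
        using fisoD(4)[OF iso a x(2) y(2)] psi[OF a subfun_mult[OF H(1) a x(2) y(2)]]
          phom_mult[OF \<theta>(1) a x(2) y(2)] psi[OF a x(2)] psi[OF a y(2)] x(1) y(1) by simp
    qed
    fix b f assume b: "b \<in> S" and f: "f \<in> arr B a b"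
    show "code_psi l b (fmap (code_fctr l) a b f z) = fmap P a b f (code_psi l a z)"
      using fisoD(5)[OF iso a b f x(2)] psi[OF b subfun_map[OF H(1) a b f x(2)]]
        phom_nat[OF \<theta>(1) a b f x(2)] psi[OF a x(2)] x(1) by simp
  qed
  moreover have "\<forall>a\<in>S. \<forall>x\<in>car (code_fctr l) a. code_psi l a x \<in> K a"
    using car psi \<theta>(2) by auto
  ultimately have "l \<in> codes I P K"
    using psh_fiso[OF F H(1) iso] by (simp add: codes_def l_def)
  then show ?thesis using iso sub psi by blast
qed

end

context skeleton
begin

text \<open>A morphism killed by \<theta> is one with values in the pointwise kernel
  \<open>K\<close>. The saturated functor over \<open>K\<close> is exact and small, and every
  morphism from an exact functor into \<open>K\<close> lifts to it. The lift depends on choices, so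
  the factorization is not claimed to be unique.\<close>

lemma Exc_pseudokernels: "has_pseudokernels Exc"
  unfolding has_pseudokernels_def
proof (intro ballI)
  fix F G \<theta> assume F: "F \<in> obj Exc" and G: "G \<in> obj Exc" and \<theta>: "\<theta> \<in> arr Exc F G"
  note pF = Exc_S[OF F] and pG = Exc_S[OF G] and h = Exc_arr_S[OF F G \<theta>]
  define K where "K s = {x \<in> car F s. \<theta> s x = \<one>\<^bsub>fob G s\<^esub>}" for s
  have K: "subfun F K"
    unfolding subfun_def
  proof (intro ballI conjI)
    fix a assume a: "a \<in> S"
    interpret F: comm_group "fob F a" using psh_grp[OF pF(1) a] .
    interpret G: comm_group "fob G a" using psh_grp[OF pG(1) a] .
    show "K a \<subseteq> car F a" by (auto simp: K_def)
    show "\<one>\<^bsub>fob F a\<^esub> \<in> K a" using phom_one[OF pF(1) pG(1) pF(3) h a] by (simp add: K_def)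
    show "x \<otimes>\<^bsub>fob F a\<^esub> y \<in> K a" if "x \<in> K a" "y \<in> K a" for x y
      using that phom_mult[OF h a] by (simp add: K_def)
    show "fmap F a b f x \<in> K b" if "b \<in> S" "f \<in> arr B a b" "x \<in> K a" for b f x
      using that psh_map[OF pF(1) a that(1,2)] phom_nat[OF h a that(1,2)] psh_one[OF pG(1) a that(1,2)]
      by (simp add: K_def)
  qed
  \<comment> \<open>The cells are codes with carriers inside \<open>I\<close>, so their number is
    bounded by a member of \<open>U\<close> although every small extension problem over
    \<open>K\<close> is represented.\<close>
  interpret rich_cells B S "exact_seqs B S" F K "codes I F K" code_fctr code_sub code_psi I
  proof (unfold_locales, rule pF(1), rule K)
    fix l assume "l \<in> codes I F K"
    then show "psh (code_fctr l)" "exfun (code_fctr l) (car (code_fctr l))"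
      "subfun (code_fctr l) (code_sub l)" "exfun (code_fctr l) (code_sub l)"
      "phom (car (code_fctr l)) (code_fctr l) F (code_psi l)"
      by (simp_all add: codes_def)
  next
    fix l a m assume "l \<in> codes I F K" "a \<in> S" "m \<in> car (code_fctr l) a"
    then show "code_psi l a m \<in> K a" by (simp add: codes_def)
  qed (rule small_site_I, rule codes_rich)
  obtain Z where Z: "Z \<in> U" "absorbing I Z" and FZ: "\<And>s. s \<in> S \<Longrightarrow> car F s \<lesssim> Z"
    using universe_family_bound[OF universe S_small, of "car F"] Exc_U[OF F SO] by blast
  have inf: "infinite I" using universe by (simp add: universe_def)
  have "car (code_fctr l) a \<subseteq> I" if "l \<in> codes I F K" for l a
    using that by (auto simp: codes_def code_fctr_def small_facts_def)
  then have tZ: "terms \<lesssim> Z"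
    using terms_lepoll[OF Z(2) inf S_small codes_lepoll[OF small_site_I Z(2) FZ]] by blast
  have small: "\<exists>Z\<in>U. Sat s \<lesssim> Z" for s
  proof -
    have "Sat s \<subseteq> (tval \<circ> snd) ` terms" by (force simp: span_def)
    then show ?thesis using lepoll_subset[OF lepoll_image[OF tZ]] Z(1) by blast
  qed
  define \<xi> where "\<xi> s w = snd w" for s :: 'o and w :: "((('o, 'm, 'i) fact set \<times> ('o \<times> 'i \<Rightarrow> 'u), 'o, 'i) cterm \<times> 'o \<times> 'm \<Rightarrow> complex) \<times> 'u"
  have \<xi>: "phom Sat Amb F \<xi>"
    using subfun_car[OF subfun_span] unfolding phom_def by (auto simp: \<xi>_def ambient_simps)
  have \<theta>\<xi>: "\<theta> s (\<xi> s w) = \<one>\<^bsub>fob G s\<^esub>" if "w \<in> Sat s" for s w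
    using span_K[OF that] by (simp add: \<xi>_def K_def)
  obtain Y inA outA where "realization B S r e e' I U Amb Sat Y inA outA"
    by (rule realize[OF psh_Amb subfun_span exfun_span_valid small])
  then interpret R: realization B S r e e' I U Amb Sat Y inA outA .
  have "pseudokernel_of Exc F G \<theta> Y (outA F \<xi>)"
    unfolding pseudokernel_of_def
  proof (intro conjI ballI impI R.real_obj R.out_arr[OF F \<xi>] R.zero_out[OF F G \<xi> \<theta> \<theta>\<xi>])
    fix H \<eta> assume H: "H \<in> obj Exc" and \<eta>: "\<eta> \<in> arr Exc H F" and 0: "cmp Exc H F G \<theta> \<eta> = zero_arr Exc H G"
    note pH = Exc_S[OF H] and h\<eta> = Exc_arr_S[OF H F \<eta>]
    have "\<eta> s x \<in> K s" if s: "s \<in> S" and x: "x \<in> car H s" for s x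
      using phom_car[OF h\<eta> s x] Exc_cmp_app[OF SO[OF s] x, of F G \<theta> \<eta>] Exc_zero_app[OF SO[OF s] x, of G] 0
      by (simp add: K_def)
    from lift_exists[OF pH(1,2) h\<eta> this] obtain g where g: "phom (car H) H Amb g"
      "\<And>s x. s \<in> S \<Longrightarrow> x \<in> car H s \<Longrightarrow> g s x \<in> Sat s \<and> snd (g s x) = \<eta> s x" by blast
    then have "inA H g \<in> arr Exc H Y" "cmp Exc H Y F (outA F \<xi>) (inA H g) = \<eta>"
      by (auto intro!: R.in_arr[OF H] R.out_in[OF H F _ _ \<xi> \<eta>] simp: \<xi>_def)
    then show "\<exists>u. u \<in> arr Exc H Y \<and> cmp Exc H Y F (outA F \<xi>) u = \<eta>" by blast
  qed
  then show "\<exists>Y k. pseudokernel_of Exc F G \<theta> Y k" by blast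
qed

end

section \<open>Transfer along an equivalence\<close>

text \<open>The three properties speak of composition, identities and zero arrows only. This common
  structure suffices to carry them across an equivalence and spares a study of the addition in
  \<open>Exc\<close>.\<close>

locale zero_category =
  fixes D :: "('p, 'n) category"
  assumes cat_idt: "a \<in> obj D \<Longrightarrow> idt D a \<in> arr D a a"
    and cat_cmp: "\<lbrakk>a \<in> obj D; b \<in> obj D; c \<in> obj D; f \<in> arr D a b; g \<in> arr D b c\<rbrakk> \<Longrightarrow> cmp D a b c g f \<in> arr D a c"
    and cat_idr: "\<lbrakk>a \<in> obj D; b \<in> obj D; f \<in> arr D a b\<rbrakk> \<Longrightarrow> cmp D a a b f (idt D a) = f"
    and cat_idl: "\<lbrakk>a \<in> obj D; b \<in> obj D; f \<in> arr D a b\<rbrakk> \<Longrightarrow> cmp D a b b (idt D b) f = f"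
    and cat_assoc: "\<lbrakk>a \<in> obj D; b \<in> obj D; c \<in> obj D; d \<in> obj D; f \<in> arr D a b; g \<in> arr D b c; h \<in> arr D c d\<rbrakk>
      \<Longrightarrow> cmp D a b d (cmp D b c d h g) f = cmp D a c d h (cmp D a b c g f)"
    and cat_zero: "\<lbrakk>a \<in> obj D; b \<in> obj D\<rbrakk> \<Longrightarrow> zero_arr D a b \<in> arr D a b"
    and cat_zero_left: "\<lbrakk>a \<in> obj D; b \<in> obj D; c \<in> obj D; f \<in> arr D a b\<rbrakk> \<Longrightarrow>
      cmp D a b c (zero_arr D b c) f = zero_arr D a c"
    and cat_zero_right: "\<lbrakk>a \<in> obj D; b \<in> obj D; c \<in> obj D; g \<in> arr D b c\<rbrakk> \<Longrightarrow>
      cmp D a b c g (zero_arr D a b) = zero_arr D a c"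

lemma (in preadditive_category) zero_category: "zero_category C"
  by unfold_locales
    (simp_all add: idt_closed cmp_closed cmp_idt_left cmp_idt_right cmp_assoc zero_closed cmp_zero_left cmp_zero_right)

lemma (in skeleton) zero_category_Exc: "zero_category Exc"
proof
  fix F G H assume F: "F \<in> obj Exc" and G: "G \<in> obj Exc"
  note cl = Exc_cmp_closed and z = Exc_zero_closed
  show "zero_arr Exc F G \<in> arr Exc F G" by (rule z[OF F G])
  show "cmp Exc F F G \<eta> (idt Exc F) = \<eta>" if \<eta>: "\<eta> \<in> arr Exc F G" for \<eta>
    by (rule Exc_eqI[OF F G cl[OF F F G Exc_idt_closed[OF F] \<eta>] \<eta>]) (simp add: Exc_cmp_app Exc_idt_app)
  show "cmp Exc F G G (idt Exc G) \<eta> = \<eta>" if \<eta>: "\<eta> \<in> arr Exc F G" for \<eta>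
    by (rule Exc_eqI[OF F G cl[OF F G G \<eta> Exc_idt_closed[OF G]] \<eta>])
      (simp add: Exc_cmp_app Exc_idt_app full.phom_car[OF Exc_arrD[OF F G \<eta>]])
  assume H: "H \<in> obj Exc"
  show "cmp Exc F G H (zero_arr Exc G H) \<eta> = zero_arr Exc F H" if \<eta>: "\<eta> \<in> arr Exc F G" for \<eta>
    by (rule Exc_eqI[OF F H cl[OF F G H \<eta> z[OF G H]] z[OF F H]])
      (simp add: Exc_cmp_app Exc_zero_app full.phom_car[OF Exc_arrD[OF F G \<eta>]])
  show "cmp Exc F G H \<theta> (zero_arr Exc F G) = zero_arr Exc F H" if \<theta>: "\<theta> \<in> arr Exc G H" for \<theta>
    by (rule Exc_eqI[OF F H cl[OF F G H z[OF F G] \<theta>] z[OF F H]])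
      (simp add: Exc_cmp_app Exc_zero_app
        full.phom_one[OF Exc_psh[OF G] Exc_psh[OF H] full.subfun_carrier[OF Exc_psh[OF G]] Exc_arrD[OF G H \<theta>]])
  fix J \<eta> \<theta> \<kappa> assume J: "J \<in> obj Exc" and \<eta>: "\<eta> \<in> arr Exc F G" and \<theta>: "\<theta> \<in> arr Exc G H" and \<kappa>: "\<kappa> \<in> arr Exc H J"
  show "cmp Exc F G J (cmp Exc G H J \<kappa> \<theta>) \<eta> = cmp Exc F H J \<kappa> (cmp Exc F G H \<theta> \<eta>)"
    by (rule Exc_eqI[OF F J cl[OF F G J \<eta> cl[OF G H J \<theta> \<kappa>]] cl[OF F H J cl[OF F G H \<eta> \<theta>] \<kappa>]])
      (simp add: Exc_cmp_app full.phom_car[OF Exc_arrD[OF F G \<eta>]])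
qed (fact Exc_idt_closed Exc_cmp_closed)+

text \<open>An equivalence consists of plain functors, so preservation of zero arrows has to be
  derived. It comes from the zero object \<open>z\<close>: zero arrows factor through
  \<open>z\<close> in \<open>C\<close>, and through F z in \<open>D\<close>.\<close>

locale category_equivalence = C: zero_category C + D: zero_category D
  for C :: "('o, 'm) category" and D :: "('p, 'n) category" +
  fixes F :: "('o, 'm, 'p, 'n) fctr" and G :: "('p, 'n, 'o, 'm) fctr"
    and \<eta> \<eta>' :: "'o \<Rightarrow> 'm" and \<epsilon> \<epsilon>' :: "'p \<Rightarrow> 'n" and z :: 'o
  assumes F: "is_functor C D F" and G: "is_functor D C G"
    and zero: "zero_object C z"
    and eta: "a \<in> obj C \<Longrightarrow> \<eta> a \<in> arr C (fob G (fob F a)) a"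
    and eta': "a \<in> obj C \<Longrightarrow> \<eta>' a \<in> arr C a (fob G (fob F a))"
    and eta_eta': "a \<in> obj C \<Longrightarrow> cmp C a (fob G (fob F a)) a (\<eta> a) (\<eta>' a) = idt C a"
    and eta'_eta: "a \<in> obj C \<Longrightarrow> cmp C (fob G (fob F a)) a (fob G (fob F a)) (\<eta>' a) (\<eta> a) = idt C (fob G (fob F a))"
    and eta_nat: "a \<in> obj C \<Longrightarrow> b \<in> obj C \<Longrightarrow> f \<in> arr C a b \<Longrightarrow>
      cmp C (fob G (fob F a)) (fob G (fob F b)) b (\<eta> b) (fmap G (fob F a) (fob F b) (fmap F a b f)) =
      cmp C (fob G (fob F a)) a b f (\<eta> a)"
    and eps: "x \<in> obj D \<Longrightarrow> \<epsilon> x \<in> arr D (fob F (fob G x)) x"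
    and eps': "x \<in> obj D \<Longrightarrow> \<epsilon>' x \<in> arr D x (fob F (fob G x))"
    and eps_eps': "x \<in> obj D \<Longrightarrow> cmp D x (fob F (fob G x)) x (\<epsilon> x) (\<epsilon>' x) = idt D x"
    and eps_nat: "x \<in> obj D \<Longrightarrow> y \<in> obj D \<Longrightarrow> g \<in> arr D x y \<Longrightarrow>
      cmp D (fob F (fob G x)) (fob F (fob G y)) y (\<epsilon> y) (fmap F (fob G x) (fob G y) (fmap G x y g)) =
      cmp D (fob F (fob G x)) x y g (\<epsilon> x)"
begin

lemma Fo: "a \<in> obj C \<Longrightarrow> fob F a \<in> obj D" and Go: "x \<in> obj D \<Longrightarrow> fob G x \<in> obj C"
  and Fa: "a \<in> obj C \<Longrightarrow> b \<in> obj C \<Longrightarrow> f \<in> arr C a b \<Longrightarrow> fmap F a b f \<in> arr D (fob F a) (fob F b)"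
  and Ga: "x \<in> obj D \<Longrightarrow> y \<in> obj D \<Longrightarrow> g \<in> arr D x y \<Longrightarrow> fmap G x y g \<in> arr C (fob G x) (fob G y)"
  and Fi: "a \<in> obj C \<Longrightarrow> fmap F a a (idt C a) = idt D (fob F a)"
  and Gi: "x \<in> obj D \<Longrightarrow> fmap G x x (idt D x) = idt C (fob G x)"
  and Fc: "a \<in> obj C \<Longrightarrow> b \<in> obj C \<Longrightarrow> c \<in> obj C \<Longrightarrow> f \<in> arr C a b \<Longrightarrow> f' \<in> arr C b c \<Longrightarrow>
    fmap F a c (cmp C a b c f' f) = cmp D (fob F a) (fob F b) (fob F c) (fmap F b c f') (fmap F a b f)"
  and Gc: "x \<in> obj D \<Longrightarrow> y \<in> obj D \<Longrightarrow> w \<in> obj D \<Longrightarrow> g \<in> arr D x y \<Longrightarrow> g' \<in> arr D y w \<Longrightarrow>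
    fmap G x w (cmp D x y w g' g) = cmp C (fob G x) (fob G y) (fob G w) (fmap G y w g') (fmap G x y g)"
  using F G by (simp_all add: is_functor_def)

lemmas closed = Fo Go Fa Ga eta eta' C.cat_cmp C.cat_idt C.cat_zero D.cat_cmp D.cat_idt D.cat_zero

lemma eta_cancel:
  assumes "a \<in> obj C" "y \<in> obj C"
  shows "f \<in> arr C y a \<Longrightarrow> cmp C y (fob G (fob F a)) a (\<eta> a) (cmp C y a (fob G (fob F a)) (\<eta>' a) f) = f"
    and "f \<in> arr C y (fob G (fob F a)) \<Longrightarrow>
      cmp C y a (fob G (fob F a)) (\<eta>' a) (cmp C y (fob G (fob F a)) a (\<eta> a) f) = f"
proof -
  show "cmp C y (fob G (fob F a)) a (\<eta> a) (cmp C y a (fob G (fob F a)) (\<eta>' a) f) = f" if "f \<in> arr C y a"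
    using C.cat_assoc[of y a "fob G (fob F a)" a f "\<eta>' a" "\<eta> a"] assms that by (simp add: closed eta_eta' C.cat_idl)
  show "cmp C y a (fob G (fob F a)) (\<eta>' a) (cmp C y (fob G (fob F a)) a (\<eta> a) f) = f"
    if "f \<in> arr C y (fob G (fob F a))"
    using C.cat_assoc[of y "fob G (fob F a)" a "fob G (fob F a)" f "\<eta> a" "\<eta>' a"] assms that
    by (simp add: closed eta'_eta C.cat_idl)
qed

text \<open>An arrow is recovered from its image under F and G by conjugation with \<eta>; each of
  the three transfers uses this to check its factorization.\<close>

lemma eta_conj:
  assumes "a \<in> obj C" "b \<in> obj C" "f \<in> arr C a b"
  shows "cmp C a (fob G (fob F b)) b (\<eta> b)
    (cmp C a (fob G (fob F a)) (fob G (fob F b)) (fmap G (fob F a) (fob F b) (fmap F a b f)) (\<eta>' a)) = f"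
proof -
  have "cmp C a (fob G (fob F a)) b (cmp C (fob G (fob F a)) (fob G (fob F b)) b (\<eta> b)
      (fmap G (fob F a) (fob F b) (fmap F a b f))) (\<eta>' a) = f"
    unfolding eta_nat[OF assms] using assms by (simp add: C.cat_assoc closed eta_eta' C.cat_idr)
  then show ?thesis using assms by (simp add: C.cat_assoc closed)
qed

lemma eta'_nat:
  assumes "a \<in> obj C" "b \<in> obj C" "f \<in> arr C a b"
  shows "cmp C a (fob G (fob F a)) (fob G (fob F b)) (fmap G (fob F a) (fob F b) (fmap F a b f)) (\<eta>' a) =
    cmp C a b (fob G (fob F b)) (\<eta>' b) f"
  using arg_cong[OF eta_conj[OF assms], of "cmp C a b (fob G (fob F b)) (\<eta>' b)"] assms
  by (simp add: eta_cancel closed)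

lemma z: "z \<in> obj C"
  using zero by (simp add: zero_object_def)

lemma into_zero: "a \<in> obj C \<Longrightarrow> f \<in> arr C a z \<Longrightarrow> f = zero_arr C a z"
  using zero z C.cat_zero unfolding zero_object_def by blast

lemma into_GFz: "y \<in> obj C \<Longrightarrow> f \<in> arr C y (fob G (fob F z)) \<Longrightarrow> f = zero_arr C y (fob G (fob F z))"
  using eta_cancel(2)[of z y f] into_zero[of y "cmp C y (fob G (fob F z)) z (\<eta> z) f"]
  by (metis C.cat_cmp C.cat_zero_right Fo Go eta eta' z)

text \<open>By naturality of \<epsilon>, an arrow f is determined by G f. Since G (F z) is
  isomorphic to \<open>z\<close> and so receives only zero arrows, f and the zero arrow have the
  same image under G.\<close>

lemma into_Fz:
  assumes x: "x \<in> obj D" and f: "f \<in> arr D x (fob F z)"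
  shows "f = zero_arr D x (fob F z)"
proof -
  have key: "f = cmp D x (fob F (fob G (fob F z))) (fob F z) (\<epsilon> (fob F z))
      (cmp D x (fob F (fob G x)) (fob F (fob G (fob F z))) (fmap F (fob G x) (fob G (fob F z)) (fmap G x (fob F z) f)) (\<epsilon>' x))"
    if "f \<in> arr D x (fob F z)" for f
  proof -
    have o: "fob F z \<in> obj D" "fob F (fob G x) \<in> obj D" "fob F (fob G (fob F z)) \<in> obj D" using x z closed by simp_all
    have ar: "fmap F (fob G x) (fob G (fob F z)) (fmap G x (fob F z) f) \<in> arr D (fob F (fob G x)) (fob F (fob G (fob F z)))"
      using that x o z by (simp add: closed)
    have "cmp D x (fob F (fob G x)) (fob F z) (cmp D (fob F (fob G x)) x (fob F z) f (\<epsilon> x)) (\<epsilon>' x) = f"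
      using D.cat_assoc[OF x o(2) x o(1) eps'[OF x] eps[OF x] that] that x o by (simp add: eps_eps' D.cat_idr)
    then show ?thesis
      using eps_nat[OF x o(1) that] D.cat_assoc[OF x o(2,3,1) eps'[OF x] ar eps[OF o(1)]] by simp
  qed
  have "fmap G x (fob F z) g = zero_arr C (fob G x) (fob G (fob F z))" if "g \<in> arr D x (fob F z)" for g
    using into_GFz[of "fob G x"] that x z by (simp add: closed)
  then show ?thesis
    using key[OF f] key[OF D.cat_zero[OF x Fo[OF z]]] f D.cat_zero[OF x Fo[OF z]] by simp
qed

lemma F_zero:
  assumes "a \<in> obj C" "b \<in> obj C"
  shows "fmap F a b (zero_arr C a b) = zero_arr D (fob F a) (fob F b)"
proof -
  have "zero_arr C a b = cmp C a z b (zero_arr C z b) (zero_arr C a z)"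
    using assms z by (simp add: C.cat_zero_left closed)
  then show ?thesis
    using assms z into_Fz[of "fob F a" "fmap F a z (zero_arr C a z)"] by (simp add: Fc closed D.cat_zero_right)
qed

lemma G_zero:
  assumes "x \<in> obj D" "y \<in> obj D"
  shows "fmap G x y (zero_arr D x y) = zero_arr C (fob G x) (fob G y)"
proof -
  have "zero_arr D x y = cmp D x (fob F z) y (zero_arr D (fob F z) y) (zero_arr D x (fob F z))"
    using assms z by (simp add: D.cat_zero_left closed)
  then show ?thesis
    using assms z into_GFz[of "fob G x" "fmap G x (fob F z) (zero_arr D x (fob F z))"]
    by (simp add: Gc closed C.cat_zero_right)
qed

lemma transfer_split_idempotents:
  assumes "has_split_idempotents D"
  shows "has_split_idempotents C"
  unfolding has_split_idempotents_def
proof (intro ballI impI)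
  fix a e assume a: "a \<in> obj C" and e: "e \<in> arr C a a" and ee: "cmp C a a a e e = e"
  have "cmp D (fob F a) (fob F a) (fob F a) (fmap F a a e) (fmap F a a e) = fmap F a a e"
    using Fc[OF a a a e e] ee by simp
  then obtain x p i where x: "x \<in> obj D" and p: "p \<in> arr D (fob F a) x" and i: "i \<in> arr D x (fob F a)"
    and ip: "cmp D (fob F a) x (fob F a) i p = fmap F a a e" and pi: "cmp D x (fob F a) x p i = idt D x"
    using assms Fo[OF a] Fa[OF a a e] unfolding has_split_idempotents_def by meson
  let ?p = "cmp C a (fob G (fob F a)) (fob G x) (fmap G (fob F a) x p) (\<eta>' a)"
  let ?i = "cmp C (fob G x) (fob G (fob F a)) a (\<eta> a) (fmap G x (fob F a) i)"
  have "cmp C a (fob G x) a ?i ?p = cmp C a (fob G (fob F a)) a (\<eta> a)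
      (cmp C a (fob G (fob F a)) (fob G (fob F a)) (fmap G (fob F a) (fob F a) (fmap F a a e)) (\<eta>' a))"
    using a x p i by (simp add: C.cat_assoc closed Gc flip: ip)
  then have "cmp C a (fob G x) a ?i ?p = e" using eta_conj[OF a a e] by simp
  moreover have "cmp C (fob G x) a (fob G x) ?p ?i = fmap G x x (cmp D x (fob F a) x p i)"
    using a x p i by (simp add: C.cat_assoc closed Gc eta_cancel)
  ultimately show "\<exists>b\<in>obj C. \<exists>p\<in>arr C a b. \<exists>i\<in>arr C b a. cmp C a b a i p = e \<and> cmp C b a b p i = idt C b"
    using a x p i by (intro bexI[of _ "fob G x"] bexI[of _ ?p] bexI[of _ ?i]) (simp_all add: pi Gi closed)
qed

text \<open>A test arrow is sent to \<open>D\<close> by F and factored there; the factor returns by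
  G, with \<eta> and \<eta>' repairing the end points.\<close>

lemma transfer_pseudokernels:
  assumes "has_pseudokernels D"
  shows "has_pseudokernels C"
  unfolding has_pseudokernels_def
proof (intro ballI)
  fix a b f assume a: "a \<in> obj C" and b: "b \<in> obj C" and f: "f \<in> arr C a b"
  obtain x k where "pseudokernel_of D (fob F a) (fob F b) (fmap F a b f) x k"
    using assms Fo[OF a] Fo[OF b] Fa[OF a b f] unfolding has_pseudokernels_def by blast
  then have x: "x \<in> obj D" and k: "k \<in> arr D x (fob F a)"
    and 0: "cmp D x (fob F a) (fob F b) (fmap F a b f) k = zero_arr D x (fob F b)"
    and fac: "\<And>y h. y \<in> obj D \<Longrightarrow> h \<in> arr D y (fob F a) \<Longrightarrow>
      cmp D y (fob F a) (fob F b) (fmap F a b f) h = zero_arr D y (fob F b) \<Longrightarrow>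
      \<exists>u. u \<in> arr D y x \<and> cmp D y x (fob F a) k u = h"
    unfolding pseudokernel_of_def by auto
  let ?k = "cmp C (fob G x) (fob G (fob F a)) a (\<eta> a) (fmap G x (fob F a) k)"
  have "pseudokernel_of C a b f (fob G x) ?k"
    unfolding pseudokernel_of_def
  proof (intro conjI ballI impI)
    show "fob G x \<in> obj C" "?k \<in> arr C (fob G x) a" using a x k by (simp_all add: closed)
    have "cmp C (fob G x) a b f ?k =
        cmp C (fob G x) (fob G (fob F a)) b (cmp C (fob G (fob F a)) a b f (\<eta> a)) (fmap G x (fob F a) k)"
      using a b x k f by (simp add: C.cat_assoc closed)
    also have "\<dots> = cmp C (fob G x) (fob G (fob F b)) b (\<eta> b)
        (fmap G x (fob F b) (cmp D x (fob F a) (fob F b) (fmap F a b f) k))"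
      unfolding eta_nat[OF a b f, symmetric] using a b x k f by (simp add: C.cat_assoc closed Gc)
    also have "\<dots> = zero_arr C (fob G x) b"
      unfolding 0 using a b x by (simp add: G_zero closed C.cat_zero_right)
    finally show "cmp C (fob G x) a b f ?k = zero_arr C (fob G x) b" .
    fix y h assume y: "y \<in> obj C" and h: "h \<in> arr C y a" and fh: "cmp C y a b f h = zero_arr C y b"
    have "cmp D (fob F y) (fob F a) (fob F b) (fmap F a b f) (fmap F y a h) = zero_arr D (fob F y) (fob F b)"
      using Fc[OF y a b h f] fh F_zero[OF y b] by simp
    then obtain u where u: "u \<in> arr D (fob F y) x" "cmp D (fob F y) x (fob F a) k u = fmap F y a h"
      using fac[OF Fo[OF y] Fa[OF y a h]] by blast
    let ?u = "cmp C y (fob G (fob F y)) (fob G x) (fmap G (fob F y) x u) (\<eta>' y)"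
    have "cmp C y (fob G x) a ?k ?u = cmp C y (fob G (fob F a)) a (\<eta> a)
        (cmp C y (fob G (fob F y)) (fob G (fob F a)) (fmap G (fob F y) (fob F a) (fmap F y a h)) (\<eta>' y))"
      using a x y k u(1) by (simp add: C.cat_assoc closed Gc flip: u(2))
    then have "cmp C y (fob G x) a ?k ?u = h" using eta_conj[OF y a h] by simp
    moreover have "?u \<in> arr C y (fob G x)" using x y u(1) by (simp add: closed)
    ultimately show "\<exists>u. u \<in> arr C y (fob G x) \<and> cmp C y (fob G x) a ?k u = h" by blast
  qed
  then show "\<exists>x k. pseudokernel_of C a b f x k" by blast
qed

lemma transfer_pseudocokernels:
  assumes "has_pseudocokernels D"
  shows "has_pseudocokernels C"
  unfolding has_pseudocokernels_def
proof (intro ballI)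
  fix a b f assume a: "a \<in> obj C" and b: "b \<in> obj C" and f: "f \<in> arr C a b"
  obtain x k where "pseudocokernel_of D (fob F a) (fob F b) (fmap F a b f) x k"
    using assms Fo[OF a] Fo[OF b] Fa[OF a b f] unfolding has_pseudocokernels_def by blast
  then have x: "x \<in> obj D" and k: "k \<in> arr D (fob F b) x"
    and 0: "cmp D (fob F a) (fob F b) x k (fmap F a b f) = zero_arr D (fob F a) x"
    and fac: "\<And>y h. y \<in> obj D \<Longrightarrow> h \<in> arr D (fob F b) y \<Longrightarrow>
      cmp D (fob F a) (fob F b) y h (fmap F a b f) = zero_arr D (fob F a) y \<Longrightarrow>
      \<exists>u. u \<in> arr D x y \<and> cmp D (fob F b) x y u k = h"
    unfolding pseudocokernel_of_def pseudokernel_of_def opposite_simps by auto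
  let ?k = "cmp C b (fob G (fob F b)) (fob G x) (fmap G (fob F b) x k) (\<eta>' b)"
  have "pseudocokernel_of C a b f (fob G x) ?k"
    unfolding pseudocokernel_of_def pseudokernel_of_def opposite_simps
  proof (intro conjI ballI impI)
    show "fob G x \<in> obj C" "?k \<in> arr C b (fob G x)" using b x k by (simp_all add: closed)
    have "cmp C a b (fob G x) ?k f = cmp C a (fob G (fob F b)) (fob G x) (fmap G (fob F b) x k)
        (cmp C a (fob G (fob F a)) (fob G (fob F b)) (fmap G (fob F a) (fob F b) (fmap F a b f)) (\<eta>' a))"
      using a b x k f by (simp add: C.cat_assoc closed eta'_nat)
    also have "\<dots> = cmp C a (fob G (fob F a)) (fob G x)
        (fmap G (fob F a) x (cmp D (fob F a) (fob F b) x k (fmap F a b f))) (\<eta>' a)"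
      using a b x k f by (simp add: C.cat_assoc closed Gc)
    also have "\<dots> = zero_arr C a (fob G x)"
      unfolding 0 using a x by (simp add: G_zero closed C.cat_zero_left)
    finally show "cmp C a b (fob G x) ?k f = zero_arr C a (fob G x)" .
    fix y h assume y: "y \<in> obj C" and h: "h \<in> arr C b y" and hf: "cmp C a b y h f = zero_arr C a y"
    have "cmp D (fob F a) (fob F b) (fob F y) (fmap F b y h) (fmap F a b f) = zero_arr D (fob F a) (fob F y)"
      using Fc[OF a b y f h] hf F_zero[OF a y] by simp
    then obtain u where u: "u \<in> arr D x (fob F y)" "cmp D (fob F b) x (fob F y) u k = fmap F b y h"
      using fac[OF Fo[OF y] Fa[OF b y h]] by blast
    let ?u = "cmp C (fob G x) (fob G (fob F y)) y (\<eta> y) (fmap G x (fob F y) u)"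
    have "cmp C b (fob G x) y ?u ?k = cmp C b (fob G (fob F y)) y (\<eta> y)
        (cmp C b (fob G (fob F b)) (fob G (fob F y)) (fmap G (fob F b) (fob F y) (fmap F b y h)) (\<eta>' b))"
      using b x y k u(1) by (simp add: C.cat_assoc closed Gc flip: u(2))
    then have "cmp C b (fob G x) y ?u ?k = h" using eta_conj[OF b y h] by simp
    moreover have "?u \<in> arr C (fob G x) y" using x y u(1) by (simp add: closed)
    ultimately show "\<exists>u. u \<in> arr C (fob G x) y \<and> cmp C b (fob G x) y u ?k = h" by blast
  qed
  then show "\<exists>x k. pseudocokernel_of C a b f x k" by blast
qed

end

lemma skeleton_opposite:
  assumes "abelian_category A" and U: "universe I U" and small: "skeletally_small I A"
  obtains S r e e' where "skeleton (opposite A) S r e e' I U"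
proof -
  interpret abelian_category A by fact
  interpret op: preadditive_category "opposite A" by (rule preadditive_opposite)
  obtain S where S: "S \<subseteq> obj A" "\<And>a. a \<in> obj A \<Longrightarrow> \<exists>s\<in>S. \<exists>f. is_iso A a s f" "S \<lesssim> I"
    "\<And>a b. a \<in> S \<Longrightarrow> b \<in> S \<Longrightarrow> arr A a b \<lesssim> I"
    using small unfolding skeletally_small_def by blast
  have "\<forall>a\<in>obj A. \<exists>s f g. s \<in> S \<and> f \<in> arr A a s \<and> g \<in> arr A s a \<and>
      cmp A a s a g f = idt A a \<and> cmp A s a s f g = idt A s"
    using S(2) unfolding is_iso_def by blast
  then obtain r f g where r: "\<And>a. a \<in> obj A \<Longrightarrow> r a \<in> S \<and> f a \<in> arr A a (r a) \<and> g a \<in> arr A (r a) a \<and>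
      cmp A a (r a) a (g a) (f a) = idt A a \<and> cmp A (r a) a (r a) (f a) (g a) = idt A (r a)" by metis
  \<comment> \<open>In the opposite category the arrow from a to r a is g, the one that leads from r
    a to a in \<open>A\<close>; hence \<open>g\<close> comes before \<open>f\<close>.\<close>
  have "skeleton (opposite A) S r g f I U"
    by unfold_locales (use U S r in simp_all)
  then show ?thesis by (rule that)
qed

theorem proposition6p3:
  fixes I :: "'i set" and U :: "'u set set"
    and A :: "('a, 'b) category" and C :: "('o, 'm) category"
  assumes "universe I U"
    and "exactly_definable_via I U A C"
  shows "has_split_idempotents C \<and> has_pseudocokernels C \<and> has_pseudokernels C"
proof -
  have C: "additive_category C" and A: "abelian_category A" "skeletally_small I A"
    and eq: "equivalent_categories C (Ex U A)" using assms(2) by (auto simp: exactly_definable_via_def)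
  interpret C: additive_category C by fact
  obtain S r e e' where "skeleton (opposite A) S r e e' I U" using skeleton_opposite[OF A(1) assms(1) A(2)] .
  then interpret sk: skeleton "opposite A" S r e e' I U .
  have Ex: "Ex U A = sk.Exc" by (simp add: Ex_def sk.Exc_def)
  obtain F G where F: "is_functor C sk.Exc F" and G: "is_functor sk.Exc C G"
    and GF: "naturally_isomorphic C C (comp_functor G F) id_functor"
    and FG: "naturally_isomorphic sk.Exc sk.Exc (comp_functor F G) id_functor"
    using eq unfolding equivalent_categories_def Ex by blast
  obtain \<eta> where \<eta>: "nat_trans C C (comp_functor G F) id_functor \<eta>"
    "\<forall>a\<in>obj C. is_iso C (fob G (fob F a)) a (\<eta> a)"
    using GF unfolding naturally_isomorphic_def by (auto simp: comp_functor_def id_functor_def)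
  obtain \<epsilon> where \<epsilon>: "nat_trans sk.Exc sk.Exc (comp_functor F G) id_functor \<epsilon>"
    "\<forall>x\<in>obj sk.Exc. is_iso sk.Exc (fob F (fob G x)) x (\<epsilon> x)"
    using FG unfolding naturally_isomorphic_def by (auto simp: comp_functor_def id_functor_def)
  obtain \<eta>' where \<eta>': "\<And>a. a \<in> obj C \<Longrightarrow> \<eta>' a \<in> arr C a (fob G (fob F a)) \<and>
    cmp C (fob G (fob F a)) a (fob G (fob F a)) (\<eta>' a) (\<eta> a) = idt C (fob G (fob F a)) \<and>
    cmp C a (fob G (fob F a)) a (\<eta> a) (\<eta>' a) = idt C a"
    using \<eta>(2) unfolding is_iso_def by metis
  obtain \<epsilon>' where \<epsilon>': "\<And>x. x \<in> obj sk.Exc \<Longrightarrow> \<epsilon>' x \<in> arr sk.Exc x (fob F (fob G x)) \<and>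
    cmp sk.Exc x (fob F (fob G x)) x (\<epsilon> x) (\<epsilon>' x) = idt sk.Exc x"
    using \<epsilon>(2) unfolding is_iso_def by metis
  \<comment> \<open>The zero object of \<open>C\<close> is what lets the equivalence identify zero
    arrows on both sides.\<close>
  obtain z where z: "zero_object C z" using C.has_zero_object by blast
  interpret D: zero_category sk.Exc by (rule sk.zero_category_Exc)
  interpret C0: zero_category C by (rule C.zero_category)
  interpret category_equivalence C sk.Exc F G \<eta> \<eta>' \<epsilon> \<epsilon>' z
    by unfold_locales
      (use F G z \<eta> \<eta>' \<epsilon> \<epsilon>' in \<open>simp_all add: nat_trans_def is_iso_def comp_functor_def id_functor_def\<close>)
  show ?thesis
    using transfer_split_idempotents[OF sk.Exc_split_idempotents]
      transfer_pseudocokernels[OF sk.Exc_pseudocokernels] transfer_pseudokernels[OF sk.Exc_pseudokernels] by blast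
qed

end
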